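(* Let $\widehat\beta_n$ be the penalized estimator described in the context, where $\rho$ satisfies (R3): $\rho$ is twice continuously differentiable with $\psi=\rho'$ and $\psi'=\rho''$ bounded. Consider the penalty $$I_\lambda(\beta)=\lambda\Big\{(1-\alpha)\sum_{\ell=1}^pJ_\ell(|\beta_\ell|)+\alpha\sum_{\ell=1}^p|\beta_\ell|\Big\},$$ where $\alpha\in[0,1]$ and each $J_\ell$ is a continuously differentiable function (on $[0,\infty)$) such that $J_\ell'(0)=0$. Assume that: (H2) $w$ is a non-negative bounded function, with $\|w\|_\infty=1$, whose support $\mathcal{C}_w=\{x:w(x)>0\}$ satisfies $\mathbb{P}(x\in\mathcal{C}_w)>0$; (H3) $\mathbb{E}[w(x)\|x\|^2]<\infty$; (H4) the matrix $A$ is non-singular; and that $\sqrt n(\widehat\beta_n-\beta_0)=O_{\mathbb{P}}(1)$ and $\sqrt n\,\lambda_n\to b$ in probability. Then, if $\|\beta_0\|\ne0$, $$\sqrt n(\widehat\beta_n-\beta_0)\ \text{ converges in distribution to }\ \operatorname{argmin}_{z\in\mathbb{R}^p}R(z),$$ where the process $R:\mathbb{R}^p\to\mathbb{R}$ is $$R(z)=z^{T}\mathbf{w}+\tfrac12z^{T}Az+b\,z^{T}q(z),$$ with $\mathbf{w}\sim N_p(0,B)$ and $q(z)=(q_1(z),\dots,q_p(z))^{T}$, $$q_\ell(z)=(1-\alpha)J_\ell'(|\beta_{0,\ell}|)\operatorname{sign}(\beta_{0,\ell})+\alpha\big\{\operatorname{sign}(\beta_{0,\ell})\mathbf 1_{\{\beta_{0,\ell}\ne0\}}+\operatorname{sign}(z_\ell)\mathbf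 1_{\{\beta_{0,\ell}=0\}}\big\}.$$
   Context: Model: $p\ge1$ is fixed; $(y_i,x_i)$, $i\ge 1$, are i.i.d. copies of $(y,x)$ with $x\in\mathbb{R}^p$, $y\in\{0,1\}$ and $\mathbb{P}(y=1\mid x)=F(x^{T}\beta_0)$, where $F(t)=e^t/(1+e^t)$ and $\beta_0\in\mathbb{R}^p$. Loss: $\rho:[0,\infty)\to\mathbb{R}$ is a bounded, differentiable, nondecreasing function with derivative $\psi=\rho'$, and $$\phi(y,t)=y\,\rho(-\log F(t))+(1-y)\,\rho(-\log(1-F(t)))+G(F(t))+G(1-F(t)),\qquad G(t)=\int_0^t\psi(-\log u)\,du .$$ With $\nu(t)=\psi(-\log F(t))[1-F(t)]+\psi(-\log[1-F(t)])F(t)$, define $$A=\mathbb{E}\big(F(x^{T}\beta_0)[1-F(x^{T}\beta_0)]\nu(x^{T}\beta_0)w(x)xx^{T}\big),\quad B=\mathbb{E}\big(F(x^{T}\beta_0)[1-F(x^{T}\beta_0)]\nu^2(x^{T}\beta_0)w^2(x)xx^{T}\big).$$ Weight: $w:\mathbb{R}^p\to[0,\infty)$ measurable. $\lambda_n>0$ is a (possibly random) sequence of tuning parameters. $\operatorname{sign}(z)=z/|z|$ for $z\ne0$, $\operatorname{sign}(0)=0$. Estimator: $L_n(\beta)=\frac1n\sum_{i=1}^n\phi(y_i,x_i^{T}\beta)\,w(x_i)$ and $\widehat\beta_n$ is a minimizer, $\widehat\beta_n=\operatorname{argmin}_{\beta\in\mathbb{R}^p}\{L_n(\beta)+I_{\lambda_n}(\beta)\}$.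 *)

theory Defs
  imports "HOL-Probability.Probability"
begin

section \<open>Modes of convergence\<close>

definition conv_in_prob :: "'a measure \<Rightarrow> (nat \<Rightarrow> 'a \<Rightarrow> 'b::metric_space) \<Rightarrow> 'b \<Rightarrow> bool" where
  "conv_in_prob M X c \<longleftrightarrow>
    (\<forall>\<epsilon>>0. (\<lambda>n. measure M {\<omega> \<in> space M. dist (X n \<omega>) c > \<epsilon>}) \<longlonglongrightarrow> 0)"

definition bounded_in_prob :: "'a measure \<Rightarrow> (nat \<Rightarrow> 'a \<Rightarrow> 'b::real_normed_vector) \<Rightarrow> bool" where
  "bounded_in_prob M X \<longleftrightarrow>
    (\<forall>\<epsilon>>0. \<exists>K. \<forall>\<^sub>F n in sequentially. measure M {\<omega> \<in> space M. norm (X n \<omega>) > K} < \<epsilon>)"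

(* HOL-Probability defines weak convergence only for laws on the real line (weak_conv_m). The limit Z
   may live on a different probability space N, and its measurability is part of the claim. *)
definition conv_in_distr ::
    "'a measure \<Rightarrow> (nat \<Rightarrow> 'a \<Rightarrow> 'c::euclidean_space) \<Rightarrow> 'b measure \<Rightarrow> ('b \<Rightarrow> 'c) \<Rightarrow> bool" where
  "conv_in_distr M X N Z \<longleftrightarrow> Z \<in> borel_measurable N \<and>
    (\<forall>f :: 'c \<Rightarrow> real. continuous_on UNIV f \<longrightarrow> bounded (range f) \<longrightarrow>
       (\<lambda>n. \<integral>\<omega>. f (X n \<omega>) \<partial>M) \<longlonglongrightarrow> (\<integral>\<omega>. f (Z \<omega>) \<partial>N))"

(* W ~ N_p(0, S): every linear combination of the coordinates is a centred univariate normal with the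
   variance prescribed by S, a zero-variance normal being the point mass at 0. *)
definition centred_gaussian ::
    "'b measure \<Rightarrow> ('b \<Rightarrow> real^'p) \<Rightarrow> real^'p^'p \<Rightarrow> bool" where
  "centred_gaussian N W S \<longleftrightarrow> W \<in> borel_measurable N \<and> transpose S = S \<and>
    (\<forall>t. 0 \<le> t \<bullet> (S *v t) \<and>
         distr N borel (\<lambda>\<omega>. t \<bullet> W \<omega>) =
           (if t \<bullet> (S *v t) = 0 then return borel 0
            else density lborel (\<lambda>s. ennreal (normal_density 0 (sqrt (t \<bullet> (S *v t))) s))))"

section \<open>Loss function\<close>

definition logistic :: "real \<Rightarrow> real" where
  "logistic t = exp t / (1 + exp t)"

(* ln 0 = 0 in HOL, so the integrand is only meaningful for u > 0; a single point is negligible. *)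
definition G_corr :: "(real \<Rightarrow> real) \<Rightarrow> real \<Rightarrow> real" where
  "G_corr \<psi> t = integral {0..t} (\<lambda>u. \<psi> (- ln u))"

definition phi_loss :: "(real \<Rightarrow> real) \<Rightarrow> (real \<Rightarrow> real) \<Rightarrow> real \<Rightarrow> real \<Rightarrow> real" where
  "phi_loss \<rho> \<psi> y t =
     y * \<rho> (- ln (logistic t)) + (1 - y) * \<rho> (- ln (1 - logistic t))
     + G_corr \<psi> (logistic t) + G_corr \<psi> (1 - logistic t)"

definition nu :: "(real \<Rightarrow> real) \<Rightarrow> real \<Rightarrow> real" where
  "nu \<psi> t = \<psi> (- ln (logistic t)) * (1 - logistic t) + \<psi> (- ln (1 - logistic t)) * logistic t"

section \<open>Matrices, objective function and limiting process\<close>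

definition A_mat ::
    "'a measure \<Rightarrow> ('a \<Rightarrow> real^'p) \<Rightarrow> (real \<Rightarrow> real) \<Rightarrow> (real^'p \<Rightarrow> real) \<Rightarrow> real^'p \<Rightarrow> real^'p^'p" where
  "A_mat M x \<psi> w \<beta>0 = (\<chi> i j. \<integral>\<omega>.
     logistic (x \<omega> \<bullet> \<beta>0) * (1 - logistic (x \<omega> \<bullet> \<beta>0)) * nu \<psi> (x \<omega> \<bullet> \<beta>0) * w (x \<omega>)
       * (x \<omega> $ i * x \<omega> $ j) \<partial>M)"

definition B_mat ::
    "'a measure \<Rightarrow> ('a \<Rightarrow> real^'p) \<Rightarrow> (real \<Rightarrow> real) \<Rightarrow> (real^'p \<Rightarrow> real) \<Rightarrow> real^'p \<Rightarrow> real^'p^'p" where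
  "B_mat M x \<psi> w \<beta>0 = (\<chi> i j. \<integral>\<omega>.
     logistic (x \<omega> \<bullet> \<beta>0) * (1 - logistic (x \<omega> \<bullet> \<beta>0)) * (nu \<psi> (x \<omega> \<bullet> \<beta>0))\<^sup>2 * (w (x \<omega>))\<^sup>2
       * (x \<omega> $ i * x \<omega> $ j) \<partial>M)"

definition emp_loss ::
    "(real \<Rightarrow> real) \<Rightarrow> (real \<Rightarrow> real) \<Rightarrow> (real^'p \<Rightarrow> real) \<Rightarrow> (nat \<Rightarrow> real) \<Rightarrow> (nat \<Rightarrow> real^'p)
      \<Rightarrow> nat \<Rightarrow> real^'p \<Rightarrow> real" where
  "emp_loss \<rho> \<psi> w y x n \<beta> = (1 / real n) * (\<Sum>i=1..n. phi_loss \<rho> \<psi> (y i) (x i \<bullet> \<beta>) * w (x i))"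

definition penalty ::
    "real \<Rightarrow> ('p \<Rightarrow> real \<Rightarrow> real) \<Rightarrow> real \<Rightarrow> real^'p \<Rightarrow> real" where
  "penalty \<alpha> J l \<beta> =
     l * ((1 - \<alpha>) * (\<Sum>k\<in>UNIV. J k \<bar>\<beta> $ k\<bar>) + \<alpha> * (\<Sum>k\<in>UNIV. \<bar>\<beta> $ k\<bar>))"

definition q_vec ::
    "real \<Rightarrow> ('p \<Rightarrow> real \<Rightarrow> real) \<Rightarrow> real^'p \<Rightarrow> real^'p \<Rightarrow> real^'p" where
  "q_vec \<alpha> J' \<beta>0 z = (\<chi> k.
     (1 - \<alpha>) * J' k \<bar>\<beta>0 $ k\<bar> * sgn (\<beta>0 $ k)
     + \<alpha> * (sgn (\<beta>0 $ k) * of_bool (\<beta>0 $ k \<noteq> 0) + sgn (z $ k) * of_bool (\<beta>0 $ k = 0)))"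

definition R_proc ::
    "real^'p^'p \<Rightarrow> real \<Rightarrow> real \<Rightarrow> ('p \<Rightarrow> real \<Rightarrow> real) \<Rightarrow> real^'p \<Rightarrow> real^'p \<Rightarrow> real^'p \<Rightarrow> real" where
  "R_proc A b \<alpha> J' \<beta>0 W z = z \<bullet> W + 1/2 * (z \<bullet> (A *v z)) + b * (z \<bullet> q_vec \<alpha> J' \<beta>0 z)"

end

theory Submission
  imports Defs
begin

text \<open>
  In the local parameter \<open>z = \<surd>n (\<beta> - \<beta>0)\<close> the centred objective \<open>n (L\<^sub>n + I\<^sub>\<lambda>)\<close> is, uniformly on bounded sets and up
  to a remainder tending to 0 in probability, the process \<open>R\<close> with \<open>W\<close> replaced by the normalised score
  \<open>V\<^sub>n\<close>: the linear term is \<open>V\<^sub>n\<close>, the Hessian converges by the weak law of large numbers, and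
  the penalty is differentiable along rays. Since \<open>A\<close> is positive definite and \<open>b \<ge> 0\<close>, \<open>R\<close> is strongly
  convex, so its minimiser \<open>m\<close> is a Lipschitz function of the linear term, and a near minimiser of \<open>R\<close> is
  close to it. Hence \<open>\<surd>n (\<beta>hat - \<beta>0) - m(V\<^sub>n)\<close> tends to 0 in probability, although the objective itself need
  not be convex. No weak convergence of processes is needed: \<open>V\<^sub>n\<close> converges to \<open>W\<close> by the multivariate
  central limit theorem, and the continuous mapping theorem and Slutsky's lemma give the claim.
\<close>

section \<open>Events of high probability and convergence in distribution\<close>

text \<open>The objective is not convex, so its expansion on a ball says nothing about minimisers
  far away: the assumed root-n rate confines \<open>\<beta>hat\<close>, tightness confines
  \<open>m(V\<^sub>n)\<close>, and the two are compared on one ball. Both signs behind strong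
  convexity are inherited: \<open>nu\<close> is nonnegative because \<open>\<rho>\<close> is
  nondecreasing, so \<open>A\<close> is a Gram form, which invertibility makes definite; and
  \<open>b\<close> is a limit of nonnegative variables. The delicate estimate is the Hessian
  remainder. Covariates of norm at most \<open>T\<close> are treated by uniform continuity, the
  others by a bound on \<open>score'\<close> and the small tail of the weighted second
  moment.\<close>

text \<open>
  For all large \<open>n\<close>, \<open>P n\<close> holds off an event of probability at most \<open>\<eta>\<close>. Asking only for a measurable exceptional
  set allows predicates that quantify over uncountably many parameters and are not known to be measurable.
\<close>

definition likely :: "'a measure \<Rightarrow> real \<Rightarrow> (nat \<Rightarrow> 'a \<Rightarrow> bool) \<Rightarrow> bool" where
  "likely M \<eta> P \<longleftrightarrow>
    (\<forall>\<^sub>F n in sequentially. \<exists>S\<in>sets M. measure M S \<le> \<eta> \<and> (\<forall>\<omega>\<in>space M - S. P n \<omega>))"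

lemma likely_mono:
  assumes "likely M \<eta> P" "\<forall>\<^sub>F n in sequentially. \<forall>\<omega>\<in>space M. P n \<omega> \<longrightarrow> Q n \<omega>" "\<eta> \<le> \<eta>'"
  shows "likely M \<eta>' Q"
  using assms(1,2) unfolding likely_def
  by eventually_elim (use assms(3) in \<open>force intro: order_trans\<close>)

lemma likely_conj:
  assumes "likely M \<eta> P" "likely M \<eta>' Q" "finite_measure M"
  shows "likely M (\<eta> + \<eta>') (\<lambda>n \<omega>. P n \<omega> \<and> Q n \<omega>)"
  using assms(1,2) unfolding likely_def
proof eventually_elim
  case (elim n)
  then obtain S T where S: "S \<in> sets M" "measure M S \<le> \<eta>" "\<forall>\<omega>\<in>space M - S. P n \<omega>"
    and T: "T \<in> sets M" "measure M T \<le> \<eta>'" "\<forall>\<omega>\<in>space M - T. Q n \<omega>" by blast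
  have "measure M (S \<union> T) \<le> \<eta> + \<eta>'"
    using measure_subadditive[OF S(1) T(1)] finite_measure.emeasure_finite[OF assms(3)] S T by force
  then show ?case using S T by (intro bexI[of _ "S \<union> T"]) auto
qed

text \<open>Levels add under conjunction, so each conjunct is required at every positive level: the
  induction spends half of the level on the new index and half on the rest.\<close>

lemma likely_ball:
  assumes "finite I" "finite_measure M" and "\<And>i \<eta>. i \<in> I \<Longrightarrow> \<eta> > 0 \<Longrightarrow> likely M \<eta> (P i)" and "\<eta> > 0"
  shows "likely M \<eta> (\<lambda>n \<omega>. \<forall>i\<in>I. P i n \<omega>)"
  using assms(1,3,4)
proof (induction I arbitrary: \<eta> rule: finite_induct)
  case empty
  then show ?case unfolding likely_def by (intro always_eventually) (auto intro!: bexI[of _ "{}"])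
next
  case (insert i I)
  have "likely M (\<eta>/2 + \<eta>/2) (\<lambda>n \<omega>. P i n \<omega> \<and> (\<forall>i\<in>I. P i n \<omega>))"
    using insert by (intro likely_conj assms(2)) auto
  then show ?case by simp
qed

lemma likely_AE:
  assumes "\<And>n. n \<ge> 1 \<Longrightarrow> AE \<omega> in M. P n \<omega>" "\<eta> \<ge> 0"
  shows "likely M \<eta> P"
  unfolding likely_def
proof (rule eventually_sequentiallyI[of 1])
  fix n :: nat assume "n \<ge> 1"
  from AE_E[OF assms(1)[OF this]] obtain S
    where "{\<omega> \<in> space M. \<not> P n \<omega>} \<subseteq> S" "emeasure M S = 0" "S \<in> sets M" by blast
  then show "\<exists>S\<in>sets M. measure M S \<le> \<eta> \<and> (\<forall>\<omega>\<in>space M - S. P n \<omega>)"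
    using assms(2) by (intro bexI[of _ S]) (auto simp: measure_def)
qed

lemma likely_of_measure:
  assumes "\<And>n. n \<ge> 1 \<Longrightarrow> {\<omega>\<in>space M. \<not> P n \<omega>} \<in> sets M"
    and "\<forall>\<^sub>F n in sequentially. measure M {\<omega>\<in>space M. \<not> P n \<omega>} \<le> \<eta>"
  shows "likely M \<eta> P"
  using assms(2) eventually_ge_at_top[of 1] unfolding likely_def
  by eventually_elim (use assms(1) in \<open>auto intro!: bexI[of _ "{\<omega>\<in>space M. \<not> P _ \<omega>}"]\<close>)

lemma likely_Markov:
  assumes "prob_space M" and [measurable]: "\<And>n. D n \<in> borel_measurable M"
    and "\<And>n. integrable M (D n)" "\<And>n \<omega>. 0 \<le> D n \<omega>"
    and "\<forall>\<^sub>F n in sequentially. (\<integral>\<omega>. D n \<omega> \<partial>M) \<le> \<eta> * \<epsilon>" and "\<epsilon> > 0"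
  shows "likely M \<eta> (\<lambda>n \<omega>. D n \<omega> < \<epsilon>)"
proof (rule likely_of_measure)
  show "\<forall>\<^sub>F n in sequentially. measure M {\<omega> \<in> space M. \<not> D n \<omega> < \<epsilon>} \<le> \<eta>"
    using assms(5)
  proof eventually_elim
    case (elim n)
    have "measure M {\<omega> \<in> space M. \<epsilon> \<le> D n \<omega>} \<le> (\<integral>\<omega>. D n \<omega> \<partial>M) / \<epsilon>"
      by (rule integral_Markov_inequality_measure[where A="{}"]) (use assms in auto)
    also have "\<dots> \<le> \<eta>" using elim \<open>\<epsilon> > 0\<close> by (simp add: divide_simps)
    finally show ?case by (simp add: not_less)
  qed
qed (use assms in measurable)

lemma conv_in_prob_likely:
  assumes "conv_in_prob M X c" "\<And>n. n \<ge> 1 \<Longrightarrow> X n \<in> borel_measurable M" "\<epsilon> > 0" "\<eta> > 0"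
  shows "likely M \<eta> (\<lambda>n \<omega>. dist (X n \<omega>) (c::'c::{metric_space, second_countable_topology}) \<le> \<epsilon>)"
proof (rule likely_of_measure)
  have "(\<lambda>n. measure M {\<omega> \<in> space M. dist (X n \<omega>) c > \<epsilon>}) \<longlonglongrightarrow> 0"
    using assms by (auto simp: conv_in_prob_def)
  from order_tendstoD(2)[OF this \<open>\<eta> > 0\<close>]
  show "\<forall>\<^sub>F n in sequentially. measure M {\<omega> \<in> space M. \<not> dist (X n \<omega>) c \<le> \<epsilon>} \<le> \<eta>"
    by eventually_elim (simp add: not_le)
next
  fix n :: nat assume "n \<ge> 1"
  note [measurable] = assms(2)[OF this]
  show "{\<omega> \<in> space M. \<not> dist (X n \<omega>) c \<le> \<epsilon>} \<in> sets M" by measurable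
qed

lemma bounded_in_prob_likely:
  assumes "bounded_in_prob M X" "\<And>n. n \<ge> 1 \<Longrightarrow> X n \<in> borel_measurable M" "\<eta> > 0"
  obtains K where "likely M \<eta> (\<lambda>n \<omega>. norm (X n \<omega> :: 'c::euclidean_space) \<le> K)"
proof -
  obtain K where K: "\<forall>\<^sub>F n in sequentially. measure M {\<omega> \<in> space M. norm (X n \<omega>) > K} < \<eta>"
    using assms by (auto simp: bounded_in_prob_def)
  have "likely M \<eta> (\<lambda>n \<omega>. norm (X n \<omega>) \<le> K)"
  proof (rule likely_of_measure)
    show "\<forall>\<^sub>F n in sequentially. measure M {\<omega> \<in> space M. \<not> norm (X n \<omega>) \<le> K} \<le> \<eta>"
      using K by eventually_elim (simp add: not_le)
  next
    fix n :: nat assume "n \<ge> 1"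
    note [measurable] = assms(2)[OF this]
    show "{\<omega> \<in> space M. \<not> norm (X n \<omega>) \<le> K} \<in> sets M" by measurable
  qed
  then show ?thesis using that by blast
qed

section \<open>Bounded test functions, tightness and Slutsky's lemma\<close>

lemma (in prob_space) expectation_le_likely:
  assumes S: "S \<in> sets M" "prob S \<le> \<eta>" and f: "f \<in> borel_measurable M"
    and "\<And>\<omega>. \<omega> \<in> space M - S \<Longrightarrow> \<bar>f \<omega>\<bar> \<le> \<epsilon>" "\<And>\<omega>. \<bar>f \<omega>\<bar> \<le> C" "\<epsilon> \<ge> 0"
  shows "\<bar>expectation f\<bar> \<le> \<epsilon> + C * \<eta>"
proof -
  have C: "C \<ge> 0" using assms(5)[of undefined] by linarith
  have int: "integrable M f"
    by (rule integrable_const_bound[of _ C]) (use assms in auto)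
  have "\<bar>expectation f\<bar> \<le> expectation (\<lambda>\<omega>. \<bar>f \<omega>\<bar>)" by (rule integral_abs_bound)
  also have "\<dots> \<le> expectation (\<lambda>\<omega>. \<epsilon> + C * indicator S \<omega>)"
  proof (rule integral_mono_AE)
    show "AE \<omega> in M. \<bar>f \<omega>\<bar> \<le> \<epsilon> + C * indicator S \<omega>"
      by (rule AE_I2) (use assms C in \<open>auto simp: indicator_def intro: order_trans[of _ C]\<close>)
  qed (use int S in \<open>auto simp: emeasure_eq_measure intro!: integrable_real_indicator\<close>)
  also have "\<dots> = \<epsilon> + C * prob S" using S
    by (subst Bochner_Integration.integral_add)
       (auto simp: emeasure_eq_measure prob_space intro!: integrable_real_indicator)
  also have "\<dots> \<le> \<epsilon> + C * \<eta>" using S C by (simp add: mult_left_mono)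
  finally show ?thesis .
qed

text \<open>The passage from closeness in probability to closeness of integrals of test functions.
  On the exceptional event the difference is controlled only by \<open>2 * C\<close>.\<close>

lemma likely_expectation_diff:
  fixes f g :: "nat \<Rightarrow> 'a \<Rightarrow> real"
  assumes "prob_space M" "\<And>n. n \<ge> 1 \<Longrightarrow> f n \<in> borel_measurable M" "\<And>n. n \<ge> 1 \<Longrightarrow> g n \<in> borel_measurable M"
    and "\<And>n \<omega>. \<bar>f n \<omega>\<bar> \<le> C" "\<And>n \<omega>. \<bar>g n \<omega>\<bar> \<le> C"
    and "likely M \<eta> (\<lambda>n \<omega>. \<bar>f n \<omega> - g n \<omega>\<bar> \<le> \<epsilon>)" "\<epsilon> \<ge> 0"
  shows "\<forall>\<^sub>F n in sequentially. \<bar>(\<integral>\<omega>. f n \<omega> \<partial>M) - (\<integral>\<omega>. g n \<omega> \<partial>M)\<bar> \<le> \<epsilon> + 2 * C * \<eta>"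
  using assms(6) eventually_ge_at_top[of 1] unfolding likely_def
proof eventually_elim
  case (elim n)
  interpret prob_space M by fact
  note [measurable] = assms(2)[OF \<open>1 \<le> n\<close>] assms(3)[OF \<open>1 \<le> n\<close>]
  from elim obtain S where S: "S \<in> sets M" "prob S \<le> \<eta>" "\<And>\<omega>. \<omega> \<in> space M - S \<Longrightarrow> \<bar>f n \<omega> - g n \<omega>\<bar> \<le> \<epsilon>"
    by blast
  have int: "integrable M (f n)" "integrable M (g n)"
    by (rule integrable_const_bound[of _ C]; use assms in auto)+
  have "\<bar>expectation (\<lambda>\<omega>. f n \<omega> - g n \<omega>)\<bar> \<le> \<epsilon> + (2 * C) * \<eta>"
  proof (rule expectation_le_likely[OF S(1,2) _ S(3)])
    show "\<bar>f n \<omega> - g n \<omega>\<bar> \<le> 2 * C" for \<omega> using assms(4)[of n \<omega>] assms(5)[of n \<omega>] by linarith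
  qed (use assms in auto)
  then show ?case using int by simp
qed

lemma conv_in_distr_borel_measurable:
  "conv_in_distr M X N Z \<Longrightarrow> Z \<in> borel_measurable N"
  by (simp add: conv_in_distr_def)

text \<open>Convergence in distribution tests continuous functions only, so the indicator of the
  complement of a ball is replaced by a ramp \<open>h k\<close> that rises from 0 at radius
  \<open>k\<close> to 1 at radius \<open>k + 1\<close>. Dominated convergence chooses
  \<open>k\<close> from the limit law alone, and the same \<open>k\<close> then serves all large
  \<open>n\<close>.\<close>

lemma conv_in_distr_tight:
  fixes Z :: "'b \<Rightarrow> 'c::euclidean_space"
  assumes "prob_space M" "prob_space N" "\<And>n. n \<ge> 1 \<Longrightarrow> X n \<in> borel_measurable M"
    and conv: "conv_in_distr M X N Z" and "\<eta> > 0"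
  obtains K where "likely M \<eta> (\<lambda>n \<omega>. norm (X n \<omega>) \<le> K)"
proof -
  interpret N: prob_space N by fact
  interpret prob_space M by fact
  note [measurable] = conv_in_distr_borel_measurable[OF conv]
  define h where "h k u = min 1 (max 0 (norm u - k))" for k :: real and u :: 'c
  have hc: "continuous_on UNIV (h k)" for k unfolding h_def by (intro continuous_intros)
  have hm [measurable]: "h k \<in> borel_measurable borel" for k
    using hc by (rule borel_measurable_continuous_onI)
  have hb: "0 \<le> h k u" "h k u \<le> 1" "\<bar>h k u\<bar> \<le> 1" for k u by (auto simp: h_def)
  have "(\<lambda>k. \<integral>\<omega>. h (real k) (Z \<omega>) \<partial>N) \<longlonglongrightarrow> (\<integral>\<omega>. 0 \<partial>N)"
  proof (rule integral_dominated_convergence[where w="\<lambda>_. 1"])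
    show "AE \<omega> in N. (\<lambda>k. h (real k) (Z \<omega>)) \<longlonglongrightarrow> 0"
    proof (rule AE_I2)
      fix \<omega>
      obtain k0 :: nat where "norm (Z \<omega>) \<le> k0" using real_arch_simple by blast
      then have "\<forall>\<^sub>F k in sequentially. h (real k) (Z \<omega>) = 0"
        by (intro eventually_sequentiallyI[of k0]) (auto simp: h_def)
      then show "(\<lambda>k. h (real k) (Z \<omega>)) \<longlonglongrightarrow> 0" by (rule tendsto_eventually)
    qed
  qed (use hb in auto)
  then have "\<forall>\<^sub>F k in sequentially. (\<integral>\<omega>. h (real k) (Z \<omega>) \<partial>N) < \<eta>"
    using \<open>\<eta> > 0\<close> by (intro order_tendstoD) auto
  then obtain k where k: "(\<integral>\<omega>. h (real k) (Z \<omega>) \<partial>N) < \<eta>" by (auto simp: eventually_sequentially)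
  have ind: "indicator {u. norm u > real k + 1} u \<le> h k u" for u
    by (auto simp: h_def indicator_def)
  have bnd: "measure L {\<omega>\<in>space L. norm (V \<omega>) > real k + 1} \<le> (\<integral>\<omega>. h k (V \<omega>) \<partial>L)"
    if "prob_space L" and V[measurable]: "V \<in> borel_measurable L" for L :: "'d measure" and V
  proof -
    interpret L: prob_space L by fact
    have "measure L {\<omega>\<in>space L. norm (V \<omega>) > real k + 1} = (\<integral>\<omega>. indicator {u. norm u > real k + 1} (V \<omega>) \<partial>L)"
      by (subst Bochner_Integration.integral_cong[where g="indicator {\<omega>\<in>space L. norm (V \<omega>) > real k + 1}"])
         (auto simp: indicator_def)
    also have "\<dots> \<le> (\<integral>\<omega>. h k (V \<omega>) \<partial>L)"
      by (intro integral_mono L.integrable_const_bound[of _ 1] ind)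
         (use hb in \<open>auto simp: indicator_def\<close>)
    finally show ?thesis .
  qed
  have "(\<lambda>n. \<integral>\<omega>. h k (X n \<omega>) \<partial>M) \<longlonglongrightarrow> (\<integral>\<omega>. h k (Z \<omega>) \<partial>N)"
    using conv hc[of "real k"] hb(3)[of "real k"] unfolding conv_in_distr_def bounded_iff by auto
  from order_tendstoD(2)[OF this k]
  have ev: "\<forall>\<^sub>F n in sequentially. measure M {\<omega>\<in>space M. \<not> norm (X n \<omega>) \<le> real k + 1} \<le> \<eta>"
    using eventually_ge_at_top[of 1]
  proof eventually_elim
    case (elim n)
    show ?case using bnd[OF \<open>prob_space M\<close> assms(3)[OF elim(2)]] elim by (simp add: not_le)
  qed
  show ?thesis
  proof (rule that[of "real k + 1"])
    show "likely M \<eta> (\<lambda>n \<omega>. norm (X n \<omega>) \<le> real k + 1)"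
    proof (rule likely_of_measure[OF _ ev])
      fix n :: nat assume "1 \<le> n"
      note [measurable] = assms(3)[OF this]
      show "{\<omega> \<in> space M. \<not> norm (X n \<omega>) \<le> real k + 1} \<in> events" by measurable
    qed
  qed
qed

text \<open>A continuous test function is uniformly continuous only on compact sets. Tightness puts
  \<open>X n\<close> in the ball of radius \<open>K\<close>, and a distance of at most 1 keeps
  \<open>X' n\<close> in the ball of radius \<open>K + 1\<close>.\<close>

lemma slutsky:
  fixes Z :: "'b \<Rightarrow> 'c::euclidean_space"
  assumes "prob_space M" "prob_space N"
    and X: "\<And>n. n \<ge> 1 \<Longrightarrow> X n \<in> borel_measurable M" and X': "\<And>n. n \<ge> 1 \<Longrightarrow> X' n \<in> borel_measurable M"
    and conv: "conv_in_distr M X N Z"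
    and close: "\<And>\<epsilon> \<eta>. \<epsilon> > 0 \<Longrightarrow> \<eta> > 0 \<Longrightarrow> likely M \<eta> (\<lambda>n \<omega>. dist (X' n \<omega>) (X n \<omega>) \<le> \<epsilon>)"
  shows "conv_in_distr M X' N Z"
  unfolding conv_in_distr_def
proof (intro conjI allI impI)
  show "Z \<in> borel_measurable N" using conv by (rule conv_in_distr_borel_measurable)
  fix f :: "'c \<Rightarrow> real" assume cont: "continuous_on UNIV f" and "bounded (range f)"
  then obtain C where C: "\<And>u. \<bar>f u\<bar> \<le> C" "C > 0" by (auto simp: bounded_pos)
  have [measurable]: "f \<in> borel_measurable borel" using cont by (rule borel_measurable_continuous_onI)
  have lim: "(\<lambda>n. \<integral>\<omega>. f (X n \<omega>) \<partial>M) \<longlonglongrightarrow> (\<integral>\<omega>. f (Z \<omega>) \<partial>N)"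
    using conv cont \<open>bounded (range f)\<close> by (simp add: conv_in_distr_def)
  have "(\<lambda>n. (\<integral>\<omega>. f (X' n \<omega>) \<partial>M) - (\<integral>\<omega>. f (X n \<omega>) \<partial>M)) \<longlonglongrightarrow> 0"
  proof (rule tendstoI)
    fix e :: real assume "e > 0"
    \<comment> \<open>Two exceptional events of level \<open>\<eta>\<close>, weighted by
      \<open>2 * C\<close>, cost \<open>e / 4\<close>; the modulus of continuity costs
      \<open>e / 2\<close>, and the sum stays below \<open>e\<close>.\<close>
    define \<eta> where "\<eta> = e / (16 * C)"
    have \<eta>: "\<eta> > 0" "2 * C * (\<eta> + \<eta>) = e / 4" using \<open>e > 0\<close> \<open>C > 0\<close> by (auto simp: \<eta>_def)
    obtain K where K: "likely M \<eta> (\<lambda>n \<omega>. norm (X n \<omega>) \<le> K)"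
      by (rule conv_in_distr_tight[OF assms(1,2) X conv \<eta>(1)])
    have "uniformly_continuous_on (cball 0 (K + 1)) f"
      by (intro compact_uniformly_continuous continuous_on_subset[OF cont]) auto
    then obtain d where d: "d > 0" "\<And>u v. u \<in> cball 0 (K+1) \<Longrightarrow> v \<in> cball 0 (K+1) \<Longrightarrow> dist v u < d \<Longrightarrow> dist (f v) (f u) < e/2"
      unfolding uniformly_continuous_on_def using \<open>e > 0\<close> by (meson half_gt_zero)
    have "likely M \<eta> (\<lambda>n \<omega>. dist (X' n \<omega>) (X n \<omega>) \<le> min 1 (d/2))"
      using d \<eta> by (intro close) auto
    then have "likely M (\<eta> + \<eta>) (\<lambda>n \<omega>. norm (X n \<omega>) \<le> K \<and> dist (X' n \<omega>) (X n \<omega>) \<le> min 1 (d/2))"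
      using K assms(1) by (intro likely_conj) (auto intro: prob_space.finite_measure)
    then have "likely M (\<eta> + \<eta>) (\<lambda>n \<omega>. \<bar>f (X' n \<omega>) - f (X n \<omega>)\<bar> \<le> e/2)"
    proof (rule likely_mono, intro always_eventually allI ballI impI)
      fix n \<omega> assume *: "norm (X n \<omega>) \<le> K \<and> dist (X' n \<omega>) (X n \<omega>) \<le> min 1 (d/2)"
      then have "norm (X' n \<omega>) \<le> K + 1"
        using norm_triangle_sub[of "X' n \<omega>" "X n \<omega>"] by (auto simp: dist_norm)
      then show "\<bar>f (X' n \<omega>) - f (X n \<omega>)\<bar> \<le> e/2"
        using * d(1) d(2)[of "X n \<omega>" "X' n \<omega>"] by (auto simp: dist_real_def)
    qed simp
    then have "\<forall>\<^sub>F n in sequentially. \<bar>(\<integral>\<omega>. f (X' n \<omega>) \<partial>M) - (\<integral>\<omega>. f (X n \<omega>) \<partial>M)\<bar> \<le> e/2 + 2 * C * (\<eta> + \<eta>)"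
      using C \<open>e > 0\<close> X X' by (intro likely_expectation_diff assms) auto
    then show "\<forall>\<^sub>F n in sequentially. dist ((\<integral>\<omega>. f (X' n \<omega>) \<partial>M) - (\<integral>\<omega>. f (X n \<omega>) \<partial>M)) 0 < e"
      by eventually_elim (use \<open>e > 0\<close> \<eta> in auto)
  qed
  from tendsto_add[OF this lim] show "(\<lambda>n. \<integral>\<omega>. f (X' n \<omega>) \<partial>M) \<longlonglongrightarrow> (\<integral>\<omega>. f (Z \<omega>) \<partial>N)"
    by simp
qed

lemma conv_in_distr_continuous:
  assumes "conv_in_distr M X N Z" "continuous_on UNIV m"
  shows "conv_in_distr M (\<lambda>n \<omega>. m (X n \<omega>)) N (\<lambda>\<omega>. m (Z \<omega>))"
  unfolding conv_in_distr_def
proof (intro conjI allI impI)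
  show "(\<lambda>\<omega>. m (Z \<omega>)) \<in> borel_measurable N"
    using borel_measurable_continuous_onI[OF assms(2)] conv_in_distr_borel_measurable[OF assms(1)] by measurable
next
  fix f :: "'d \<Rightarrow> real" assume f: "continuous_on UNIV f" "bounded (range f)"
  have "continuous_on UNIV (f \<circ> m)" "bounded (range (f \<circ> m))"
    using f assms(2) continuous_on_compose2[of UNIV f UNIV m]
    by (auto intro: bounded_subset simp: comp_def)
  then show "(\<lambda>n. \<integral>\<omega>. f (m (X n \<omega>)) \<partial>M) \<longlonglongrightarrow> (\<integral>\<omega>. f (m (Z \<omega>)) \<partial>N)"
    using assms(1) by (fastforce simp: conv_in_distr_def comp_def)
qed

section \<open>The Cramer--Wold device\<close>

text \<open>In the Cramer--Wold argument tightness is known only for projections. The l1 bound on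
  the norm combines them; partial sums are treated at an arbitrary level so that it can be halved at
  each new coordinate.\<close>

lemma likely_coordinates:
  fixes V :: "nat \<Rightarrow> 'a \<Rightarrow> 'c::euclidean_space"
  assumes "finite_measure M" and "\<eta> > 0"
    and coord: "\<And>b \<eta>. b \<in> Basis \<Longrightarrow> \<eta> > 0 \<Longrightarrow> \<exists>K. likely M \<eta> (\<lambda>n \<omega>. norm (b \<bullet> V n \<omega>) \<le> K)"
  shows "\<exists>K. likely M \<eta> (\<lambda>n \<omega>. norm (V n \<omega>) \<le> K)"
proof -
  have "\<exists>K. likely M \<eta> (\<lambda>n \<omega>. (\<Sum>b\<in>I. \<bar>V n \<omega> \<bullet> b\<bar>) \<le> K)" if "finite I" "I \<subseteq> Basis" "\<eta> > 0" for I \<eta>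
    using that
  proof (induction I arbitrary: \<eta> rule: finite_induct)
    case empty
    then show ?case using likely_AE[where P="\<lambda>n \<omega>. (\<Sum>b\<in>{}. \<bar>V n \<omega> \<bullet> b\<bar>) \<le> 0"] by (intro exI[of _ 0]) auto
  next
    case (insert b I)
    obtain K1 where K1: "likely M (\<eta>/2) (\<lambda>n \<omega>. (\<Sum>b\<in>I. \<bar>V n \<omega> \<bullet> b\<bar>) \<le> K1)"
      using insert.IH[of "\<eta>/2"] insert.prems by auto
    obtain K2 where K2: "likely M (\<eta>/2) (\<lambda>n \<omega>. norm (b \<bullet> V n \<omega>) \<le> K2)"
      using coord[of b "\<eta>/2"] insert.prems by auto
    have "likely M (\<eta>/2 + \<eta>/2) (\<lambda>n \<omega>. (\<Sum>b\<in>insert b I. \<bar>V n \<omega> \<bullet> b\<bar>) \<le> K1 + K2)"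
      by (rule likely_mono[OF likely_conj[OF K1 K2 assms(1)]])
         (use insert.hyps in \<open>auto simp: inner_commute\<close>)
    then show ?case by auto
  qed
  from this[OF finite_Basis order_refl assms(2)] obtain K
    where "likely M \<eta> (\<lambda>n \<omega>. (\<Sum>b\<in>Basis. \<bar>V n \<omega> \<bullet> b\<bar>) \<le> K)" by blast
  then have "likely M \<eta> (\<lambda>n \<omega>. norm (V n \<omega>) \<le> K)"
    by (rule likely_mono) (auto intro!: always_eventually order_trans[OF norm_le_l1])
  then show ?thesis by blast
qed

text \<open>The real span of the real and imaginary parts of the characters of the space. Each
  generator depends on one projection of its argument. Products are not a constructor, because
  convergence of expectations passes through linear combinations but not through products; the
  closure under products that Stone--Weierstrass requires comes from the product-to-sum
  formulas.\<close>

inductive trig_poly :: "('a::real_inner \<Rightarrow> real) \<Rightarrow> bool" where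
  cos: "trig_poly (\<lambda>u. cos (t \<bullet> u))"
| sin: "trig_poly (\<lambda>u. sin (t \<bullet> u))"
| add: "trig_poly f \<Longrightarrow> trig_poly g \<Longrightarrow> trig_poly (\<lambda>u. f u + g u)"
| scale: "trig_poly f \<Longrightarrow> trig_poly (\<lambda>u. c * f u)"

lemma trig_poly_const: "trig_poly (\<lambda>_. c)"
  using trig_poly.scale[OF trig_poly.cos[of 0], of c] by simp

lemma trig_poly_cos_mult:
  assumes "trig_poly g" shows "trig_poly (\<lambda>u. cos (s \<bullet> u) * g u)"
  using assms
proof induction
  case (cos t)
  have "cos (s \<bullet> u) * cos (t \<bullet> u) = 1/2 * cos ((s - t) \<bullet> u) + 1/2 * cos ((s + t) \<bullet> u)" for u
    by (simp add: inner_diff_left inner_add_left cos_add cos_diff field_simps)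
  then show ?case by (simp only:) (intro trig_poly.intros)
next
  case (sin t)
  have "cos (s \<bullet> u) * sin (t \<bullet> u) = 1/2 * sin ((s + t) \<bullet> u) + (-1/2) * sin ((s - t) \<bullet> u)" for u
    by (simp add: inner_diff_left inner_add_left sin_add sin_diff field_simps)
  then show ?case by (simp only:) (intro trig_poly.intros)
next
  case (add f g)
  then show ?case by (auto simp: distrib_left intro: trig_poly.intros)
next
  case (scale f c)
  then show ?case using trig_poly.scale[OF scale.IH, of c] by (simp add: ac_simps)
qed

lemma trig_poly_sin_mult:
  assumes "trig_poly g" shows "trig_poly (\<lambda>u. sin (s \<bullet> u) * g u)"
  using assms
proof induction
  case (cos t)
  have "sin (s \<bullet> u) * cos (t \<bullet> u) = 1/2 * sin ((s + t) \<bullet> u) + 1/2 * sin ((s - t) \<bullet> u)" for u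
    by (simp add: inner_diff_left inner_add_left sin_add sin_diff field_simps)
  then show ?case by (simp only:) (intro trig_poly.intros)
next
  case (sin t)
  have "sin (s \<bullet> u) * sin (t \<bullet> u) = 1/2 * cos ((s - t) \<bullet> u) + (-1/2) * cos ((s + t) \<bullet> u)" for u
    by (simp add: inner_diff_left inner_add_left cos_add cos_diff field_simps)
  then show ?case by (simp only:) (intro trig_poly.intros)
next
  case (add f g)
  then show ?case by (auto simp: distrib_left intro: trig_poly.intros)
next
  case (scale f c)
  then show ?case using trig_poly.scale[OF scale.IH, of c] by (simp add: ac_simps)
qed

lemma trig_poly_mult:
  assumes "trig_poly f" "trig_poly g" shows "trig_poly (\<lambda>u. f u * g u)"
  using assms(1)
proof induction
  case (cos t) show ?case by (rule trig_poly_cos_mult[OF assms(2)])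
next
  case (sin t) show ?case by (rule trig_poly_sin_mult[OF assms(2)])
next
  case (add f h) then show ?case by (auto simp: distrib_right intro: trig_poly.intros)
next
  case (scale f c) then show ?case using trig_poly.scale[OF scale.IH, of c] by (simp add: ac_simps)
qed

lemma trig_poly_continuous: "trig_poly f \<Longrightarrow> continuous_on A f"
  by (induction rule: trig_poly.induct) (auto intro!: continuous_intros)

lemma trig_poly_bounded: "trig_poly f \<Longrightarrow> \<exists>C. \<forall>u. \<bar>f u\<bar> \<le> C"
proof (induction rule: trig_poly.induct)
  case (add f g)
  then obtain C D where "\<forall>u. \<bar>f u\<bar> \<le> C" "\<forall>u. \<bar>g u\<bar> \<le> D" by blast
  then have "\<bar>f u + g u\<bar> \<le> C + D" for u using abs_triangle_ineq[of "f u" "g u"] by (meson add_mono order_trans)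
  then show ?case by blast
next
  case (scale f c)
  then obtain C where "\<forall>u. \<bar>f u\<bar> \<le> C" by blast
  then have "\<bar>c * f u\<bar> \<le> \<bar>c\<bar> * C" for u by (simp add: abs_mult mult_left_mono)
  then show ?case by blast
qed (auto intro: exI[of _ 1])

lemma trig_poly_polynomial:
  fixes g :: "real \<Rightarrow> real"
  assumes "real_polynomial_function g" "trig_poly h" shows "trig_poly (\<lambda>u. g (h u))"
  using assms(1)
proof induction
  case (linear f)
  have "f (h u) = f 1 * h u" for u
    using linear_cmul[OF bounded_linear.linear[OF linear], of "h u" 1] by simp
  then show ?case using trig_poly.scale[OF assms(2)] by simp
qed (auto intro: trig_poly.intros trig_poly_mult trig_poly_const)

lemma trig_poly_dense:
  fixes f :: "'a::euclidean_space \<Rightarrow> real"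
  assumes "compact S" "continuous_on S f" "e > 0"
  obtains h where "trig_poly h" "\<And>u. u \<in> S \<Longrightarrow> \<bar>f u - h u\<bar> < e"
proof -
  have sep: "\<exists>h\<in>Collect trig_poly. h u \<noteq> h v" if "u \<noteq> v" for u v :: 'a
  proof -
    \<comment> \<open>The scaling makes \<open>u\<close> and \<open>v\<close> differ by angle 1 in
      the direction \<open>t\<close>. If cosine and sine agreed at both points, the cosine of the
      difference would be a sum of squares equal to 1, but \<open>cos 1\<close> is not 1.\<close>
    define t where "t = (1 / (norm (u - v))\<^sup>2) *\<^sub>R (u - v)"
    have "t \<bullet> (u - v) = 1" using that by (simp add: t_def dot_square_norm)
    then have "cos ((t \<bullet> u) - t \<bullet> v) \<noteq> 1"
      using cos_monotone_0_pi[of 0 1] pi_gt3 by (simp add: inner_diff_right)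
    then have "cos (t \<bullet> u) \<noteq> cos (t \<bullet> v) \<or> sin (t \<bullet> u) \<noteq> sin (t \<bullet> v)"
      by (auto simp: cos_diff simp flip: power2_eq_square)
    then show ?thesis using trig_poly.cos[of t] trig_poly.sin[of t] by (metis mem_Collect_eq)
  qed
  interpret function_ring_on "Collect trig_poly" S
    by unfold_locales
       (use assms sep in \<open>auto intro: trig_poly_continuous trig_poly.add trig_poly_mult trig_poly_const\<close>)
  show ?thesis using Stone_Weierstrass_basic[OF assms(2,3)] that by auto
qed

text \<open>
  A trigonometric polynomial \<open>h\<close> close to \<open>f\<close> on a large ball is uncontrolled off that ball. Clipping \<open>h\<close> to the
  range of \<open>f\<close> repairs this, and by Weierstrass the clipping function may be replaced by a polynomial \<open>g\<close>, so
  that \<open>g \<circ> h\<close> is again a trigonometric polynomial.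
\<close>

theorem cramer_wold:
  fixes V :: "nat \<Rightarrow> 'a \<Rightarrow> 'c::euclidean_space"
  assumes M: "prob_space M" and N: "prob_space N"
    and V[measurable]: "\<And>n. V n \<in> borel_measurable M" and Z[measurable]: "Z \<in> borel_measurable N"
    and line: "\<And>t. conv_in_distr M (\<lambda>n \<omega>. t \<bullet> V n \<omega>) N (\<lambda>\<omega>. t \<bullet> Z \<omega>)"
  shows "conv_in_distr M V N Z"
proof -
  interpret M: prob_space M by fact
  interpret N: prob_space N by fact
  have trig_int: "integrable L (\<lambda>\<omega>. h (U \<omega>))"
    if "prob_space L" and [measurable]: "U \<in> borel_measurable L" and h: "trig_poly h"
    for h :: "'c \<Rightarrow> real" and L :: "'d measure" and U
  proof -
    interpret L: prob_space L by fact
    have [measurable]: "h \<in> borel_measurable borel"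
      by (rule borel_measurable_continuous_onI[OF trig_poly_continuous[OF h]])
    obtain C where "\<forall>u. \<bar>h u\<bar> \<le> C" using trig_poly_bounded[OF h] by blast
    then show ?thesis by (intro L.integrable_const_bound[of _ C]) auto
  qed
  have ridge: "(\<lambda>n. \<integral>\<omega>. f (t \<bullet> V n \<omega>) \<partial>M) \<longlonglongrightarrow> (\<integral>\<omega>. f (t \<bullet> Z \<omega>) \<partial>N)"
    if "continuous_on UNIV f" "\<And>u. \<bar>f u\<bar> \<le> 1" for t and f :: "real \<Rightarrow> real"
    using line[of t] that unfolding conv_in_distr_def bounded_iff by auto
  have trig: "(\<lambda>n. \<integral>\<omega>. h (V n \<omega>) \<partial>M) \<longlonglongrightarrow> (\<integral>\<omega>. h (Z \<omega>) \<partial>N)" if "trig_poly h" for h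
    using that
  proof induction
    case (cos t) then show ?case by (intro ridge) (auto intro!: continuous_intros)
  next
    case (sin t) then show ?case by (intro ridge) (auto intro!: continuous_intros)
  next
    case (add f g)
    then show ?case using trig_int[OF M V] trig_int[OF N Z] by (auto intro!: tendsto_intros)
  next
    case (scale f c)
    then show ?case by (auto intro!: tendsto_intros)
  qed
  show ?thesis
    unfolding conv_in_distr_def
  proof (intro conjI allI impI Z)
    fix f :: "'c \<Rightarrow> real" assume cont: "continuous_on UNIV f" and "bounded (range f)"
    then obtain C where C: "\<And>u. \<bar>f u\<bar> \<le> C" "C > 0" by (auto simp: bounded_pos)
    have [measurable]: "f \<in> borel_measurable borel" using cont by (rule borel_measurable_continuous_onI)
    show "(\<lambda>n. \<integral>\<omega>. f (V n \<omega>) \<partial>M) \<longlonglongrightarrow> (\<integral>\<omega>. f (Z \<omega>) \<partial>N)"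
    proof (rule tendstoI)
      fix e0 :: real assume "e0 > 0"
      \<comment> \<open>On the ball \<open>f\<close> and \<open>k\<close> differ by at most
        \<open>2 * e\<close>, and the exceptional event adds \<open>e\<close> by the choice of
        \<open>\<eta>\<close>. Replacing \<open>f\<close> by \<open>k\<close> for \<open>V n\<close>
        and for \<open>Z\<close> thus costs \<open>3 * e\<close> each, the convergence for
        \<open>k\<close> costs \<open>e\<close>, and 7 parts out of 8 suffice.\<close>
      define e where "e = e0 / 8"
      define \<eta> where "\<eta> = e / (2 * (C + e))"
      have e: "e > 0" "\<eta> > 0" "2 * (C + e) * \<eta> = e" using \<open>e0 > 0\<close> \<open>C > 0\<close> by (auto simp: e_def \<eta>_def field_simps add_pos_pos)
      obtain K1 where K1: "likely M \<eta> (\<lambda>n \<omega>. norm (V n \<omega>) \<le> K1)"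
      proof -
        have "\<exists>K. likely M \<eta> (\<lambda>n \<omega>. norm (b \<bullet> V n \<omega>) \<le> K)" if "\<eta> > 0" for b \<eta>
          using conv_in_distr_tight[OF M N _ line that, of b] by auto
        from likely_coordinates[OF M.finite_measure_axioms e(2) this] show ?thesis using that by blast
      qed
      \<comment> \<open>A constant sequence converges to its value, so the tightness lemma also
        yields a ball for the limit law.\<close>
      have "conv_in_distr N (\<lambda>_. Z) N Z" by (simp add: conv_in_distr_def)
      then obtain K2 where K2: "likely N \<eta> (\<lambda>_ \<omega>. norm (Z \<omega>) \<le> K2)"
        using conv_in_distr_tight[OF N N Z _ e(2)] by blast
      define K where "K = max K1 K2"
      obtain h where h: "trig_poly h" "\<And>u. u \<in> cball 0 K \<Longrightarrow> \<bar>f u - h u\<bar> < e"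
        by (rule trig_poly_dense[of "cball 0 K" f e]) (use e continuous_on_subset[OF cont] in auto)
      obtain H where H: "\<And>u. \<bar>h u\<bar> \<le> H" using trig_poly_bounded[OF h(1)] by blast
      define clip where "clip r = max (- C) (min C r)" for r
      have clip: "\<bar>clip r\<bar> \<le> C" "\<bar>a\<bar> \<le> C \<Longrightarrow> \<bar>a - clip r\<bar> \<le> \<bar>a - r\<bar>" for r a
        using C(2) by (auto simp: clip_def)
      have "continuous_on {-H..H} clip" unfolding clip_def by (intro continuous_intros)
      then obtain g where g: "real_polynomial_function g" "\<And>r. r \<in> {-H..H} \<Longrightarrow> \<bar>clip r - g r\<bar> < e"
        using Stone_Weierstrass_real_polynomial_function[of "{-H..H}" clip e] e by auto
      define k where "k u = g (h u)" for u
      have k: "trig_poly k" unfolding k_def by (rule trig_poly_polynomial[OF g(1) h(1)])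
      have [measurable]: "k \<in> borel_measurable borel"
        by (rule borel_measurable_continuous_onI[OF trig_poly_continuous[OF k]])
      have kc: "\<bar>clip (h u) - k u\<bar> < e" for u
        unfolding k_def using H[of u] by (intro g) auto
      have kb: "\<bar>k u\<bar> \<le> C + e" for u using kc[of u] clip(1)[of "h u"] by linarith
      have fk: "\<bar>f u - k u\<bar> \<le> 2 * e" if "norm u \<le> K" for u
        using kc[of u] clip(2)[OF C(1), of u "h u"] h(2)[of u] that by auto
      have near: "\<forall>\<^sub>F n in sequentially. \<bar>(\<integral>\<omega>. f (U n \<omega>) \<partial>L) - (\<integral>\<omega>. k (U n \<omega>) \<partial>L)\<bar> \<le> 2 * e + 2 * (C + e) * \<eta>"
        if "prob_space L" and [measurable]: "\<And>n. U n \<in> borel_measurable L"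
          and "likely L \<eta> (\<lambda>n \<omega>. norm (U n \<omega>) \<le> K)" for L :: "'d measure" and U
      proof (rule likely_expectation_diff[OF that(1)])
        show "likely L \<eta> (\<lambda>n \<omega>. \<bar>f (U n \<omega>) - k (U n \<omega>)\<bar> \<le> 2 * e)"
          by (rule likely_mono[OF that(3)]) (use fk in auto)
        show "\<bar>f (U n \<omega>)\<bar> \<le> C + e" for n \<omega> using C(1)[of "U n \<omega>"] e by linarith
      qed (use kb e in auto)
      have 1: "\<forall>\<^sub>F n in sequentially. \<bar>(\<integral>\<omega>. f (V n \<omega>) \<partial>M) - (\<integral>\<omega>. k (V n \<omega>) \<partial>M)\<bar> \<le> 2 * e + 2 * (C + e) * \<eta>"
        by (intro near M likely_mono[OF K1]) (auto simp: K_def intro!: always_eventually)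
      have "\<forall>\<^sub>F n::nat in sequentially. \<bar>(\<integral>\<omega>. f (Z \<omega>) \<partial>N) - (\<integral>\<omega>. k (Z \<omega>) \<partial>N)\<bar> \<le> 2 * e + 2 * (C + e) * \<eta>"
        by (intro near N likely_mono[OF K2]) (auto simp: K_def intro!: always_eventually)
      then have 2: "\<bar>(\<integral>\<omega>. f (Z \<omega>) \<partial>N) - (\<integral>\<omega>. k (Z \<omega>) \<partial>N)\<bar> \<le> 2 * e + 2 * (C + e) * \<eta>"
        by simp
      have 3: "\<forall>\<^sub>F n in sequentially. dist (\<integral>\<omega>. k (V n \<omega>) \<partial>M) (\<integral>\<omega>. k (Z \<omega>) \<partial>N) < e"
        using trig[OF k] e(1) by (rule tendstoD)
      show "\<forall>\<^sub>F n in sequentially. dist (\<integral>\<omega>. f (V n \<omega>) \<partial>M) (\<integral>\<omega>. f (Z \<omega>) \<partial>N) < e0"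
        using 1 3
      proof eventually_elim
        case (elim n)
        then show ?case using 2 e(3) \<open>e > 0\<close> e_def unfolding dist_real_def by linarith
      qed
    qed
  qed
qed

section \<open>The weak law of large numbers\<close>

text \<open>Integrand and size are separate functions because the Hessian remainder truncates by the
  norm of the covariate while integrating a weighted square.\<close>

lemma tendsto_integral_tail:
  fixes f g :: "'a \<Rightarrow> real"
  assumes f: "integrable M f" and [measurable]: "g \<in> borel_measurable M"
  shows "(\<lambda>k. \<integral>\<omega>. f \<omega> * of_bool (g \<omega> > real k) \<partial>M) \<longlonglongrightarrow> 0"
proof -
  note [measurable] = borel_measurable_integrable[OF f]
  have "(\<lambda>k. \<integral>\<omega>. f \<omega> * of_bool (g \<omega> > real k) \<partial>M) \<longlonglongrightarrow> (\<integral>\<omega>. 0 \<partial>M)"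
  proof (rule integral_dominated_convergence[where w="\<lambda>\<omega>. \<bar>f \<omega>\<bar>"])
    show "AE \<omega> in M. (\<lambda>k. f \<omega> * of_bool (g \<omega> > real k)) \<longlonglongrightarrow> 0"
    proof (rule AE_I2)
      fix \<omega>
      obtain k0 :: nat where "g \<omega> \<le> k0" using real_arch_simple by blast
      then have "\<forall>\<^sub>F k in sequentially. f \<omega> * of_bool (g \<omega> > real k) = 0"
        by (intro eventually_sequentiallyI[of k0]) auto
      then show "(\<lambda>k. f \<omega> * of_bool (g \<omega> > real k)) \<longlonglongrightarrow> 0" by (rule tendsto_eventually)
    qed
  qed (use f in auto)
  then show ?thesis by simp
qed

text \<open>The next summand is independent of the partial sum and centred, so the cross term
  vanishes. Bounded summands are enough, since the law of large numbers applies this after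
  truncation.\<close>

lemma (in prob_space) expectation_square_sum_indep:
  fixes V :: "nat \<Rightarrow> 'a \<Rightarrow> real"
  assumes ind: "indep_vars (\<lambda>_. borel) V UNIV"
    and bound: "\<And>i \<omega>. \<bar>V i \<omega>\<bar> \<le> T" and mean: "\<And>i. expectation (V i) = 0"
  shows "expectation (\<lambda>\<omega>. (\<Sum>i<n. V i \<omega>)\<^sup>2) \<le> n * T\<^sup>2"
proof (induction n)
  case (Suc n)
  have rv [measurable]: "random_variable borel (V i)" for i
    using ind by (simp add: indep_vars_def2)
  have Sb: "\<bar>\<Sum>i<n. V i \<omega>\<bar> \<le> n * T" for n \<omega>
    using sum_norm_bound[of "{..<n}" "\<lambda>i. V i \<omega>" T] bound by simp
  have iV: "integrable M (V i)" for i by (rule integrable_const_bound[of _ T]) (use bound in auto)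
  have iS: "integrable M (\<lambda>\<omega>. \<Sum>i<n. V i \<omega>)" for n using iV by auto
  have T: "T \<ge> 0" using bound[of 0 undefined] by linarith
  have sq: "r\<^sup>2 \<le> s\<^sup>2" if "\<bar>r\<bar> \<le> s" for r s :: real
    using that by (metis abs_ge_zero power2_abs power_mono)
  have i1: "integrable M (\<lambda>\<omega>. (V i \<omega>)\<^sup>2)" for i
    by (rule integrable_const_bound[of _ "T\<^sup>2"]) (use bound sq in auto)
  have i2: "integrable M (\<lambda>\<omega>. (\<Sum>i<n. V i \<omega>)\<^sup>2)"
    by (rule integrable_const_bound[of _ "(n * T)\<^sup>2"]) (use Sb sq in auto)
  have "indep_var borel (V n) borel (\<lambda>\<omega>. \<Sum>i<n. V i \<omega>)"
    by (rule indep_vars_sum[OF _ _ indep_vars_subset[OF ind]]) auto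
  from indep_var_lebesgue_integral[OF this iV iS] indep_var_integrable[OF this iV iS]
  have cross: "expectation (\<lambda>\<omega>. V n \<omega> * (\<Sum>i<n. V i \<omega>)) = 0" and i3: "integrable M (\<lambda>\<omega>. V n \<omega> * (\<Sum>i<n. V i \<omega>))"
    using mean by auto
  have "expectation (\<lambda>\<omega>. (\<Sum>i<Suc n. V i \<omega>)\<^sup>2) =
      expectation (\<lambda>\<omega>. (\<Sum>i<n. V i \<omega>)\<^sup>2 + 2 * (V n \<omega> * (\<Sum>i<n. V i \<omega>)) + (V n \<omega>)\<^sup>2)"
    by (simp add: power2_eq_square algebra_simps)
  also have "\<dots> = expectation (\<lambda>\<omega>. (\<Sum>i<n. V i \<omega>)\<^sup>2) + expectation (\<lambda>\<omega>. (V n \<omega>)\<^sup>2)"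
    using i1 i2 i3 cross by simp
  also have "expectation (\<lambda>\<omega>. (V n \<omega>)\<^sup>2) \<le> expectation (\<lambda>\<omega>. T\<^sup>2)"
    by (intro integral_mono i1) (use bound sq in auto)
  finally show ?case using Suc by (simp add: prob_space algebra_simps)
qed simp

lemma (in prob_space) expectation_cong_distr:
  assumes "distr M borel X = distr M borel Y" "f \<in> borel_measurable borel"
    "X \<in> borel_measurable M" "Y \<in> borel_measurable M"
  shows "expectation (\<lambda>\<omega>. f (X \<omega>)) = (expectation (\<lambda>\<omega>. f (Y \<omega>)) :: real)"
    and "integrable M (\<lambda>\<omega>. f (X \<omega>)) \<longleftrightarrow> integrable M (\<lambda>\<omega>. f (Y \<omega>))"
  using integral_distr[OF assms(3,2)] integral_distr[OF assms(4,2)]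
    integrable_distr_eq[OF assms(3,2)] integrable_distr_eq[OF assms(4,2)] assms(1) by auto

text \<open>Only a first moment is available, so the summands are truncated at a fixed level
  \<open>k\<close>. The centred bounded part is handled by its second moment and Markov's
  inequality, the tail by its small first absolute moment.\<close>

lemma (in prob_space) weak_law_of_large_numbers:
  fixes \<xi> :: "nat \<Rightarrow> 'a \<Rightarrow> real"
  assumes ind: "indep_vars (\<lambda>_. borel) \<xi> UNIV"
    and ident: "\<And>i. distr M borel (\<xi> i) = distr M borel X" and [measurable]: "X \<in> borel_measurable M"
    and int: "integrable M X" and pos: "\<epsilon> > 0" "\<eta> > 0"
  shows "likely M \<eta> (\<lambda>n \<omega>. \<bar>(1 / real n) * (\<Sum>i<n. \<xi> i \<omega>) - expectation X\<bar> < \<epsilon>)"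
proof -
  have rv [measurable]: "random_variable borel (\<xi> i)" for i
    using ind by (simp add: indep_vars_def2)
  note law = expectation_cong_distr[OF ident _ rv \<open>random_variable borel X\<close>]
  \<comment> \<open>The first entry bounds the shift of the mean caused by truncation; the second is
    what Markov's inequality requires to make the average tail smaller than
    \<open>\<epsilon> / 3\<close> at level \<open>\<eta> / 2\<close>.\<close>
  define \<delta> where "\<delta> = min (\<epsilon> / 3) (\<eta> / 2 * (\<epsilon> / 3))"
  have \<delta>: "\<delta> > 0" "\<delta> \<le> \<epsilon> / 3" "\<delta> \<le> \<eta> / 2 * (\<epsilon> / 3)" using pos by (auto simp: \<delta>_def)
  have "(\<lambda>k. \<integral>\<omega>. \<bar>X \<omega>\<bar> * of_bool (\<bar>X \<omega>\<bar> > real k) \<partial>M) \<longlonglongrightarrow> 0"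
    by (rule tendsto_integral_tail) (use int in auto)
  from order_tendstoD(2)[OF this \<delta>(1)]
  obtain k :: nat where k: "expectation (\<lambda>\<omega>. \<bar>X \<omega>\<bar> * of_bool (\<bar>X \<omega>\<bar> > real k)) < \<delta>"
    by (auto simp: eventually_sequentially)
  \<comment> \<open>The decomposition is \<open>r = V r + U r + m\<close>: centred core, tail, and
    mean of the core.\<close>
  define U where "U r = r * of_bool (\<bar>r\<bar> > real k)" for r :: real
  define m where "m = expectation (\<lambda>\<omega>. X \<omega> - U (X \<omega>))"
  define V where "V r = r - U r - m" for r
  have [measurable]: "U \<in> borel_measurable borel" "V \<in> borel_measurable borel" unfolding U_def V_def by measurable
  have Uabs: "\<bar>U r\<bar> = \<bar>r\<bar> * of_bool (\<bar>r\<bar> > real k)" for r by (simp add: U_def abs_mult)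
  have kU: "expectation (\<lambda>\<omega>. \<bar>U (X \<omega>)\<bar>) < \<delta>" using k by (simp add: Uabs)
  have intU: "integrable M (\<lambda>\<omega>. U (X \<omega>))"
    by (rule Bochner_Integration.integrable_bound[OF int]) (auto simp: U_def)
  have core: "\<bar>r - U r\<bar> \<le> k" for r by (auto simp: U_def)
  have intV: "integrable M (\<lambda>\<omega>. X \<omega> - U (X \<omega>))" using int intU by auto
  have "\<bar>m\<bar> \<le> expectation (\<lambda>\<omega>. \<bar>X \<omega> - U (X \<omega>)\<bar>)" unfolding m_def by (rule integral_abs_bound)
  also have "\<dots> \<le> expectation (\<lambda>\<omega>. k)" by (intro integral_mono) (use intV core in auto)
  finally have mk: "\<bar>m\<bar> \<le> k" by (simp add: prob_space)
  have Vb: "\<bar>V r\<bar> \<le> 2 * k" for r using core[of r] mk by (auto simp: V_def)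
  have V0: "expectation (\<lambda>\<omega>. V (\<xi> i \<omega>)) = 0" for i
    by (subst law) (use intV in \<open>auto simp: V_def m_def prob_space\<close>)
  have indV: "indep_vars (\<lambda>_. borel) (\<lambda>i \<omega>. V (\<xi> i \<omega>)) UNIV"
    by (rule indep_vars_compose2[OF ind]) auto
  define D where "D = (\<lambda>n \<omega>. (1 / real n)\<^sup>2 * (\<Sum>i<n. V (\<xi> i \<omega>))\<^sup>2)"
  have ED: "expectation (D n) \<le> (2 * real k)\<^sup>2 / n" for n
  proof -
    have "expectation (D n) = (1 / real n)\<^sup>2 * expectation (\<lambda>\<omega>. (\<Sum>i<n. V (\<xi> i \<omega>))\<^sup>2)" by (simp add: D_def)
    also have "\<dots> \<le> (1 / real n)\<^sup>2 * (n * (2 * real k)\<^sup>2)"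
      using expectation_square_sum_indep[OF indV Vb V0, of n] by (intro mult_left_mono) auto
    also have "\<dots> = (2 * real k)\<^sup>2 / n" by (simp add: power2_eq_square)
    finally show ?thesis .
  qed
  have "likely M (\<eta>/2) (\<lambda>n \<omega>. D n \<omega> < (\<epsilon>/3)\<^sup>2)"
  proof (rule likely_Markov[OF prob_space_axioms])
    have "(\<lambda>n. (2 * real k)\<^sup>2 / real n) \<longlonglongrightarrow> 0" by (rule lim_const_over_n)
    then have "\<forall>\<^sub>F n in sequentially. (2 * real k)\<^sup>2 / real n < \<eta>/2 * (\<epsilon>/3)\<^sup>2"
      using pos by (intro order_tendstoD) auto
    then show "\<forall>\<^sub>F n in sequentially. expectation (D n) \<le> \<eta>/2 * (\<epsilon>/3)\<^sup>2"
    proof eventually_elim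
      case (elim n)
      then show ?case using ED[of n] by linarith
    qed
    have "\<bar>\<Sum>i<n. V (\<xi> i \<omega>)\<bar> \<le> real n * (2 * real k)" for n \<omega>
      using sum_norm_bound[of "{..<n}" "\<lambda>i. V (\<xi> i \<omega>)" "2 * real k"] Vb by simp
    then have "(\<Sum>i<n. V (\<xi> i \<omega>))\<^sup>2 \<le> (real n * (2 * real k))\<^sup>2" for n \<omega>
      using power_mono[OF _ abs_ge_zero, of "\<Sum>i<n. V (\<xi> i \<omega>)" _ 2] by simp
    then show "integrable M (D n)" for n unfolding D_def
      by (intro integrable_mult_right integrable_const_bound[of _ "(real n * (2 * real k))\<^sup>2"]) auto
  qed (use pos in \<open>auto simp: D_def\<close>)
  moreover have "likely M (\<eta>/2) (\<lambda>n \<omega>. (1 / real n) * (\<Sum>i<n. \<bar>U (\<xi> i \<omega>)\<bar>) < \<epsilon>/3)"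
  proof (rule likely_Markov[OF prob_space_axioms])
    have iU: "integrable M (\<lambda>\<omega>. \<bar>U (\<xi> i \<omega>)\<bar>)" for i
      by (subst law) (use intU in auto)
    then show "integrable M (\<lambda>\<omega>. (1 / real n) * (\<Sum>i<n. \<bar>U (\<xi> i \<omega>)\<bar>))" for n by auto
    have eq: "expectation (\<lambda>\<omega>. \<bar>U (\<xi> i \<omega>)\<bar>) = expectation (\<lambda>\<omega>. \<bar>U (X \<omega>)\<bar>)" for i
      by (rule law(1)) auto
    have "expectation (\<lambda>\<omega>. (1 / real n) * (\<Sum>i<n. \<bar>U (\<xi> i \<omega>)\<bar>)) \<le> \<delta>" for n
      using kU \<delta>(1) by (cases "n = 0") (simp_all add: Bochner_Integration.integral_sum iU eq)
    then show "\<forall>\<^sub>F n in sequentially. expectation (\<lambda>\<omega>. (1 / real n) * (\<Sum>i<n. \<bar>U (\<xi> i \<omega>)\<bar>)) \<le> \<eta>/2 * (\<epsilon>/3)"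
      using \<delta>(3) order_trans by (intro always_eventually allI) blast
  qed (use pos in \<open>auto intro: sum_nonneg\<close>)
  ultimately have "likely M (\<eta>/2 + \<eta>/2)
     (\<lambda>n \<omega>. D n \<omega> < (\<epsilon>/3)\<^sup>2 \<and> (1 / real n) * (\<Sum>i<n. \<bar>U (\<xi> i \<omega>)\<bar>) < \<epsilon>/3)"
    by (rule likely_conj[OF _ _ finite_measure_axioms])
  then show ?thesis
  proof (rule likely_mono)
    show "\<forall>\<^sub>F n in sequentially. \<forall>\<omega>\<in>space M.
      D n \<omega> < (\<epsilon>/3)\<^sup>2 \<and> (1 / real n) * (\<Sum>i<n. \<bar>U (\<xi> i \<omega>)\<bar>) < \<epsilon>/3 \<longrightarrow>
      \<bar>(1 / real n) * (\<Sum>i<n. \<xi> i \<omega>) - expectation X\<bar> < \<epsilon>"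
    proof (intro eventually_sequentiallyI[of 1] ballI impI, elim conjE)
      fix n \<omega> assume n: "1 \<le> (n::nat)" and a: "D n \<omega> < (\<epsilon>/3)\<^sup>2" and b: "(1 / real n) * (\<Sum>i<n. \<bar>U (\<xi> i \<omega>)\<bar>) < \<epsilon>/3"
      have "\<bar>(1 / real n) * (\<Sum>i<n. V (\<xi> i \<omega>))\<bar> < \<epsilon>/3"
        using a pos unfolding D_def power_mult_distrib[symmetric]
        by (metis abs_le_square_iff abs_of_pos divide_pos_pos not_le zero_less_numeral)
      moreover have "\<bar>(1 / real n) * (\<Sum>i<n. U (\<xi> i \<omega>))\<bar> < \<epsilon>/3"
        by (rule order.strict_trans1[OF _ b]) (simp add: abs_mult divide_right_mono sum_abs)
      moreover have "\<bar>expectation (\<lambda>\<omega>. U (X \<omega>))\<bar> \<le> \<epsilon>/3"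
        using integral_abs_bound[of M "\<lambda>\<omega>. U (X \<omega>)"] kU \<delta>(2) by linarith
      moreover have "m = expectation X - expectation (\<lambda>\<omega>. U (X \<omega>))"
        using int intU by (simp add: m_def)
      moreover have "(1 / real n) * (\<Sum>i<n. \<xi> i \<omega>) = (1 / real n) * (\<Sum>i<n. V (\<xi> i \<omega>)) + (1 / real n) * (\<Sum>i<n. U (\<xi> i \<omega>)) + m"
        using n by (simp add: V_def sum_subtractf sum.distrib field_simps)
      ultimately show "\<bar>(1 / real n) * (\<Sum>i<n. \<xi> i \<omega>) - expectation X\<bar> < \<epsilon>" by linarith
    qed
  qed simp
qed

section \<open>The multivariate central limit theorem\<close>

text \<open>The univariate limit theorem normalises to variance 1 while the target has standard
  deviation \<open>\<sigma>\<close>; the scale is moved from the density into the test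
  function.\<close>

lemma integral_normal_density_rescale:
  assumes "\<sigma> > 0"
  shows "(\<integral>s. normal_density 0 \<sigma> s * f s \<partial>lborel) = (\<integral>u. std_normal_density u * (f (\<sigma> * u) :: real) \<partial>lborel)"
proof -
  have "normal_density 0 \<sigma> (\<sigma> * u) * \<sigma> = std_normal_density u" for u
    using assms by (simp add: normal_density_def real_sqrt_mult power_mult_distrib)
  then have "\<sigma> * (\<integral>u. normal_density 0 \<sigma> (\<sigma> * u) * f (\<sigma> * u) \<partial>lborel) = (\<integral>u. std_normal_density u * f (\<sigma> * u) \<partial>lborel)"
    unfolding integral_mult_right_zero[symmetric]
    by (intro Bochner_Integration.integral_cong) (auto simp flip: mult.assoc simp: mult.commute)
  then show ?thesis
    using lborel_integral_real_affine[of \<sigma> "\<lambda>s. normal_density 0 \<sigma> s * f s" 0] assms by simp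
qed

text \<open>Cramer--Wold reduces the claim to projections. The covariance may be singular: in a
  direction of zero variance the summands vanish almost surely and the limit is the point mass at 0;
  in every other direction the univariate theorem applies.\<close>

theorem (in prob_space) multivariate_central_limit_theorem:
  fixes \<xi> :: "nat \<Rightarrow> 'a \<Rightarrow> 'c::euclidean_space" and \<zeta> :: "'a \<Rightarrow> 'c" and Z :: "'b \<Rightarrow> 'c"
  assumes ind: "indep_vars (\<lambda>_. borel) \<xi> UNIV"
    and ident: "\<And>i. distr M borel (\<xi> i) = distr M borel \<zeta>"
    and \<zeta>[measurable]: "\<zeta> \<in> borel_measurable M"
    and mean: "\<And>t. expectation (\<lambda>\<omega>. t \<bullet> \<zeta> \<omega>) = 0"
    and sq: "\<And>t. integrable M (\<lambda>\<omega>. (t \<bullet> \<zeta> \<omega>)\<^sup>2)"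
    and N: "prob_space N" and Z[measurable]: "Z \<in> borel_measurable N"
    and gauss: "\<And>t. distr N borel (\<lambda>\<omega>. t \<bullet> Z \<omega>) =
      (if expectation (\<lambda>\<omega>. (t \<bullet> \<zeta> \<omega>)\<^sup>2) = 0 then return borel 0
       else density lborel (\<lambda>s. ennreal (normal_density 0 (sqrt (expectation (\<lambda>\<omega>. (t \<bullet> \<zeta> \<omega>)\<^sup>2))) s)))"
  shows "conv_in_distr M (\<lambda>n \<omega>. (1 / sqrt (real n)) *\<^sub>R (\<Sum>i<n. \<xi> i \<omega>)) N Z"
proof (rule cramer_wold[OF prob_space_axioms N _ Z])
  have rv [measurable]: "random_variable borel (\<xi> i)" for i
    using ind by (simp add: indep_vars_def2)
  note law = expectation_cong_distr[OF ident _ rv \<zeta>]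
  show "(\<lambda>\<omega>. (1 / sqrt (real n)) *\<^sub>R (\<Sum>i<n. \<xi> i \<omega>)) \<in> borel_measurable M" for n by measurable
  fix t
  define v where "v = expectation (\<lambda>\<omega>. (t \<bullet> \<zeta> \<omega>)\<^sup>2)"
  have v0: "v \<ge> 0" by (simp add: v_def)
  have lin: "t \<bullet> ((1 / sqrt (real n)) *\<^sub>R (\<Sum>i<n. \<xi> i \<omega>)) = (1 / sqrt (real n)) * (\<Sum>i<n. t \<bullet> \<xi> i \<omega>)" for n \<omega>
    by (simp add: inner_sum_right)
  have mean': "expectation (\<lambda>\<omega>. t \<bullet> \<xi> i \<omega>) = 0" for i by (subst law) (auto simp: mean)
  have sq': "integrable M (\<lambda>\<omega>. (t \<bullet> \<xi> i \<omega>)\<^sup>2)" for i by (subst law) (auto simp: sq)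
  have var': "expectation (\<lambda>\<omega>. (t \<bullet> \<xi> i \<omega>)\<^sup>2) = v" for i unfolding v_def by (subst law) auto
  show "conv_in_distr M (\<lambda>n \<omega>. t \<bullet> ((1 / sqrt (real n)) *\<^sub>R (\<Sum>i<n. \<xi> i \<omega>))) N (\<lambda>\<omega>. t \<bullet> Z \<omega>)"
    unfolding conv_in_distr_def lin
  proof (intro conjI allI impI)
    fix f :: "real \<Rightarrow> real" assume f: "continuous_on UNIV f" "bounded (range f)"
    have fm [measurable]: "f \<in> borel_measurable borel" using f(1) by (rule borel_measurable_continuous_onI)
    obtain C where C: "\<And>u. norm (f u) \<le> C" using f(2) by (auto simp: bounded_iff)
    have ZN: "(\<integral>\<omega>. f (t \<bullet> Z \<omega>) \<partial>N) = (\<integral>u. f u \<partial>distr N borel (\<lambda>\<omega>. t \<bullet> Z \<omega>))"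
      by (rule integral_distr[symmetric]) auto
    show "(\<lambda>n. expectation (\<lambda>\<omega>. f ((1 / sqrt (real n)) * (\<Sum>i<n. t \<bullet> \<xi> i \<omega>)))) \<longlonglongrightarrow> (\<integral>\<omega>. f (t \<bullet> Z \<omega>) \<partial>N)"
    proof (cases "v = 0")
      case True
      have "AE \<omega> in M. t \<bullet> \<xi> i \<omega> = 0" for i
        using integral_nonneg_eq_0_iff_AE[OF sq'[of i]] var'[of i] True by auto
      then have "AE \<omega> in M. \<forall>i. t \<bullet> \<xi> i \<omega> = 0" by (simp add: AE_all_countable)
      then have "expectation (\<lambda>\<omega>. f ((1 / sqrt (real n)) * (\<Sum>i<n. t \<bullet> \<xi> i \<omega>))) = expectation (\<lambda>\<omega>. f 0)" for n
        by (intro integral_cong_AE) auto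
      moreover have "(\<integral>\<omega>. f (t \<bullet> Z \<omega>) \<partial>N) = f 0"
        unfolding ZN gauss using True by (simp add: v_def integral_return)
      ultimately show ?thesis by (simp add: prob_space)
    next
      case False
      define \<sigma> where "\<sigma> = sqrt v"
      have \<sigma>: "\<sigma> > 0" "\<sigma>\<^sup>2 = v" using False v0 by (auto simp: \<sigma>_def)
      have "weak_conv_m (\<lambda>n. distr M borel (\<lambda>\<omega>. (\<Sum>i<n. t \<bullet> \<xi> i \<omega>) / sqrt (n * \<sigma>\<^sup>2))) std_normal_distribution"
      proof (rule central_limit_theorem_zero_mean[where \<mu>="distr M borel (\<lambda>\<omega>. t \<bullet> \<zeta> \<omega>)"])
        show "indep_vars (\<lambda>i. borel) (\<lambda>i \<omega>. t \<bullet> \<xi> i \<omega>) UNIV"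
          by (rule indep_vars_compose2[OF ind]) auto
        show "distr M borel (\<lambda>\<omega>. t \<bullet> \<xi> i \<omega>) = distr M borel (\<lambda>\<omega>. t \<bullet> \<zeta> \<omega>)" for i
          using distr_distr[of "(\<bullet>) t" borel borel "\<xi> i" M] distr_distr[of "(\<bullet>) t" borel borel \<zeta> M]
          by (simp add: ident comp_def)
      qed (use \<sigma> mean' sq' var' in auto)
      moreover have rd: "real_distribution (distr M borel (\<lambda>\<omega>. (\<Sum>i<n. t \<bullet> \<xi> i \<omega>) / sqrt (n * \<sigma>\<^sup>2)))" for n
        by (rule real_distribution_distr) auto
      ultimately have "(\<lambda>n. \<integral>u. f (\<sigma> * u) \<partial>distr M borel (\<lambda>\<omega>. (\<Sum>i<n. t \<bullet> \<xi> i \<omega>) / sqrt (n * \<sigma>\<^sup>2)))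
          \<longlonglongrightarrow> (\<integral>u. f (\<sigma> * u) \<partial>std_normal_distribution)"
      proof (intro weak_conv_imp_integral_bdd_continuous_conv[where B=C] rd real_dist_normal_dist)
        show "isCont (\<lambda>u. f (\<sigma> * u)) u" for u
          using continuous_on_compose2[OF f(1), of UNIV "\<lambda>u. \<sigma> * u"]
          by (auto intro!: continuous_intros simp: continuous_on_eq_continuous_at)
      qed (use C in auto)
      moreover have "(\<integral>u. f (\<sigma> * u) \<partial>distr M borel (\<lambda>\<omega>. (\<Sum>i<n. t \<bullet> \<xi> i \<omega>) / sqrt (n * \<sigma>\<^sup>2))) =
          expectation (\<lambda>\<omega>. f ((1 / sqrt (real n)) * (\<Sum>i<n. t \<bullet> \<xi> i \<omega>)))" for n
        using \<sigma>(1) by (subst integral_distr) (auto simp: real_sqrt_mult)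
      moreover have "(\<integral>u. f (\<sigma> * u) \<partial>std_normal_distribution) = (\<integral>\<omega>. f (t \<bullet> Z \<omega>) \<partial>N)"
      proof -
        have "(\<integral>\<omega>. f (t \<bullet> Z \<omega>) \<partial>N) = (\<integral>u. f u \<partial>density lborel (\<lambda>s. ennreal (normal_density 0 \<sigma> s)))"
          unfolding ZN gauss using False by (simp add: \<sigma>_def flip: v_def)
        also have "\<dots> = (\<integral>s. normal_density 0 \<sigma> s * f s \<partial>lborel)" by (subst integral_density) auto
        also have "\<dots> = (\<integral>u. std_normal_density u * f (\<sigma> * u) \<partial>lborel)"
          by (rule integral_normal_density_rescale[OF \<sigma>(1)])
        also have "\<dots> = (\<integral>u. f (\<sigma> * u) \<partial>std_normal_distribution)" by (subst integral_density) auto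
        finally show ?thesis by simp
      qed
      ultimately show ?thesis by simp
    qed
  qed measurable
qed

section \<open>Derivatives of the loss\<close>

lemma logistic_bounds: "0 < logistic t" "logistic t < 1"
  by (auto simp: logistic_def divide_simps add_pos_pos)

lemma DERIV_logistic: "(logistic has_real_derivative logistic t * (1 - logistic t)) (at t)"
proof -
  have "1 + exp t \<noteq> 0" by (simp add: add_pos_pos less_imp_neq[symmetric])
  then show ?thesis unfolding logistic_def
    by (auto intro!: derivative_eq_intros simp: field_simps)
qed

lemma continuous_on_logistic [continuous_intros]:
  "continuous_on S f \<Longrightarrow> continuous_on S (\<lambda>x. logistic (f x))"
  by (rule continuous_on_compose2[OF DERIV_continuous_on[OF DERIV_subset[OF DERIV_logistic]], of UNIV S f]) auto

lemma DERIV_neg_ln_logistic: "((\<lambda>t. - ln (logistic t)) has_real_derivative - (1 - logistic t)) (at t)"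
  using logistic_bounds[of t] by (auto intro!: derivative_eq_intros DERIV_logistic simp: divide_simps)

lemma DERIV_neg_ln_1_minus_logistic: "((\<lambda>t. - ln (1 - logistic t)) has_real_derivative logistic t) (at t)"
  using logistic_bounds[of t] by (auto intro!: derivative_eq_intros DERIV_logistic simp: divide_simps)

lemma neg_ln_logistic_pos: "- ln (logistic t) > 0" "- ln (1 - logistic t) > 0"
  using logistic_bounds[of t] by (auto simp: ln_less_zero)

locale smooth_loss =
  fixes \<rho> \<psi> \<psi>' :: "real \<Rightarrow> real"
  assumes rho_deriv: "\<And>t. t \<ge> 0 \<Longrightarrow> (\<rho> has_real_derivative \<psi> t) (at t within {0..})"
    and psi_deriv: "\<And>t. t \<ge> 0 \<Longrightarrow> (\<psi> has_real_derivative \<psi>' t) (at t within {0..})"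
    and psi'_cont: "continuous_on {0..} \<psi>'"
    and psi_bounded: "bounded (\<psi> ` {0..})" and psi'_bounded: "bounded (\<psi>' ` {0..})"
begin

definition nu' :: "real \<Rightarrow> real" where
  "nu' t = logistic t * (1 - logistic t) * (\<psi> (- ln (1 - logistic t)) - \<psi> (- ln (logistic t)))
    + \<psi>' (- ln (1 - logistic t)) * (logistic t)\<^sup>2 - \<psi>' (- ln (logistic t)) * (1 - logistic t)\<^sup>2"

text \<open>The derivative of the loss in its linear predictor. The two \<open>G_corr\<close> terms
  complete the derivative to a multiple of the residual \<open>logistic t - y\<close>, which is the
  source of Fisher consistency: the score has conditional mean zero at the true parameter.\<close>

definition score :: "real \<Rightarrow> real \<Rightarrow> real" where
  "score y t = (logistic t - y) * nu \<psi> t"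

definition score' :: "real \<Rightarrow> real \<Rightarrow> real" where
  "score' y t = logistic t * (1 - logistic t) * nu \<psi> t + (logistic t - y) * nu' t"

text \<open>The hypotheses give derivatives relative to the half-line, but the loss evaluates
  \<open>\<rho>\<close> and \<open>\<psi>\<close> only at the strictly positive points
  \<open>- ln (logistic t)\<close> and \<open>- ln (1 - logistic t)\<close>, where these are
  ordinary derivatives.\<close>

lemma at_within_nonneg_eq_at: "at t within {0..} = at t" if "t > 0" for t :: real
  using that by (intro at_within_interior) (auto simp: interior_real_atLeast)

lemma rho_DERIV: "t > 0 \<Longrightarrow> (\<rho> has_real_derivative \<psi> t) (at t)"
  and psi_DERIV: "t > 0 \<Longrightarrow> (\<psi> has_real_derivative \<psi>' t) (at t)"
  using rho_deriv[of t] psi_deriv[of t] by (simp_all add: at_within_nonneg_eq_at)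

lemma continuous_on_psi: "continuous_on {0..} \<psi>"
  using psi_deriv by (intro DERIV_continuous_on) auto

lemma psi_bound: obtains C where "C \<ge> 0" "\<And>t. t \<ge> 0 \<Longrightarrow> \<bar>\<psi> t\<bar> \<le> C" "\<And>t. t \<ge> 0 \<Longrightarrow> \<bar>\<psi>' t\<bar> \<le> C"
proof -
  obtain C1 C2 where "\<And>t. t \<ge> 0 \<Longrightarrow> \<bar>\<psi> t\<bar> \<le> C1" "\<And>t. t \<ge> 0 \<Longrightarrow> \<bar>\<psi>' t\<bar> \<le> C2"
    using psi_bounded psi'_bounded unfolding bounded_iff by fastforce
  then show ?thesis
    by (intro that[of "max 0 (max C1 C2)"]) (force intro: max.coboundedI2 max.coboundedI1)+
qed

lemma integrable_psi_ln: "(\<lambda>u. \<psi> (- ln u)) integrable_on {0..1}"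
proof -
  obtain C where C: "C \<ge> 0" "\<And>t. t \<ge> 0 \<Longrightarrow> \<bar>\<psi> t\<bar> \<le> C" using psi_bound by metis
  \<comment> \<open>Composing with \<open>max 0\<close> extends \<open>\<psi>\<close> continuously
    from the half-line to the reals, which gives Borel measurability. Nothing changes on the unit
    interval, where \<open>- ln u\<close> is nonnegative; at \<open>u = 0\<close> the convention
    \<open>ln 0 = 0\<close> applies.\<close>
  have "continuous_on UNIV (\<lambda>s. \<psi> (max 0 s))"
    by (rule continuous_on_compose2[OF continuous_on_psi]) (auto intro!: continuous_intros)
  then have [measurable]: "(\<lambda>s. \<psi> (max 0 s)) \<in> borel_measurable borel"
    by (rule borel_measurable_continuous_onI)
  have "integrable lborel (\<lambda>u. indicator {0..1} u * \<psi> (max 0 (- ln u)))"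
  proof (rule Bochner_Integration.integrable_bound)
    show "integrable lborel (\<lambda>u::real. C * indicator {0..1} u)"
      by (intro integrable_mult_right integrable_real_indicator) auto
    have "(\<lambda>u. \<psi> (max 0 (- ln u))) \<in> borel_measurable lborel"
      using measurable_compose[of "\<lambda>u::real. - ln u" lborel borel "\<lambda>s. \<psi> (max 0 s)" borel] by simp
    then show "(\<lambda>u. indicator {0..1} u * \<psi> (max 0 (- ln u))) \<in> borel_measurable lborel" by simp
    show "AE u in lborel. norm (indicator {0..1} u * \<psi> (max 0 (- ln u))) \<le> norm (C * indicator {0..1} (u::real))"
      using C by (intro AE_I2) (auto simp: indicator_def)
  qed
  then have "set_integrable lborel {0..1} (\<lambda>u. \<psi> (max 0 (- ln u)))"
    by (simp add: set_integrable_def)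
  from set_borel_integral_eq_integral(1)[OF this]
  show ?thesis
    by (rule integrable_eq) (auto simp: max_def le_less)
qed

text \<open>The integrand may jump at 0, so the fundamental theorem is used in the form that asks
  for integrability on the interval and continuity at the single point \<open>s\<close>.\<close>

lemma DERIV_G_corr:
  assumes "0 < s" "s < 1" shows "(G_corr \<psi> has_real_derivative \<psi> (- ln s)) (at s)"
proof -
  have "isCont (\<lambda>u. \<psi> (- ln u)) s"
    using assms by (intro continuous_intros isCont_o2[OF _ DERIV_isCont[OF psi_DERIV]]) auto
  then have "((\<lambda>u. integral {0..u} (\<lambda>u. \<psi> (- ln u))) has_vector_derivative \<psi> (- ln s)) (at s within {0..1})"
    using assms by (intro integral_has_vector_derivative_continuous_at[OF integrable_psi_ln, of _ "{}", simplified])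
      (auto intro: continuous_at_imp_continuous_at_within)
  moreover have "at s within {0..1} = at s"
    using assms by (intro at_within_interior) auto
  ultimately show ?thesis
    by (simp add: G_corr_def[abs_def] has_real_derivative_iff_has_vector_derivative)
qed

lemma DERIV_phi_loss: "(phi_loss \<rho> \<psi> y has_real_derivative score y t) (at t)"
proof -
  note F = logistic_bounds[of t] neg_ln_logistic_pos[of t]
  have F': "0 < 1 - logistic t" "1 - logistic t < 1" using F by auto
  note D = DERIV_chain2[OF rho_DERIV[OF F(3)] DERIV_neg_ln_logistic]
    DERIV_chain2[OF rho_DERIV[OF F(4)] DERIV_neg_ln_1_minus_logistic]
    DERIV_chain2[OF DERIV_G_corr[OF F(1,2)] DERIV_logistic]
    DERIV_chain2[OF DERIV_G_corr[OF F'] DERIV_diff[OF DERIV_const DERIV_logistic]]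
  show ?thesis unfolding phi_loss_def[abs_def] score_def nu_def
    by (rule DERIV_cong)
       (rule DERIV_add DERIV_cmult D | simp add: algebra_simps power2_eq_square)+
qed

lemma DERIV_nu: "(nu \<psi> has_real_derivative nu' t) (at t)"
proof -
  note F = neg_ln_logistic_pos[of t]
  note D = DERIV_chain2[OF psi_DERIV[OF F(1)] DERIV_neg_ln_logistic]
    DERIV_chain2[OF psi_DERIV[OF F(2)] DERIV_neg_ln_1_minus_logistic]
    DERIV_logistic DERIV_diff[OF DERIV_const DERIV_logistic]
  show ?thesis unfolding nu_def[abs_def] nu'_def
    by (rule DERIV_cong)
       (rule DERIV_add DERIV_mult D | simp add: algebra_simps power2_eq_square)+
qed

lemma DERIV_score: "(score y has_real_derivative score' y t) (at t)"
  unfolding score_def[abs_def] score'_def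
  by (rule DERIV_cong, rule DERIV_mult[OF DERIV_diff[OF DERIV_logistic DERIV_const] DERIV_nu])
     (simp add: algebra_simps)

text \<open>The intermediate point appears only through an offset bounded by the increment. The
  Hessian remainder is later controlled for all such offsets simultaneously, so they can be chosen
  for each outcome without a measurable selection.\<close>

lemma phi_loss_Taylor:
  "\<exists>r. \<bar>r\<bar> \<le> \<bar>s\<bar> \<and> phi_loss \<rho> \<psi> y (t + s) - phi_loss \<rho> \<psi> y t = score y t * s + score' y (t + r) / 2 * s\<^sup>2"
proof (cases "s = 0")
  case False
  define d where "d m = (if m = 0 then phi_loss \<rho> \<psi> y else if m = 1 then score y else score' y)" for m :: nat
  have "\<exists>u. (if t + s < t then t + s < u \<and> u < t else t < u \<and> u < t + s) \<and>
      phi_loss \<rho> \<psi> y (t + s) = (\<Sum>m<2. d m t / fact m * (t + s - t) ^ m) + d 2 u / fact 2 * (t + s - t) ^ 2"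
  proof (rule Taylor[where a="min t (t+s)" and b="max t (t+s)"])
    show "\<forall>m u. m < 2 \<and> min t (t+s) \<le> u \<and> u \<le> max t (t+s) \<longrightarrow> DERIV (d m) u :> d (Suc m) u"
      by (auto simp: d_def less_2_cases_iff DERIV_phi_loss DERIV_score)
  qed (use False in \<open>auto simp: d_def\<close>)
  then obtain u where u: "if t + s < t then t + s < u \<and> u < t else t < u \<and> u < t + s"
    and "phi_loss \<rho> \<psi> y (t + s) = (\<Sum>m<2. d m t / fact m * (t + s - t) ^ m) + d 2 u / fact 2 * (t + s - t) ^ 2"
    by blast
  moreover have "\<bar>u - t\<bar> \<le> \<bar>s\<bar>" using u by (auto split: if_splits)
  ultimately show ?thesis by (intro exI[of _ "u - t"]) (simp add: d_def numeral_2_eq_2)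
qed auto

lemma continuous_on_nu: "continuous_on UNIV (nu \<psi>)"
  using DERIV_nu by (intro DERIV_continuous_on) auto

lemma continuous_on_nu': "continuous_on UNIV nu'"
proof -
  have "continuous_on UNIV (\<lambda>t. - ln (logistic t))" "continuous_on UNIV (\<lambda>t. - ln (1 - logistic t))"
    using DERIV_neg_ln_logistic DERIV_neg_ln_1_minus_logistic by (auto intro!: DERIV_continuous_on)
  note c = continuous_on_compose2[OF continuous_on_psi this(1)] continuous_on_compose2[OF continuous_on_psi this(2)]
    continuous_on_compose2[OF psi'_cont this(1)] continuous_on_compose2[OF psi'_cont this(2)]
  show ?thesis unfolding nu'_def[abs_def]
    using neg_ln_logistic_pos by (intro continuous_intros c) (auto intro: less_imp_le)
qed

lemma continuous_on_score': "continuous_on UNIV (score' y)"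
  unfolding score'_def[abs_def] by (intro continuous_intros continuous_on_nu continuous_on_nu')

lemma nu_bounds: obtains C where "C \<ge> 0" "\<And>t. \<bar>nu \<psi> t\<bar> \<le> C" "\<And>t. \<bar>nu' t\<bar> \<le> C"
proof -
  obtain C where C: "C \<ge> 0" "\<And>t. t \<ge> 0 \<Longrightarrow> \<bar>\<psi> t\<bar> \<le> C" "\<And>t. t \<ge> 0 \<Longrightarrow> \<bar>\<psi>' t\<bar> \<le> C" using psi_bound by metis
  have pr: "\<bar>a * b\<bar> \<le> C" if "\<bar>a\<bar> \<le> C" "0 \<le> b" "b \<le> 1" for a b
    using mult_mono[of "\<bar>a\<bar>" C b 1] that C(1) by (simp add: abs_mult)
  \<comment> \<open>The longer expression, \<open>nu'\<close>, expands into four products of a value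
    bounded by \<open>C\<close> with a factor between 0 and 1.\<close>
  show ?thesis
  proof (rule that[of "4 * C"])
    fix t
    define F where "F = logistic t"
    have F: "0 \<le> F" "F \<le> 1" using logistic_bounds[of t] by (auto simp: F_def)
    have F2: "0 \<le> F * (1 - F)" "F * (1 - F) \<le> 1" "F\<^sup>2 \<le> 1" "(1 - F)\<^sup>2 \<le> 1"
      using F by (auto simp: mult_le_one power_le_one)
    have p: "0 \<le> - ln F" "0 \<le> - ln (1 - F)" using neg_ln_logistic_pos[of t] by (auto simp: F_def)
    show "\<bar>nu \<psi> t\<bar> \<le> 4 * C"
      using pr[OF C(2)[OF p(1)], of "1 - F"] pr[OF C(2)[OF p(2)], of F] F C(1)
      unfolding nu_def F_def[symmetric] by linarith
    have "nu' t = \<psi> (- ln (1 - F)) * (F * (1 - F)) - \<psi> (- ln F) * (F * (1 - F))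
        + \<psi>' (- ln (1 - F)) * F\<^sup>2 - \<psi>' (- ln F) * (1 - F)\<^sup>2"
      unfolding nu'_def F_def[symmetric] by (simp add: algebra_simps)
    then show "\<bar>nu' t\<bar> \<le> 4 * C"
      using pr[OF C(2)[OF p(1)], of "F * (1 - F)"] pr[OF C(2)[OF p(2)], of "F * (1 - F)"]
        pr[OF C(3)[OF p(1)], of "(1 - F)\<^sup>2"] pr[OF C(3)[OF p(2)], of "F\<^sup>2"] F2 by simp
  qed (use C in auto)
qed

lemma score'_bound:
  obtains C where "C \<ge> 0" "\<And>y t. y \<in> {0, 1} \<Longrightarrow> \<bar>score' y t\<bar> \<le> C"
proof -
  obtain C where C: "C \<ge> 0" "\<And>t. \<bar>nu \<psi> t\<bar> \<le> C" "\<And>t. \<bar>nu' t\<bar> \<le> C" using nu_bounds by metis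
  have pr: "\<bar>b * a\<bar> \<le> C" if "\<bar>a\<bar> \<le> C" "\<bar>b\<bar> \<le> 1" for a b
    using mult_mono[of "\<bar>a\<bar>" C "\<bar>b\<bar>" 1] that C(1) by (simp add: abs_mult mult.commute)
  have F: "0 \<le> logistic t" "logistic t \<le> 1" for t using logistic_bounds[of t] by auto
  have Fy: "\<bar>logistic t - y\<bar> \<le> 1" if "y \<in> {0,1}" for t y using F[of t] that by auto
  have FF: "\<bar>logistic t * (1 - logistic t)\<bar> \<le> 1" for t using F[of t] by (auto simp: mult_le_one abs_mult)
  show ?thesis
  proof (rule that[of "2 * C"])
    fix y t :: real assume y: "y \<in> {0,1}"
    show "\<bar>score' y t\<bar> \<le> 2 * C"
      using pr[OF C(3) Fy[OF y], of t t] pr[OF C(2) FF, of t t] unfolding score'_def by linarith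
  qed (use C in auto)
qed

end

section \<open>The penalty and the limiting process\<close>

text \<open>An increment smaller than a nonzero coefficient keeps its sign, so the absolute value is
  exactly linear there; at a zero coefficient it equals the absolute increment, and
  \<open>J' 0 = 0\<close> removes the first-order term of \<open>J\<close>. Hence the only error is
  the differentiability remainder of \<open>J\<close>.\<close>

lemma penalty_coordinate_expansion:
  fixes J J' :: "real \<Rightarrow> real" and \<beta> e :: real
  assumes alpha: "0 \<le> \<alpha>" "\<alpha> \<le> 1" and J: "(J has_real_derivative J' \<bar>\<beta>\<bar>) (at \<bar>\<beta>\<bar> within {0..})"
    and J0: "J' 0 = 0" and "e > 0"
  obtains d where "d > 0" "\<And>u. \<bar>u\<bar> < d \<Longrightarrow>
    \<bar>(1 - \<alpha>) * (J \<bar>\<beta> + u\<bar> - J \<bar>\<beta>\<bar>) + \<alpha> * (\<bar>\<beta> + u\<bar> - \<bar>\<beta>\<bar>)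
      - u * ((1 - \<alpha>) * J' \<bar>\<beta>\<bar> * sgn \<beta> + \<alpha> * (sgn \<beta> * of_bool (\<beta> \<noteq> 0) + sgn u * of_bool (\<beta> = 0)))\<bar> \<le> e * \<bar>u\<bar>"
proof -
  obtain d0 where d0: "d0 > 0"
    "\<And>v. v \<ge> 0 \<Longrightarrow> \<bar>v - \<bar>\<beta>\<bar>\<bar> < d0 \<Longrightarrow> \<bar>J v - J \<bar>\<beta>\<bar> - J' \<bar>\<beta>\<bar> * (v - \<bar>\<beta>\<bar>)\<bar> \<le> e * \<bar>v - \<bar>\<beta>\<bar>\<bar>"
    using J \<open>e > 0\<close> unfolding has_field_derivative_def has_derivative_within_alt by (auto simp: real_norm_def)
  define d where "d = (if \<beta> = 0 then d0 else min d0 \<bar>\<beta>\<bar>)"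
  show ?thesis
  proof (rule that[of d])
    show "d > 0" using d0 by (simp add: d_def)
    fix u assume u: "\<bar>u\<bar> < d"
    define s where "s = sgn \<beta> * of_bool (\<beta> \<noteq> 0) + sgn u * of_bool (\<beta> = 0)"
    have abs: "\<bar>\<beta> + u\<bar> - \<bar>\<beta>\<bar> = u * s"
      using u by (auto simp: d_def s_def sgn_real_def abs_if split: if_splits)
    have lin: "J' \<bar>\<beta>\<bar> * (u * s) = u * (J' \<bar>\<beta>\<bar> * sgn \<beta>)" by (auto simp: s_def J0)
    have le: "\<bar>\<bar>\<beta> + u\<bar> - \<bar>\<beta>\<bar>\<bar> \<le> \<bar>u\<bar>" by linarith
    have "\<bar>J \<bar>\<beta> + u\<bar> - J \<bar>\<beta>\<bar> - u * (J' \<bar>\<beta>\<bar> * sgn \<beta>)\<bar> \<le> e * \<bar>\<bar>\<beta> + u\<bar> - \<bar>\<beta>\<bar>\<bar>"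
      using d0(2)[of "\<bar>\<beta> + u\<bar>"] le u d0 by (auto simp: d_def abs lin split: if_splits)
    also have "\<dots> \<le> e * \<bar>u\<bar>" using le \<open>e > 0\<close> by (intro mult_left_mono) auto
    finally have "\<bar>J \<bar>\<beta> + u\<bar> - J \<bar>\<beta>\<bar> - u * (J' \<bar>\<beta>\<bar> * sgn \<beta>)\<bar> \<le> e * \<bar>u\<bar>" .
    then have "\<bar>(1 - \<alpha>) * (J \<bar>\<beta> + u\<bar> - J \<bar>\<beta>\<bar> - u * (J' \<bar>\<beta>\<bar> * sgn \<beta>))\<bar> \<le> e * \<bar>u\<bar>"
      using alpha mult_mono[of "\<bar>1 - \<alpha>\<bar>" 1 "\<bar>J \<bar>\<beta> + u\<bar> - J \<bar>\<beta>\<bar> - u * (J' \<bar>\<beta>\<bar> * sgn \<beta>)\<bar>" "e * \<bar>u\<bar>"]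
      by (simp add: abs_mult)
    moreover have "(1 - \<alpha>) * (J \<bar>\<beta> + u\<bar> - J \<bar>\<beta>\<bar>) + \<alpha> * (u * s) - u * ((1 - \<alpha>) * J' \<bar>\<beta>\<bar> * sgn \<beta> + \<alpha> * s)
        = (1 - \<alpha>) * (J \<bar>\<beta> + u\<bar> - J \<bar>\<beta>\<bar> - u * (J' \<bar>\<beta>\<bar> * sgn \<beta>))"
      by (simp add: algebra_simps)
    ultimately show "\<bar>(1 - \<alpha>) * (J \<bar>\<beta> + u\<bar> - J \<bar>\<beta>\<bar>) + \<alpha> * (\<bar>\<beta> + u\<bar> - \<bar>\<beta>\<bar>)
      - u * ((1 - \<alpha>) * J' \<bar>\<beta>\<bar> * sgn \<beta> + \<alpha> * (sgn \<beta> * of_bool (\<beta> \<noteq> 0) + sgn u * of_bool (\<beta> = 0)))\<bar> \<le> e * \<bar>u\<bar>"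
      unfolding abs s_def[symmetric] by simp
  qed
qed

lemma penalty_diff:
  fixes \<beta>0 z :: "real^'p"
  shows "penalty \<alpha> J l (\<beta>0 + z) - penalty \<alpha> J l \<beta>0 =
    l * (\<Sum>k\<in>UNIV. (1 - \<alpha>) * (J k \<bar>\<beta>0 $ k + z $ k\<bar> - J k \<bar>\<beta>0 $ k\<bar>) + \<alpha> * (\<bar>\<beta>0 $ k + z $ k\<bar> - \<bar>\<beta>0 $ k\<bar>))"
  by (simp add: penalty_def sum.distrib sum_subtractf algebra_simps flip: sum_distrib_left)

text \<open>One factor \<open>sqrt n\<close> of \<open>n\<close> accompanies the tuning parameter,
  whose rescaled version stays bounded; the other cancels the scale of the increments. The penalty
  is linear in \<open>l\<close>, so the bound is uniform in \<open>l\<close> and a random tuning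
  parameter can be inserted afterwards.\<close>

lemma penalty_expansion:
  fixes \<beta>0 :: "real^'p"
  assumes alpha: "0 \<le> \<alpha>" "\<alpha> \<le> 1"
    and J: "\<And>k t. t \<ge> 0 \<Longrightarrow> (J k has_real_derivative J' k t) (at t within {0..})"
    and J0: "\<And>k. J' k 0 = 0" and "e > 0"
  shows "\<forall>\<^sub>F n in sequentially. \<forall>z l. norm z \<le> K \<longrightarrow>
    \<bar>real n * (penalty \<alpha> J l (\<beta>0 + (1 / sqrt (real n)) *\<^sub>R z) - penalty \<alpha> J l \<beta>0)
      - sqrt (real n) * l * (z \<bullet> q_vec \<alpha> J' \<beta>0 z)\<bar> \<le> sqrt (real n) * \<bar>l\<bar> * e"
proof -
  define q where "q k u = (1 - \<alpha>) * J' k \<bar>\<beta>0 $ k\<bar> * sgn (\<beta>0 $ k)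
    + \<alpha> * (sgn (\<beta>0 $ k) * of_bool (\<beta>0 $ k \<noteq> 0) + sgn u * of_bool (\<beta>0 $ k = 0))" for k u
  define H where "H k u = (1 - \<alpha>) * (J k \<bar>\<beta>0 $ k + u\<bar> - J k \<bar>\<beta>0 $ k\<bar>) + \<alpha> * (\<bar>\<beta>0 $ k + u\<bar> - \<bar>\<beta>0 $ k\<bar>)" for k u
  \<comment> \<open>The error is shared among the coordinates, each of size below
    \<open>\<bar>K\<bar> + 1\<close>; the added 1 keeps the denominator positive for every real
    \<open>K\<close>.\<close>
  define e' where "e' = e / (real CARD('p) * (\<bar>K\<bar> + 1))"
  have e': "e' > 0" "real CARD('p) * (e' * (\<bar>K\<bar> + 1)) = e"
    using \<open>e > 0\<close> by (auto simp: e'_def intro!: divide_pos_pos mult_pos_pos)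
  have "\<exists>d>0. \<forall>u. \<bar>u\<bar> < d \<longrightarrow> \<bar>H k u - u * q k u\<bar> \<le> e' * \<bar>u\<bar>" for k
  proof -
    have "(J k has_real_derivative J' k \<bar>\<beta>0 $ k\<bar>) (at \<bar>\<beta>0 $ k\<bar> within {0..})" by (rule J) simp
    from penalty_coordinate_expansion[OF alpha this J0 e'(1)] show ?thesis
      unfolding H_def q_def by metis
  qed
  then obtain d where d: "\<And>k. d k > 0" "\<And>k u. \<bar>u\<bar> < d k \<Longrightarrow> \<bar>H k u - u * q k u\<bar> \<le> e' * \<bar>u\<bar>"
    by metis
  have "(\<lambda>n. (\<bar>K\<bar> + 1) / sqrt (real n)) \<longlonglongrightarrow> 0"
    by (intro tendsto_divide_0[OF tendsto_const] filterlim_at_top_imp_at_infinity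
        filterlim_compose[OF sqrt_at_top filterlim_real_sequentially])
  then have "\<forall>\<^sub>F n in sequentially. (\<bar>K\<bar> + 1) / sqrt (real n) < d k" for k
    using d(1) by (intro order_tendstoD)
  then have "\<forall>\<^sub>F n in sequentially. \<forall>k\<in>UNIV. (\<bar>K\<bar> + 1) / sqrt (real n) < d k"
    by (intro eventually_ball_finite) auto
  then show ?thesis using eventually_gt_at_top[of 0]
  proof eventually_elim
    case (elim n)
    define r where "r = sqrt (real n)"
    have r: "r > 0" "r * r = real n" using elim by (auto simp: r_def)
    show ?case
    proof (intro allI impI)
      fix z :: "real^'p" and l assume z: "norm z \<le> K"
      have co: "\<bar>r * (H k (z $ k / r) - z $ k / r * q k (z $ k / r))\<bar> \<le> e' * (\<bar>K\<bar> + 1)" for k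
      proof -
        have zk: "\<bar>z $ k\<bar> < \<bar>K\<bar> + 1" using component_le_norm_cart[of z k] z by linarith
        then have "\<bar>z $ k / r\<bar> < (\<bar>K\<bar> + 1) / r" using r by (simp add: abs_divide divide_strict_right_mono)
        also have "\<dots> < d k" using elim by (simp add: r_def)
        finally have "\<bar>H k (z $ k / r) - z $ k / r * q k (z $ k / r)\<bar> \<le> e' * \<bar>z $ k / r\<bar>" by (rule d(2))
        then have "r * \<bar>H k (z $ k / r) - z $ k / r * q k (z $ k / r)\<bar> \<le> r * (e' * \<bar>z $ k / r\<bar>)"
          using r by (intro mult_left_mono) auto
        also have "\<dots> = e' * \<bar>z $ k\<bar>" using r by (simp add: abs_divide)
        also have "\<dots> \<le> e' * (\<bar>K\<bar> + 1)" using zk e' by (intro mult_left_mono) auto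
        finally show ?thesis using r by (simp add: abs_mult)
      qed
      \<comment> \<open>\<open>q\<close> sees its second argument only through its sign, so dividing
        by the positive \<open>r\<close> does not alter it.\<close>
      have qz: "z \<bullet> q_vec \<alpha> J' \<beta>0 z = (\<Sum>k\<in>UNIV. z $ k * q k (z $ k / r))"
        using r by (simp add: inner_vec_def q_vec_def q_def sgn_divide)
      have "\<bar>(\<Sum>k\<in>UNIV. r * (H k (z $ k / r) - z $ k / r * q k (z $ k / r)))\<bar> \<le> real CARD('p) * (e' * (\<bar>K\<bar> + 1))"
        using sum_norm_bound[of UNIV "\<lambda>k. r * (H k (z $ k / r) - z $ k / r * q k (z $ k / r))"] co by simp
      also have "(\<Sum>k\<in>UNIV. r * (H k (z $ k / r) - z $ k / r * q k (z $ k / r)))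
          = r * (\<Sum>k\<in>UNIV. H k (z $ k / r)) - z \<bullet> q_vec \<alpha> J' \<beta>0 z"
        using r unfolding qz by (simp add: right_diff_distrib sum_subtractf sum_distrib_left mult.assoc[symmetric])
      finally have main: "\<bar>r * (\<Sum>k\<in>UNIV. H k (z $ k / r)) - z \<bullet> q_vec \<alpha> J' \<beta>0 z\<bar> \<le> e" using e' by simp
      have "real n * (penalty \<alpha> J l (\<beta>0 + (1 / r) *\<^sub>R z) - penalty \<alpha> J l \<beta>0) - r * l * (z \<bullet> q_vec \<alpha> J' \<beta>0 z)
         = r * l * (r * (\<Sum>k\<in>UNIV. H k (z $ k / r)) - z \<bullet> q_vec \<alpha> J' \<beta>0 z)"
        unfolding penalty_diff r(2)[symmetric] by (simp add: H_def algebra_simps)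
      then have "\<bar>real n * (penalty \<alpha> J l (\<beta>0 + (1 / r) *\<^sub>R z) - penalty \<alpha> J l \<beta>0) - r * l * (z \<bullet> q_vec \<alpha> J' \<beta>0 z)\<bar>
         = r * \<bar>l\<bar> * \<bar>r * (\<Sum>k\<in>UNIV. H k (z $ k / r)) - z \<bullet> q_vec \<alpha> J' \<beta>0 z\<bar>"
        using r by (simp add: abs_mult)
      also have "\<dots> \<le> r * \<bar>l\<bar> * e" using main r by (intro mult_left_mono) auto
      finally show "\<bar>real n * (penalty \<alpha> J l (\<beta>0 + (1 / sqrt (real n)) *\<^sub>R z) - penalty \<alpha> J l \<beta>0)
        - sqrt (real n) * l * (z \<bullet> q_vec \<alpha> J' \<beta>0 z)\<bar> \<le> sqrt (real n) * \<bar>l\<bar> * e"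
        unfolding r_def .
    qed
  qed
qed

text \<open>\<open>q_vec\<close> can jump when a coordinate of \<open>z\<close> changes sign, but
  \<open>x * sgn x = \<bar>x\<bar>\<close> turns its product with \<open>z\<close> into a linear
  form plus a multiple of a weighted l1 seminorm. This is continuous and, for nonnegative
  \<open>\<alpha>\<close>, convex.\<close>

lemma inner_q_vec:
  fixes z :: "real^'p"
  shows "z \<bullet> q_vec \<alpha> J' \<beta>0 z = z \<bullet> q_vec \<alpha> J' \<beta>0 0 + \<alpha> * (\<Sum>k\<in>UNIV. of_bool (\<beta>0 $ k = 0) * \<bar>z $ k\<bar>)"
proof -
  have "x * sgn x = \<bar>x\<bar>" for x :: real by (simp add: sgn_real_def)
  then show ?thesis
    unfolding inner_vec_def q_vec_def sum_distrib_left sum.distrib[symmetric]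
    by (intro sum.cong) (auto simp: algebra_simps)
qed

lemma midpoint_inner_q_vec:
  fixes z m :: "real^'p"
  assumes "0 \<le> \<alpha>"
  shows "((1/2) *\<^sub>R (z + m)) \<bullet> q_vec \<alpha> J' \<beta>0 ((1/2) *\<^sub>R (z + m)) \<le>
    (z \<bullet> q_vec \<alpha> J' \<beta>0 z + m \<bullet> q_vec \<alpha> J' \<beta>0 m) / 2"
proof -
  have "(\<Sum>k\<in>UNIV. of_bool (\<beta>0 $ k = 0) * \<bar>((1/2) *\<^sub>R (z + m)) $ k\<bar>) \<le>
    (\<Sum>k\<in>UNIV. (of_bool (\<beta>0 $ k = 0) * \<bar>z $ k\<bar> + of_bool (\<beta>0 $ k = 0) * \<bar>m $ k\<bar>) / 2)"
    by (intro sum_mono) (auto simp: abs_mult)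
  also have "\<dots> = ((\<Sum>k\<in>UNIV. of_bool (\<beta>0 $ k = 0) * \<bar>z $ k\<bar>) + (\<Sum>k\<in>UNIV. of_bool (\<beta>0 $ k = 0) * \<bar>m $ k\<bar>)) / 2"
    by (simp add: sum.distrib flip: sum_divide_distrib)
  finally show ?thesis using mult_left_mono[OF _ assms]
    unfolding inner_q_vec[where z="(1/2) *\<^sub>R (z + m)"] inner_q_vec[where z=z] inner_q_vec[where z=m]
    by (fastforce simp: inner_add_left field_simps)
qed

lemma parallelogram_matrix:
  fixes z m :: "real^'p" and A :: "real^'p^'p"
  shows "((1/2) *\<^sub>R (z + m)) \<bullet> (A *v ((1/2) *\<^sub>R (z + m))) =
    (z \<bullet> (A *v z) + m \<bullet> (A *v m)) / 2 - ((z - m) \<bullet> (A *v (z - m))) / 4"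
  by (simp add: matrix_vector_mult_scaleR matrix_vector_right_distrib matrix_vector_mult_diff_distrib
      inner_add_left inner_add_right inner_diff_left inner_diff_right field_simps)

section \<open>Strong convexity and the minimiser of the limiting process\<close>

context
  fixes A :: "real^'p^'p" and b \<alpha> c :: real and J' :: "'p \<Rightarrow> real \<Rightarrow> real" and \<beta>0 :: "real^'p"
  assumes b: "b \<ge> 0" and alpha: "\<alpha> \<ge> 0" and c: "c > 0" and coercive: "\<And>z. z \<bullet> (A *v z) \<ge> c * (norm z)\<^sup>2"
begin

text \<open>The midpoint form of strong convexity avoids derivatives, which the l1 part lacks. The
  constant is the factor 1/2 of the quadratic term times the 1/4 of the parallelogram
  identity.\<close>

lemma R_proc_midpoint:
  "R_proc A b \<alpha> J' \<beta>0 v ((1/2) *\<^sub>R (z + m)) \<le>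
    (R_proc A b \<alpha> J' \<beta>0 v z + R_proc A b \<alpha> J' \<beta>0 v m) / 2 - c / 8 * (norm (z - m))\<^sup>2"
  using mult_left_mono[OF midpoint_inner_q_vec[OF alpha, of z m J' \<beta>0] b] coercive[of "z - m"]
  unfolding R_proc_def parallelogram_matrix by (simp add: inner_add_left field_simps)

text \<open>The value at the midpoint cannot be below the minimum; solving the midpoint inequality
  for the gap doubles its constant.\<close>

lemma R_proc_growth:
  assumes "is_arg_min (R_proc A b \<alpha> J' \<beta>0 v) (\<lambda>_. True) m"
  shows "R_proc A b \<alpha> J' \<beta>0 v z - R_proc A b \<alpha> J' \<beta>0 v m \<ge> c / 4 * (norm (z - m))\<^sup>2"
proof -
  have "R_proc A b \<alpha> J' \<beta>0 v m \<le> R_proc A b \<alpha> J' \<beta>0 v ((1/2) *\<^sub>R (z + m))"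
    using assms by (auto simp: is_arg_min_def not_less)
  then show ?thesis using R_proc_midpoint[where v=v and z=z and m=m] by (simp add: field_simps)
qed

lemma R_proc_argmin_exists: "\<exists>m. is_arg_min (R_proc A b \<alpha> J' \<beta>0 v) (\<lambda>_. True) m"
proof -
  define f where "f = R_proc A b \<alpha> J' \<beta>0 v"
  have f0: "f 0 = 0" by (simp add: f_def R_proc_def)
  have "continuous_on UNIV f"
    unfolding f_def R_proc_def[abs_def] inner_q_vec by (intro continuous_intros)
  \<comment> \<open>From this radius on the quadratic term outweighs the two linear ones, so the
    process is at least its value 0 at the origin, and minimising over the ball is enough.\<close>
  define r where "r = 2 / c * (norm v + b * norm (q_vec \<alpha> J' \<beta>0 0))"
  have r: "r \<ge> 0" using b c by (simp add: r_def)
  have out: "f z \<ge> 0" if "norm z \<ge> r" for z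
  proof -
    have "(\<Sum>k\<in>UNIV. of_bool (\<beta>0 $ k = 0) * \<bar>z $ k\<bar>) \<ge> 0" by (intro sum_nonneg) auto
    then have "z \<bullet> q_vec \<alpha> J' \<beta>0 z \<ge> - (norm z * norm (q_vec \<alpha> J' \<beta>0 0))"
      using Cauchy_Schwarz_ineq2[of z "q_vec \<alpha> J' \<beta>0 0"] mult_nonneg_nonneg[OF alpha]
      unfolding inner_q_vec[where z=z] by fastforce
    then have "b * (z \<bullet> q_vec \<alpha> J' \<beta>0 z) \<ge> b * - (norm z * norm (q_vec \<alpha> J' \<beta>0 0))"
      using b by (rule mult_left_mono)
    moreover have "z \<bullet> v \<ge> - (norm z * norm v)" using Cauchy_Schwarz_ineq2[of z v] by linarith
    ultimately have "f z \<ge> norm z * (c / 2 * norm z - (norm v + b * norm (q_vec \<alpha> J' \<beta>0 0)))"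
      using coercive[of z] unfolding f_def R_proc_def by (simp add: algebra_simps power2_eq_square)
    moreover have "c / 2 * norm z \<ge> norm v + b * norm (q_vec \<alpha> J' \<beta>0 0)"
      using that c by (simp add: r_def field_simps)
    ultimately show ?thesis
      by (smt (verit) mult_nonneg_nonneg norm_ge_zero)
  qed
  obtain m where m: "m \<in> cball 0 r" "\<And>z. z \<in> cball 0 r \<Longrightarrow> f m \<le> f z"
    using continuous_attains_inf[of "cball 0 r" f] continuous_on_subset[OF \<open>continuous_on UNIV f\<close>] r by auto
  have "f m \<le> f z" for z
    using m(2)[of z] m(2)[of 0] out[of z] f0 r by (cases "norm z \<le> r") auto
  then show ?thesis unfolding f_def[symmetric] by (auto simp: is_arg_min_def not_less)
qed

lemma R_proc_argmin_unique: "\<exists>!m. is_arg_min (R_proc A b \<alpha> J' \<beta>0 v) (\<lambda>_. True) m"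
proof (rule ex_ex1I[OF R_proc_argmin_exists])
  fix m m' assume m: "is_arg_min (R_proc A b \<alpha> J' \<beta>0 v) (\<lambda>_. True) m" "is_arg_min (R_proc A b \<alpha> J' \<beta>0 v) (\<lambda>_. True) m'"
  have "c / 4 * (norm (m' - m))\<^sup>2 \<le> 0"
    using R_proc_growth[OF m(1), of m'] m(2) unfolding is_arg_min_def by (smt (verit))
  then show "m = m'" using c by (simp add: mult_le_0_iff)
qed

lemma R_proc_arg_min: "is_arg_min (R_proc A b \<alpha> J' \<beta>0 v) (\<lambda>_. True) (arg_min (R_proc A b \<alpha> J' \<beta>0 v) (\<lambda>_. True))"
  unfolding arg_min_def using R_proc_argmin_exists by (rule someI_ex)

text \<open>The parameter enters only through the linear term. Adding the growth inequalities at the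
  two minimisers cancels everything else and leaves \<open>c / 2\<close> times the squared distance
  below an inner product with \<open>v - u\<close>, hence the constant \<open>2 / c\<close>.
  Continuity also makes the choice-defined minimiser measurable in the Gaussian vector.\<close>

lemma continuous_arg_min_R_proc: "continuous_on UNIV (\<lambda>v. arg_min (R_proc A b \<alpha> J' \<beta>0 v) (\<lambda>_. True))"
proof -
  define m where "m v = arg_min (R_proc A b \<alpha> J' \<beta>0 v) (\<lambda>_. True)" for v
  have lip: "dist (m v) (m u) \<le> 2 / c * dist v u" for u v
  proof -
    have swap: "R_proc A b \<alpha> J' \<beta>0 v z = R_proc A b \<alpha> J' \<beta>0 u z + z \<bullet> (v - u)" for z
      by (simp add: R_proc_def inner_diff_right)
    have "c / 2 * (norm (m v - m u))\<^sup>2 \<le> (m u - m v) \<bullet> (v - u)"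
      using R_proc_growth[OF R_proc_arg_min, where z="m v" and v=u] R_proc_growth[OF R_proc_arg_min, where z="m u" and v=v]
      unfolding m_def[symmetric] swap by (simp add: inner_diff_left norm_minus_commute)
    also have "\<dots> \<le> norm (m v - m u) * norm (v - u)"
      using norm_cauchy_schwarz[of "m u - m v" "v - u"] by (simp add: norm_minus_commute)
    finally have "norm (m v - m u) * (c / 2 * norm (m v - m u) - norm (v - u)) \<le> 0"
      by (simp add: power2_eq_square algebra_simps)
    then have "c / 2 * norm (m v - m u) \<le> norm (v - u)"
      by (cases "norm (m v - m u) = 0") (auto simp: mult_le_0_iff)
    then show ?thesis using c by (simp add: dist_norm field_simps)
  qed
  have "(2 / c)-lipschitz_on UNIV m"
    using lip c by (intro lipschitz_onI) auto
  then show ?thesis unfolding m_def[symmetric] by (rule lipschitz_on_continuous_on)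
qed

end

section \<open>Sampling from the logistic model\<close>

text \<open>The sample is indexed from 1 while the limit theorems sum over \<open>i < n\<close>; the
  shift by \<open>Suc\<close> is an instance. A finite subfamily is carried to the image, where
  independence is known, through the inverse of \<open>f\<close>.\<close>

lemma (in prob_space) indep_sets_reindex:
  assumes ind: "indep_sets F I" and f: "inj_on f J" "f ` J \<subseteq> I"
  shows "indep_sets (\<lambda>j. F (f j)) J"
  unfolding indep_sets_def
proof (intro conjI ballI allI impI)
  show "F (f j) \<subseteq> events" if "j \<in> J" for j
    using ind f that by (auto simp: indep_sets_def)
  fix K A assume K: "K \<subseteq> J" "K \<noteq> {}" "finite K" and A: "A \<in> Pi K (\<lambda>j. F (f j))"
  define A' where "A' i = A (inv_into J f i)" for i
  have inv: "A' (f j) = A j" if "j \<in> K" for j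
    using K f that by (auto simp: A'_def)
  have "\<forall>B\<in>Pi (f ` K) F. prob (\<Inter>j\<in>f ` K. B j) = (\<Prod>j\<in>f ` K. prob (B j))"
  proof -
    have "f ` K \<subseteq> I" "f ` K \<noteq> {}" "finite (f ` K)" using K f by auto
    then show ?thesis using ind unfolding indep_sets_def by blast
  qed
  moreover have "A' \<in> Pi (f ` K) F" using A inv by auto
  ultimately have "prob (\<Inter>j\<in>f ` K. A' j) = (\<Prod>j\<in>f ` K. prob (A' j))" by blast
  moreover have "(\<Prod>j\<in>f ` K. prob (A' j)) = (\<Prod>j\<in>K. prob (A j))"
    using K f inv by (subst prod.reindex) (auto intro: inj_on_subset)
  ultimately show "prob (\<Inter>j\<in>K. A j) = (\<Prod>j\<in>K. prob (A j))" using inv by simp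
qed

lemma (in prob_space) indep_vars_reindex:
  assumes "indep_vars N X I" "inj_on f J" "f ` J \<subseteq> I"
  shows "indep_vars (\<lambda>j. N (f j)) (\<lambda>j. X (f j)) J"
  using assms indep_sets_reindex[OF _ assms(2,3)] unfolding indep_vars_def2 by blast

lemma borel_measurable_vec_nth [measurable (raw)]:
  fixes f :: "'a \<Rightarrow> real^'p"
  assumes "f \<in> borel_measurable L" shows "(\<lambda>\<omega>. f \<omega> $ i) \<in> borel_measurable L"
  by (rule measurable_compose[OF assms borel_measurable_continuous_onI]) (intro continuous_intros)

lemma Cauchy_Schwarz_swap: "\<bar>u \<bullet> z\<bar> \<le> norm z * norm u"
  using Cauchy_Schwarz_ineq2[of u z] by (simp add: mult.commute)

lemma quadratic_form_integral:
  fixes x :: "'a \<Rightarrow> real^'p"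
  assumes "\<And>i j. integrable M (\<lambda>\<omega>. g \<omega> * (x \<omega> $ i * x \<omega> $ j))"
  shows "u \<bullet> ((\<chi> i j. \<integral>\<omega>. g \<omega> * (x \<omega> $ i * x \<omega> $ j) \<partial>M) *v v) = (\<integral>\<omega>. g \<omega> * ((x \<omega> \<bullet> u) * (x \<omega> \<bullet> v)) \<partial>M)"
proof -
  have "(\<integral>\<omega>. g \<omega> * ((x \<omega> \<bullet> u) * (x \<omega> \<bullet> v)) \<partial>M) =
      (\<integral>\<omega>. (\<Sum>i\<in>UNIV. \<Sum>j\<in>UNIV. (u $ i * v $ j) * (g \<omega> * (x \<omega> $ i * x \<omega> $ j))) \<partial>M)"
    unfolding inner_vec_def sum_product
    by (auto simp: sum_distrib_left algebra_simps intro!: Bochner_Integration.integral_cong sum.cong)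
  also have "\<dots> = (\<Sum>i\<in>UNIV. \<Sum>j\<in>UNIV. (u $ i * v $ j) * (\<integral>\<omega>. g \<omega> * (x \<omega> $ i * x \<omega> $ j) \<partial>M))"
    using assms by (simp add: Bochner_Integration.integral_sum)
  finally show ?thesis
    by (simp add: inner_vec_def matrix_vector_mult_def sum_distrib_left algebra_simps)
qed

locale logistic_sample = prob_space M + smooth_loss \<rho> \<psi> \<psi>'
  for M :: "'a measure" and \<rho> \<psi> \<psi>' +
  fixes y :: "'a \<Rightarrow> real" and x :: "'a \<Rightarrow> real^'p"
    and Y :: "nat \<Rightarrow> 'a \<Rightarrow> real" and X :: "nat \<Rightarrow> 'a \<Rightarrow> real^'p"
    and \<beta>0 :: "real^'p" and w :: "real^'p \<Rightarrow> real"
  assumes y_meas [measurable]: "y \<in> borel_measurable M" and x_meas [measurable]: "x \<in> borel_measurable M"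
    and y_binary: "AE \<omega> in M. y \<omega> \<in> {0, 1}"
    and model: "AE \<omega> in M. real_cond_exp M (vimage_algebra (space M) x borel)
                  (indicator {\<omega> \<in> space M. y \<omega> = 1}) \<omega> = logistic (x \<omega> \<bullet> \<beta>0)"
    and indep: "indep_vars (\<lambda>_. borel) (\<lambda>i \<omega>. (Y i \<omega>, X i \<omega>)) {1..}"
    and ident: "\<And>i. i \<ge> 1 \<Longrightarrow>
                  distr M borel (\<lambda>\<omega>. (Y i \<omega>, X i \<omega>)) = distr M borel (\<lambda>\<omega>. (y \<omega>, x \<omega>))"
    and w_meas [measurable]: "w \<in> borel_measurable borel" and w_nonneg: "\<And>u. w u \<ge> 0"
    and w_le: "\<And>u. w u \<le> 1"
    and wx2: "integrable M (\<lambda>\<omega>. w (x \<omega>) * (norm (x \<omega>))\<^sup>2)"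
begin

lemma logistic_nu_measurable [measurable]: "logistic \<in> borel_measurable borel" "nu \<psi> \<in> borel_measurable borel" "nu' \<in> borel_measurable borel"
  using continuous_on_logistic[OF continuous_on_id, of UNIV] continuous_on_nu continuous_on_nu'
  by (auto intro: borel_measurable_continuous_onI)

lemma pair_measurable [measurable]: "i \<ge> 1 \<Longrightarrow> (\<lambda>\<omega>. (Y i \<omega>, X i \<omega>)) \<in> borel_measurable M"
  using indep by (auto simp: indep_vars_def2)

lemma Y_X_meas:
  assumes "i \<ge> 1" shows "Y i \<in> borel_measurable M" "X i \<in> borel_measurable M"
  using measurable_compose[OF pair_measurable[OF assms] borel_measurable_continuous_onI[OF continuous_on_fst[OF continuous_on_id]]]
    measurable_compose[OF pair_measurable[OF assms] borel_measurable_continuous_onI[OF continuous_on_snd[OF continuous_on_id]]]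
  by simp_all

lemma pair_borel_measurable:
  assumes "(\<lambda>p. g (fst p) (snd p)) \<in> borel_measurable (borel \<Otimes>\<^sub>M borel)"
  shows "(\<lambda>p :: real \<times> (real^'p). g (fst p) (snd p)) \<in> borel_measurable borel"
  using assms by (simp only: borel_prod)

text \<open>Packages, for an arbitrary statistic of one observation, the hypotheses in the form in
  which both limit theorems take them, with the sample shifted to start at 0.\<close>

lemma iid:
  fixes g :: "real \<Rightarrow> real^'p \<Rightarrow> 'd::topological_space"
  assumes "(\<lambda>p. g (fst p) (snd p)) \<in> borel_measurable (borel \<Otimes>\<^sub>M borel)"
  shows "indep_vars (\<lambda>_. borel) (\<lambda>i \<omega>. g (Y (Suc i) \<omega>) (X (Suc i) \<omega>)) UNIV"
    and "distr M borel (\<lambda>\<omega>. g (Y (Suc i) \<omega>) (X (Suc i) \<omega>)) = distr M borel (\<lambda>\<omega>. g (y \<omega>) (x \<omega>))"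
    and "(\<lambda>\<omega>. g (Y (Suc i) \<omega>) (X (Suc i) \<omega>)) \<in> borel_measurable M"
    and "(\<lambda>\<omega>. g (y \<omega>) (x \<omega>)) \<in> borel_measurable M"
proof -
  note g = pair_borel_measurable[OF assms]
  have "indep_vars (\<lambda>_. borel) (\<lambda>i \<omega>. (Y (Suc i) \<omega>, X (Suc i) \<omega>)) UNIV"
    by (rule indep_vars_reindex[OF indep]) auto
  from indep_vars_compose2[OF this g]
  show "indep_vars (\<lambda>_. borel) (\<lambda>i \<omega>. g (Y (Suc i) \<omega>) (X (Suc i) \<omega>)) UNIV" by simp
  have p: "(\<lambda>\<omega>. (y \<omega>, x \<omega>)) \<in> borel_measurable M" by simp
  show "distr M borel (\<lambda>\<omega>. g (Y (Suc i) \<omega>) (X (Suc i) \<omega>)) = distr M borel (\<lambda>\<omega>. g (y \<omega>) (x \<omega>))"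
    using distr_distr[OF g pair_measurable[of "Suc i"]] distr_distr[OF g p] ident[of "Suc i"] by (simp add: comp_def)
  show "(\<lambda>\<omega>. g (Y (Suc i) \<omega>) (X (Suc i) \<omega>)) \<in> borel_measurable M" "(\<lambda>\<omega>. g (y \<omega>) (x \<omega>)) \<in> borel_measurable M"
    using measurable_compose[OF pair_measurable[of "Suc i"] g] measurable_compose[OF p g] by simp_all
qed

lemma Y_binary: "AE \<omega> in M. \<forall>i. Y (Suc i) \<omega> \<in> {0, 1}"
proof -
  have "AE \<omega> in M. Y (Suc i) \<omega> \<in> {0, 1}" for i
  proof -
    have d: "distr M borel (Y (Suc i)) = distr M borel y"
      using iid(2)[of "\<lambda>y x. y"] by simp
    have "AE r in distr M borel y. r \<in> {0, 1}"
      using y_binary by (subst AE_distr_iff) auto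
    then show ?thesis unfolding d[symmetric]
      using Y_X_meas(1)[of "Suc i"] by (subst (asm) AE_distr_iff) auto
  qed
  then show ?thesis by (simp add: AE_all_countable)
qed

text \<open>The residual is orthogonal to every integrable function of the covariate: a binary
  \<open>y\<close> is almost surely the indicator of \<open>y = 1\<close>, and
  \<open>h (x \<omega>)\<close> can be taken out of the conditional expectation. The mean of the
  score, its variance and the mean Hessian all rest on this.\<close>

lemma cond_mean:
  assumes h [measurable]: "h \<in> borel_measurable borel" and int: "integrable M (\<lambda>\<omega>. h (x \<omega>))"
  shows "expectation (\<lambda>\<omega>. (logistic (x \<omega> \<bullet> \<beta>0) - y \<omega>) * h (x \<omega>)) = 0"
    and "integrable M (\<lambda>\<omega>. (logistic (x \<omega> \<bullet> \<beta>0) - y \<omega>) * h (x \<omega>))"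
proof -
  define S where "S = vimage_algebra (space M) x borel"
  define I where "I = {\<omega> \<in> space M. y \<omega> = 1}"
  have [measurable]: "I \<in> sets M" unfolding I_def by measurable
  have xS [measurable]: "x \<in> borel_measurable S" unfolding S_def by (rule measurable_vimage_algebra1) auto
  have "subalgebra M S"
    unfolding subalgebra_def S_def by (auto simp: sets_vimage_algebra2 intro: measurable_sets[OF x_meas])
  then interpret S: finite_measure_subalgebra M S by unfold_locales
  have hS: "(\<lambda>\<omega>. h (x \<omega>)) \<in> borel_measurable S" by measurable
  have int1: "integrable M (\<lambda>\<omega>. h (x \<omega>) * indicator I \<omega>)"
    using integrable_mult_indicator[OF \<open>I \<in> sets M\<close> int] by (simp add: mult.commute)
  have int2: "integrable M (\<lambda>\<omega>. h (x \<omega>) * logistic (x \<omega> \<bullet> \<beta>0))"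
    proof (rule Bochner_Integration.integrable_bound[OF int])
    have "\<bar>logistic t\<bar> \<le> 1" for t using logistic_bounds[of t] by simp
    then show "AE \<omega> in M. norm (h (x \<omega>) * logistic (x \<omega> \<bullet> \<beta>0)) \<le> norm (h (x \<omega>))"
      by (intro AE_I2) (simp add: abs_mult mult_left_le)
  qed simp
  have eqy: "AE \<omega> in M. h (x \<omega>) * indicator I \<omega> = y \<omega> * h (x \<omega>)"
    using y_binary AE_space by eventually_elim (auto simp: I_def indicator_def)
  have eq: "AE \<omega> in M. h (x \<omega>) * logistic (x \<omega> \<bullet> \<beta>0) - h (x \<omega>) * indicator I \<omega> = (logistic (x \<omega> \<bullet> \<beta>0) - y \<omega>) * h (x \<omega>)"
    using eqy by eventually_elim (metis left_diff_distrib mult.commute)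
  have "expectation (\<lambda>\<omega>. h (x \<omega>) * indicator I \<omega>) = expectation (\<lambda>\<omega>. h (x \<omega>) * real_cond_exp M S (indicator I) \<omega>)"
    by (rule S.real_cond_exp_intg(2)[OF int1 hS, symmetric]) auto
  also have "\<dots> = expectation (\<lambda>\<omega>. h (x \<omega>) * logistic (x \<omega> \<bullet> \<beta>0))"
    using model unfolding S_def[symmetric] I_def[symmetric] by (intro integral_cong_AE) auto
  finally have *: "expectation (\<lambda>\<omega>. h (x \<omega>) * indicator I \<omega>) = expectation (\<lambda>\<omega>. h (x \<omega>) * logistic (x \<omega> \<bullet> \<beta>0))" .
  have int3: "integrable M (\<lambda>\<omega>. h (x \<omega>) * logistic (x \<omega> \<bullet> \<beta>0) - h (x \<omega>) * indicator I \<omega>)"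
    using int1 int2 by simp
  show "integrable M (\<lambda>\<omega>. (logistic (x \<omega> \<bullet> \<beta>0) - y \<omega>) * h (x \<omega>))"
    using int3 by (subst integrable_cong_AE[OF _ _ eq, symmetric]) auto
  have "expectation (\<lambda>\<omega>. (logistic (x \<omega> \<bullet> \<beta>0) - y \<omega>) * h (x \<omega>)) =
      expectation (\<lambda>\<omega>. h (x \<omega>) * logistic (x \<omega> \<bullet> \<beta>0) - h (x \<omega>) * indicator I \<omega>)"
    using eq by (intro integral_cong_AE) auto
  then show "expectation (\<lambda>\<omega>. (logistic (x \<omega> \<bullet> \<beta>0) - y \<omega>) * h (x \<omega>)) = 0"
    using int1 int2 * by simp
qed

section \<open>Weighted moments and the quadratic forms of the two matrices\<close>

lemma integrable_dominated:
  fixes f :: "'a \<Rightarrow> real"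
  assumes "f \<in> borel_measurable M" "AE \<omega> in M. \<bar>f \<omega>\<bar> \<le> C * (w (x \<omega>) * (norm (x \<omega>))\<^sup>2)"
  shows "integrable M f"
  by (rule Bochner_Integration.integrable_bound[OF integrable_mult_right[OF wx2, of C] assms(1)])
     (use assms(2) in \<open>auto elim!: eventually_mono intro: order_trans[OF _ abs_ge_self]\<close>)

lemma integrable_wx: "integrable M (\<lambda>\<omega>. w (x \<omega>) * norm (x \<omega>))"
proof (rule Bochner_Integration.integrable_bound[of _ "\<lambda>\<omega>. 1 + w (x \<omega>) * (norm (x \<omega>))\<^sup>2"])
  show "AE \<omega> in M. norm (w (x \<omega>) * norm (x \<omega>)) \<le> norm (1 + w (x \<omega>) * (norm (x \<omega>))\<^sup>2)"
  proof (rule AE_I2)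
    fix \<omega>
    have "norm (x \<omega>) \<le> 1 + (norm (x \<omega>))\<^sup>2"
      using zero_le_power2[of "norm (x \<omega>) - 1"] unfolding power2_diff by simp (smt (verit) norm_ge_zero)
    then have "w (x \<omega>) * norm (x \<omega>) \<le> w (x \<omega>) * (1 + (norm (x \<omega>))\<^sup>2)" by (intro mult_left_mono w_nonneg)
    then show "norm (w (x \<omega>) * norm (x \<omega>)) \<le> norm (1 + w (x \<omega>) * (norm (x \<omega>))\<^sup>2)"
      using w_nonneg[of "x \<omega>"] w_le[of "x \<omega>"] by (simp add: distrib_left)
  qed
qed (use wx2 in auto)

lemma abs_prod_le:
  assumes "\<bar>c\<bar> \<le> C" "\<bar>r\<bar> \<le> K * norm u" "\<bar>s\<bar> \<le> L * norm u"
  shows "\<bar>c * w u * (r * s)\<bar> \<le> (C * K * L) * (w u * (norm u)\<^sup>2)"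
proof -
  have "\<bar>c * w u * (r * s)\<bar> = w u * (\<bar>c\<bar> * (\<bar>r\<bar> * \<bar>s\<bar>))"
    using w_nonneg[of u] by (simp add: abs_mult)
  also have "\<dots> \<le> w u * (C * ((K * norm u) * (L * norm u)))"
    using assms w_nonneg[of u] by (intro mult_left_mono mult_mono) (auto intro: order_trans[OF abs_ge_zero])
  finally show ?thesis by (simp add: power2_eq_square algebra_simps)
qed

text \<open>Lets the squared weights in \<open>B\<close> be dominated by the single weighted moment
  that is assumed finite.\<close>

lemma w_sq_le: "(w u)\<^sup>2 \<le> w u"
  using w_nonneg[of u] w_le[of u] by (simp add: power2_eq_square mult_left_le)

lemma logistic_product_bounds: "\<bar>logistic t * (1 - logistic t)\<bar> \<le> 1" "\<bar>2 * logistic t - 1\<bar> \<le> 1"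
  using logistic_bounds[of t] by (auto simp: abs_mult mult_le_one)

lemma weighted_integrable:
  assumes "g \<in> borel_measurable borel" "\<And>t. \<bar>g t\<bar> \<le> C"
  shows "integrable M (\<lambda>\<omega>. g (x \<omega> \<bullet> \<beta>0) * w (x \<omega>) * (x \<omega> $ i * x \<omega> $ j))"
    and "integrable M (\<lambda>\<omega>. g (x \<omega> \<bullet> \<beta>0) * (w (x \<omega>))\<^sup>2 * (x \<omega> $ i * x \<omega> $ j))"
proof -
  note [measurable] = assms(1)
  have le: "\<bar>g t * w u * (u $ i * u $ j)\<bar> \<le> C * (w u * (norm u)\<^sup>2)" for t u
    using abs_prod_le[OF assms(2)[of t], of "u $ i" 1 u "u $ j" 1] component_le_norm_cart[of u] by simp
  show "integrable M (\<lambda>\<omega>. g (x \<omega> \<bullet> \<beta>0) * w (x \<omega>) * (x \<omega> $ i * x \<omega> $ j))"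
    by (rule integrable_dominated[of _ C]) (use le in auto)
  have le2: "\<bar>g t * (w u)\<^sup>2 * (u $ i * u $ j)\<bar> \<le> C * (w u * (norm u)\<^sup>2)" for t u
  proof -
    have "\<bar>g t * (w u)\<^sup>2 * (u $ i * u $ j)\<bar> = (w u)\<^sup>2 * \<bar>g t * (u $ i * u $ j)\<bar>" by (simp add: abs_mult)
    also have "\<dots> \<le> w u * \<bar>g t * (u $ i * u $ j)\<bar>" by (intro mult_right_mono w_sq_le) auto
    also have "\<dots> = \<bar>g t * w u * (u $ i * u $ j)\<bar>" using w_nonneg[of u] by (simp add: abs_mult)
    finally show ?thesis using le[of t u] by linarith
  qed
  show "integrable M (\<lambda>\<omega>. g (x \<omega> \<bullet> \<beta>0) * (w (x \<omega>))\<^sup>2 * (x \<omega> $ i * x \<omega> $ j))"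
    by (rule integrable_dominated[of _ C]) (use le2 in auto)
qed

abbreviation "A \<equiv> A_mat M x \<psi> w \<beta>0"
abbreviation "B \<equiv> B_mat M x \<psi> w \<beta>0"

lemma info_bounded: obtains C where "\<And>t. \<bar>logistic t * (1 - logistic t) * nu \<psi> t\<bar> \<le> C"
proof -
  obtain C where C: "C \<ge> 0" "\<And>t. \<bar>nu \<psi> t\<bar> \<le> C" using nu_bounds by metis
  have "\<bar>logistic t * (1 - logistic t) * nu \<psi> t\<bar> \<le> C" for t
    using mult_mono[OF logistic_product_bounds(1)[of t] C(2)[of t]] C(1) by (simp add: abs_mult)
  then show ?thesis by (rule that)
qed

lemma A_form:
  "u \<bullet> (A *v v) = expectation (\<lambda>\<omega>. logistic (x \<omega> \<bullet> \<beta>0) * (1 - logistic (x \<omega> \<bullet> \<beta>0)) * nu \<psi> (x \<omega> \<bullet> \<beta>0)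
     * w (x \<omega>) * ((x \<omega> \<bullet> u) * (x \<omega> \<bullet> v)))"
proof -
  obtain C where C: "\<And>t. \<bar>logistic t * (1 - logistic t) * nu \<psi> t\<bar> \<le> C" by (rule info_bounded) blast
  show ?thesis unfolding A_mat_def
    by (rule quadratic_form_integral, rule weighted_integrable(1)[OF _ C]) simp
qed

lemma B_form:
  "u \<bullet> (B *v v) = expectation (\<lambda>\<omega>. logistic (x \<omega> \<bullet> \<beta>0) * (1 - logistic (x \<omega> \<bullet> \<beta>0)) * (nu \<psi> (x \<omega> \<bullet> \<beta>0))\<^sup>2
     * (w (x \<omega>))\<^sup>2 * ((x \<omega> \<bullet> u) * (x \<omega> \<bullet> v)))"
proof -
  obtain C where C: "C \<ge> 0" "\<And>t. \<bar>nu \<psi> t\<bar> \<le> C" using nu_bounds by metis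
  have "\<bar>logistic t * (1 - logistic t) * (nu \<psi> t)\<^sup>2\<bar> \<le> C\<^sup>2" for t
    using mult_mono[OF logistic_product_bounds(1)[of t] power_mono[OF C(2)[of t], of 2]] C(1) by (simp add: abs_mult)
  then show ?thesis unfolding B_mat_def
    by (intro quadratic_form_integral weighted_integrable(2)) simp
qed

text \<open>The form at \<open>z\<close> is the mean of a nonnegative \<open>g\<close> times the
  square of \<open>x \<bullet> z\<close>. If it vanished, \<open>g\<close> times
  \<open>x \<bullet> z\<close> would vanish almost surely, hence so would every
  \<open>u \<bullet> (A *v z)\<close>, and \<open>z\<close> would lie in the kernel. Compactness of
  the unit sphere and homogeneity turn positivity into a constant.\<close>

lemma A_coercive:
  assumes nu: "\<And>t. nu \<psi> t \<ge> 0" and inv: "invertible A"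
  obtains c where "c > 0" "\<And>z. z \<bullet> (A *v z) \<ge> c * (norm z)\<^sup>2"
proof -
  define g where "g \<omega> = logistic (x \<omega> \<bullet> \<beta>0) * (1 - logistic (x \<omega> \<bullet> \<beta>0)) * nu \<psi> (x \<omega> \<bullet> \<beta>0) * w (x \<omega>)" for \<omega>
  have g0: "g \<omega> \<ge> 0" for \<omega>
    using nu w_nonneg logistic_bounds[of "x \<omega> \<bullet> \<beta>0"] by (simp add: g_def)
  have [measurable]: "g \<in> borel_measurable M" unfolding g_def by measurable
  obtain C where C: "\<And>t. \<bar>logistic t * (1 - logistic t) * nu \<psi> t\<bar> \<le> C" by (rule info_bounded) blast
  have int: "integrable M (\<lambda>\<omega>. g \<omega> * ((x \<omega> \<bullet> z) * (x \<omega> \<bullet> z)))" for z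
  proof (rule integrable_dominated)
    show "AE \<omega> in M. \<bar>g \<omega> * ((x \<omega> \<bullet> z) * (x \<omega> \<bullet> z))\<bar> \<le> C * norm z * norm z * (w (x \<omega>) * (norm (x \<omega>))\<^sup>2)"
      unfolding g_def by (intro AE_I2 abs_prod_le C) (simp_all add: Cauchy_Schwarz_swap)
  qed measurable
  have form: "u \<bullet> (A *v z) = expectation (\<lambda>\<omega>. g \<omega> * ((x \<omega> \<bullet> u) * (x \<omega> \<bullet> z)))" for u z
    unfolding g_def A_form ..
  have pos: "z \<bullet> (A *v z) > 0" if "z \<noteq> 0" for z
  proof (rule ccontr)
    assume "\<not> z \<bullet> (A *v z) > 0"
    moreover have "z \<bullet> (A *v z) \<ge> 0" unfolding form by (intro integral_nonneg_AE AE_I2 mult_nonneg_nonneg[OF g0] zero_le_square)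
    ultimately have "expectation (\<lambda>\<omega>. g \<omega> * ((x \<omega> \<bullet> z) * (x \<omega> \<bullet> z))) = 0" unfolding form by simp
    then have "AE \<omega> in M. g \<omega> * ((x \<omega> \<bullet> z) * (x \<omega> \<bullet> z)) = 0"
      by (subst (asm) integral_nonneg_eq_0_iff_AE[OF int]) (auto simp: g0)
    then have "expectation (\<lambda>\<omega>. g \<omega> * ((x \<omega> \<bullet> u) * (x \<omega> \<bullet> z))) = expectation (\<lambda>\<omega>. 0)" for u
      by (intro integral_cong_AE) auto
    then have "u \<bullet> (A *v z) = 0" for u unfolding form by simp
    from this[of "A *v z"] have "A *v z = 0" by simp
    then show False using inv that by (metis invertible_eq_bij matrix_vector_mult_0_right bij_def injD)
  qed
  have "continuous_on (sphere 0 1) (\<lambda>z. z \<bullet> (A *v z))"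
    by (intro continuous_intros)
  moreover have "sphere 0 1 \<noteq> ({} :: (real^'p) set)" by simp
  ultimately obtain z0 where z0: "z0 \<in> sphere 0 1" "\<And>z. z \<in> sphere 0 1 \<Longrightarrow> z0 \<bullet> (A *v z0) \<le> z \<bullet> (A *v z)"
    using continuous_attains_inf[of "sphere 0 1" "\<lambda>z. z \<bullet> (A *v z)"] compact_sphere by blast
  show ?thesis
  proof (rule that[of "z0 \<bullet> (A *v z0)"])
    show "z0 \<bullet> (A *v z0) > 0" using z0 by (intro pos) auto
    fix z :: "real^'p"
    show "z \<bullet> (A *v z) \<ge> z0 \<bullet> (A *v z0) * (norm z)\<^sup>2"
    proof (cases "z = 0")
      case False
      have "z0 \<bullet> (A *v z0) \<le> ((1 / norm z) *\<^sub>R z) \<bullet> (A *v ((1 / norm z) *\<^sub>R z))"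
        using False by (intro z0) auto
      also have "\<dots> = (z \<bullet> (A *v z)) / (norm z)\<^sup>2"
        by (simp add: matrix_vector_mult_scaleR power2_eq_square)
      finally show ?thesis using False by (simp add: pos_le_divide_eq)
    qed simp
  qed
qed

section \<open>The score vector and its asymptotic normality\<close>

definition score_vec :: "real \<Rightarrow> real^'p \<Rightarrow> real^'p" where
  "score_vec v u = (score v (u \<bullet> \<beta>0) * w u) *\<^sub>R u"

lemma score_measurable [measurable (raw)]:
  assumes "f \<in> borel_measurable L" "g \<in> borel_measurable L"
  shows "(\<lambda>p. score (f p) (g p)) \<in> borel_measurable L" "(\<lambda>p. score' (f p) (g p)) \<in> borel_measurable L"
  using assms unfolding score_def score'_def by measurable

lemma score_mean: "expectation (\<lambda>\<omega>. t \<bullet> score_vec (y \<omega>) (x \<omega>)) = 0"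
proof -
  define h where "h u = nu \<psi> (u \<bullet> \<beta>0) * w u * (t \<bullet> u)" for u
  have [measurable]: "h \<in> borel_measurable borel" unfolding h_def by measurable
  obtain C where C: "C \<ge> 0" "\<And>t. \<bar>nu \<psi> t\<bar> \<le> C" using nu_bounds by metis
  have "integrable M (\<lambda>\<omega>. h (x \<omega>))"
  proof (rule Bochner_Integration.integrable_bound[OF integrable_mult_right[OF integrable_wx, of "C * norm t"]])
    show "AE \<omega> in M. norm (h (x \<omega>)) \<le> norm (C * norm t * (w (x \<omega>) * norm (x \<omega>)))"
    proof (rule AE_I2)
      fix \<omega>
      have "norm (h (x \<omega>)) = w (x \<omega>) * (\<bar>nu \<psi> (x \<omega> \<bullet> \<beta>0)\<bar> * \<bar>t \<bullet> x \<omega>\<bar>)"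
        using w_nonneg by (simp add: h_def abs_mult)
      also have "\<dots> \<le> w (x \<omega>) * (C * (norm t * norm (x \<omega>)))"
        using C w_nonneg Cauchy_Schwarz_ineq2 by (intro mult_left_mono mult_mono) auto
      finally show "norm (h (x \<omega>)) \<le> norm (C * norm t * (w (x \<omega>) * norm (x \<omega>)))"
        using C w_nonneg by (simp add: abs_mult algebra_simps)
    qed
  qed measurable
  from cond_mean(1)[OF _ this] show ?thesis
    by (simp add: h_def score_vec_def score_def mult.assoc)
qed

text \<open>For binary \<open>y\<close> the squared residual is
  \<open>F * (1 - F) + (F - y) * (2 * F - 1)\<close>: the conditional variance plus a multiple of
  the residual by a function of the covariate, which has mean zero.\<close>

lemma score_variance:
  "integrable M (\<lambda>\<omega>. (t \<bullet> score_vec (y \<omega>) (x \<omega>))\<^sup>2)" (is ?int)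
  "expectation (\<lambda>\<omega>. (t \<bullet> score_vec (y \<omega>) (x \<omega>))\<^sup>2) = t \<bullet> (B *v t)" (is ?var)
proof -
  define k where "k u = (nu \<psi> (u \<bullet> \<beta>0))\<^sup>2 * (w u)\<^sup>2 * ((u \<bullet> t) * (u \<bullet> t))" for u
  define g where "g u = logistic (u \<bullet> \<beta>0) * (1 - logistic (u \<bullet> \<beta>0)) * k u" for u
  define h where "h u = (2 * logistic (u \<bullet> \<beta>0) - 1) * k u" for u
  have [measurable]: "k \<in> borel_measurable borel" "h \<in> borel_measurable borel" "g \<in> borel_measurable borel"
    unfolding h_def k_def g_def by measurable
  obtain C where C: "C \<ge> 0" "\<And>t. \<bar>nu \<psi> t\<bar> \<le> C" using nu_bounds by metis
  have "\<bar>k u\<bar> \<le> (C\<^sup>2 * norm t * norm t) * (w u * (norm u)\<^sup>2)" for u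
  proof -
    have "\<bar>k u\<bar> = (w u)\<^sup>2 * \<bar>(nu \<psi> (u \<bullet> \<beta>0))\<^sup>2 * ((u \<bullet> t) * (u \<bullet> t))\<bar>" by (simp add: k_def abs_mult)
    also have "\<dots> \<le> w u * \<bar>(nu \<psi> (u \<bullet> \<beta>0))\<^sup>2 * ((u \<bullet> t) * (u \<bullet> t))\<bar>" by (intro mult_right_mono w_sq_le) auto
    also have "\<dots> = \<bar>(nu \<psi> (u \<bullet> \<beta>0))\<^sup>2 * w u * ((u \<bullet> t) * (u \<bullet> t))\<bar>" using w_nonneg[of u] by (simp add: abs_mult)
    also have "\<dots> \<le> (C\<^sup>2 * norm t * norm t) * (w u * (norm u)\<^sup>2)"
      using power_mono[OF C(2)[of "u \<bullet> \<beta>0"], of 2] by (intro abs_prod_le) (simp_all add: Cauchy_Schwarz_swap)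
    finally show ?thesis .
  qed
  then have ik: "integrable M (\<lambda>\<omega>. k (x \<omega>))" by (intro integrable_dominated) auto
  have ih: "integrable M (\<lambda>\<omega>. h (x \<omega>))"
    by (rule Bochner_Integration.integrable_bound[OF ik])
       (auto simp: h_def abs_mult intro!: AE_I2 mult_left_le_one_le logistic_product_bounds)
  have ig: "integrable M (\<lambda>\<omega>. g (x \<omega>))"
    by (rule Bochner_Integration.integrable_bound[OF ik])
       (use logistic_product_bounds(1) in \<open>auto simp: g_def abs_mult intro!: AE_I2 mult_left_le_one_le\<close>)
  have eq: "AE \<omega> in M. g (x \<omega>) + (logistic (x \<omega> \<bullet> \<beta>0) - y \<omega>) * h (x \<omega>) = (t \<bullet> score_vec (y \<omega>) (x \<omega>))\<^sup>2"
    using y_binary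
  proof eventually_elim
    case (elim \<omega>)
    define F where "F = logistic (x \<omega> \<bullet> \<beta>0)"
    have "F * (1 - F) + (F - y \<omega>) * (2 * F - 1) = (F - y \<omega>)\<^sup>2"
      using elim by (auto simp: power2_eq_square algebra_simps)
    moreover have "g (x \<omega>) + (F - y \<omega>) * h (x \<omega>) = (F * (1 - F) + (F - y \<omega>) * (2 * F - 1)) * k (x \<omega>)"
      by (simp add: g_def h_def F_def algebra_simps)
    moreover have "(t \<bullet> score_vec (y \<omega>) (x \<omega>))\<^sup>2 = (F - y \<omega>)\<^sup>2 * k (x \<omega>)"
      by (simp add: score_vec_def score_def k_def F_def power2_eq_square inner_commute)
    ultimately show ?case unfolding F_def by simp
  qed
  have [measurable]: "(\<lambda>\<omega>. (t \<bullet> score_vec (y \<omega>) (x \<omega>))\<^sup>2) \<in> borel_measurable M"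
    unfolding score_vec_def by measurable
  have i: "integrable M (\<lambda>\<omega>. g (x \<omega>) + (logistic (x \<omega> \<bullet> \<beta>0) - y \<omega>) * h (x \<omega>))"
    using ig cond_mean(2)[OF _ ih] by simp
  show ?int using i by (subst integrable_cong_AE[OF _ _ eq, symmetric]) auto
  have "expectation (\<lambda>\<omega>. (t \<bullet> score_vec (y \<omega>) (x \<omega>))\<^sup>2) =
      expectation (\<lambda>\<omega>. g (x \<omega>) + (logistic (x \<omega> \<bullet> \<beta>0) - y \<omega>) * h (x \<omega>))"
    using eq by (intro integral_cong_AE) auto
  also have "\<dots> = expectation (\<lambda>\<omega>. g (x \<omega>))" using ig cond_mean[OF _ ih] by simp
  also have "\<dots> = t \<bullet> (B *v t)" unfolding B_form g_def k_def by (simp add: mult.assoc)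
  finally show ?var .
qed

definition normalized_score :: "nat \<Rightarrow> 'a \<Rightarrow> real^'p" where
  "normalized_score n \<omega> = (1 / sqrt (real n)) *\<^sub>R (\<Sum>i<n. score_vec (Y (Suc i) \<omega>) (X (Suc i) \<omega>))"

lemma score_vec_meas: "(\<lambda>p. score_vec (fst p) (snd p)) \<in> borel_measurable (borel \<Otimes>\<^sub>M borel)"
  unfolding score_vec_def by measurable

lemma normalized_score_meas [measurable]: "normalized_score n \<in> borel_measurable M"
proof -
  note [measurable] = iid(3)[OF score_vec_meas]
  show ?thesis unfolding normalized_score_def[abs_def] by measurable
qed

lemma normalized_score_conv:
  assumes "prob_space N" "centred_gaussian N W B"
  shows "conv_in_distr M normalized_score N W"
  unfolding normalized_score_def[abs_def]
proof (rule multivariate_central_limit_theorem[OF iid(1,2,4)[OF score_vec_meas] score_mean score_variance(1) assms(1)])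
  show "W \<in> borel_measurable N" using assms(2) by (simp only: centred_gaussian_def)
  show "distr N borel (\<lambda>\<omega>. t \<bullet> W \<omega>) =
      (if expectation (\<lambda>\<omega>. (t \<bullet> score_vec (y \<omega>) (x \<omega>))\<^sup>2) = 0 then return borel 0
       else density lborel (\<lambda>s. ennreal (normal_density 0 (sqrt (expectation (\<lambda>\<omega>. (t \<bullet> score_vec (y \<omega>) (x \<omega>))\<^sup>2))) s)))" for t
    using assms(2) unfolding centred_gaussian_def score_variance(2) by blast
qed

end

section \<open>Quadratic expansion of the objective\<close>

context logistic_sample
begin

text \<open>The part of \<open>score'\<close> that carries \<open>nu'\<close> is a residual times a
  function of the covariate and averages out, so the mean Hessian involves \<open>nu\<close>
  only.\<close>

lemma hessian_entry_mean:
  "integrable M (\<lambda>\<omega>. score' (y \<omega>) (x \<omega> \<bullet> \<beta>0) * w (x \<omega>) * (x \<omega> $ j * x \<omega> $ k))" (is ?int)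
  "expectation (\<lambda>\<omega>. score' (y \<omega>) (x \<omega> \<bullet> \<beta>0) * w (x \<omega>) * (x \<omega> $ j * x \<omega> $ k)) = A $ j $ k" (is ?mean)
proof -
  define g where "g u = logistic (u \<bullet> \<beta>0) * (1 - logistic (u \<bullet> \<beta>0)) * nu \<psi> (u \<bullet> \<beta>0) * w u * (u $ j * u $ k)" for u
  define h where "h u = nu' (u \<bullet> \<beta>0) * w u * (u $ j * u $ k)" for u
  obtain C where C: "\<And>t. \<bar>logistic t * (1 - logistic t) * nu \<psi> t\<bar> \<le> C" by (rule info_bounded) blast
  obtain C' where C': "\<And>t. \<bar>nu' t\<bar> \<le> C'" using nu_bounds by metis
  have ig: "integrable M (\<lambda>\<omega>. g (x \<omega>))"
    unfolding g_def by (rule weighted_integrable(1)[OF _ C]) measurable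
  have ih: "integrable M (\<lambda>\<omega>. h (x \<omega>))"
    unfolding h_def by (rule weighted_integrable(1)[OF _ C']) measurable
  have "h \<in> borel_measurable borel" unfolding h_def by measurable
  note c = cond_mean[OF this ih]
  have eq: "score' (y \<omega>) (x \<omega> \<bullet> \<beta>0) * w (x \<omega>) * (x \<omega> $ j * x \<omega> $ k) = g (x \<omega>) + (logistic (x \<omega> \<bullet> \<beta>0) - y \<omega>) * h (x \<omega>)" for \<omega>
    by (simp add: score'_def g_def h_def algebra_simps)
  show ?int unfolding eq using ig c(2) by simp
  have "expectation (\<lambda>\<omega>. g (x \<omega>)) = A $ j $ k" by (simp add: A_mat_def g_def)
  then show ?mean unfolding eq using ig c by simp
qed

text \<open>A quadratic form is determined by finitely many entries, so the scalar law for each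
  entry yields uniformity over the ball with no covering argument.\<close>

lemma hessian_lln:
  assumes "\<epsilon> > 0" "\<eta> > 0"
  shows "likely M \<eta> (\<lambda>n \<omega>. \<forall>z. norm z \<le> K \<longrightarrow>
    \<bar>(1 / real n) * (\<Sum>i<n. score' (Y (Suc i) \<omega>) (X (Suc i) \<omega> \<bullet> \<beta>0) * w (X (Suc i) \<omega>) * (X (Suc i) \<omega> \<bullet> z)\<^sup>2)
      - z \<bullet> (A *v z)\<bar> \<le> \<epsilon>)"
proof -
  define H where "H j k v u = score' v (u \<bullet> \<beta>0) * w u * (u $ j * u $ k)" for j k :: 'p and v u
  have Hm: "(\<lambda>p. H j k (fst p) (snd p)) \<in> borel_measurable (borel \<Otimes>\<^sub>M borel)" for j k
    unfolding H_def by measurable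
  \<comment> \<open>The double sum over coordinates has \<open>CARD('p)\<close> squared terms, and
    the product of two coordinates of \<open>z\<close> is at most
    \<open>(\<bar>K\<bar> + 1)\<^sup>2\<close>.\<close>
  define e where "e = \<epsilon> / (real CARD('p) * real CARD('p) * (\<bar>K\<bar> + 1)\<^sup>2)"
  have e: "e > 0" "real CARD('p) * (real CARD('p) * ((\<bar>K\<bar> + 1)\<^sup>2 * e)) = \<epsilon>"
    using assms by (auto simp: e_def)
  have "likely M \<eta> (\<lambda>n \<omega>. \<bar>(1 / real n) * (\<Sum>i<n. H (fst jk) (snd jk) (Y (Suc i) \<omega>) (X (Suc i) \<omega>)) - A $ fst jk $ snd jk\<bar> < e)"
    if "\<eta> > 0" for jk \<eta>
    using weak_law_of_large_numbers[OF iid(1,2,4)[OF Hm] _ e(1) that, of "fst jk" "snd jk"]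
      hessian_entry_mean[of "fst jk" "snd jk"] by (simp add: H_def)
  then have "likely M \<eta> (\<lambda>n \<omega>. \<forall>jk\<in>UNIV. \<bar>(1 / real n) * (\<Sum>i<n. H (fst jk) (snd jk) (Y (Suc i) \<omega>) (X (Suc i) \<omega>)) - A $ fst jk $ snd jk\<bar> < e)"
    using assms by (intro likely_ball finite_measure_axioms) auto
  then show ?thesis
  proof (rule likely_mono, intro always_eventually allI ballI impI)
    fix n \<omega> and z :: "real^'p"
    assume close: "\<forall>jk\<in>UNIV. \<bar>(1 / real n) * (\<Sum>i<n. H (fst jk) (snd jk) (Y (Suc i) \<omega>) (X (Suc i) \<omega>)) - A $ fst jk $ snd jk\<bar> < e"
      and z: "norm z \<le> K"
    define a where "a j k = (1 / real n) * (\<Sum>i<n. H j k (Y (Suc i) \<omega>) (X (Suc i) \<omega>)) - A $ j $ k" for j k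
    have a: "\<bar>a j k\<bar> \<le> e" for j k using close[rule_format, of "(j, k)"] by (simp add: a_def)
    have zj: "\<bar>z $ j\<bar> \<le> \<bar>K\<bar> + 1" for j using component_le_norm_cart[of z j] z by linarith
    have 1: "score' v t * w u * (u \<bullet> z)\<^sup>2 = (\<Sum>j\<in>UNIV. \<Sum>k\<in>UNIV. z $ j * z $ k * (score' v t * w u * (u $ j * u $ k)))" for v t u
      unfolding power2_eq_square inner_vec_def sum_product
      by (auto simp: sum_distrib_left algebra_simps intro!: sum.cong)
    have "(1 / real n) * (\<Sum>i<n. score' (Y (Suc i) \<omega>) (X (Suc i) \<omega> \<bullet> \<beta>0) * w (X (Suc i) \<omega>) * (X (Suc i) \<omega> \<bullet> z)\<^sup>2)
      = (\<Sum>j\<in>UNIV. \<Sum>k\<in>UNIV. z $ j * z $ k * ((1 / real n) * (\<Sum>i<n. H j k (Y (Suc i) \<omega>) (X (Suc i) \<omega>))))"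
      unfolding 1 H_def[symmetric] sum.swap[of _ UNIV "{..<n}"]
      by (subst sum.swap, subst sum.swap) (simp add: sum_distrib_left mult.left_commute sum.swap[of _ "{..<n}"])
    moreover have "z \<bullet> (A *v z) = (\<Sum>j\<in>UNIV. \<Sum>k\<in>UNIV. z $ j * z $ k * A $ j $ k)"
      by (simp add: inner_vec_def matrix_vector_mult_def sum_distrib_left algebra_simps)
    ultimately have "(1 / real n) * (\<Sum>i<n. score' (Y (Suc i) \<omega>) (X (Suc i) \<omega> \<bullet> \<beta>0) * w (X (Suc i) \<omega>) * (X (Suc i) \<omega> \<bullet> z)\<^sup>2)
      - z \<bullet> (A *v z) = (\<Sum>j\<in>UNIV. \<Sum>k\<in>UNIV. z $ j * z $ k * a j k)"
      by (simp add: a_def right_diff_distrib sum_subtractf)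
    also have "\<bar>\<dots>\<bar> \<le> real CARD('p) * (real CARD('p) * ((\<bar>K\<bar> + 1)\<^sup>2 * e))"
    proof -
      have "\<bar>z $ j * z $ k * a j k\<bar> \<le> (\<bar>K\<bar> + 1)\<^sup>2 * e" for j k
        unfolding abs_mult power2_eq_square using zj a e(1) by (intro mult_mono) auto
      then have "\<bar>\<Sum>k\<in>UNIV. z $ j * z $ k * a j k\<bar> \<le> real CARD('p) * ((\<bar>K\<bar> + 1)\<^sup>2 * e)" for j
        using sum_norm_bound[of UNIV "\<lambda>k. z $ j * z $ k * a j k"] by simp
      then show ?thesis
        using sum_norm_bound[of UNIV "\<lambda>j. \<Sum>k\<in>UNIV. z $ j * z $ k * a j k"] by simp
    qed
    finally show "\<bar>(1 / real n) * (\<Sum>i<n. score' (Y (Suc i) \<omega>) (X (Suc i) \<omega> \<bullet> \<beta>0) * w (X (Suc i) \<omega>) * (X (Suc i) \<omega> \<bullet> z)\<^sup>2)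
      - z \<bullet> (A *v z)\<bar> \<le> \<epsilon>" unfolding e(2) .
  qed simp
qed

text \<open>Uniform continuity on a compact interval, with a margin of 1 so that the shifted
  argument remains inside. Only two values of the response occur, so one minimum serves both;
  halving it permits a non-strict bound on \<open>s\<close>.\<close>

lemma score'_equicontinuous:
  assumes "\<kappa> > 0"
  obtains d where "d > 0" "\<And>v t s. v \<in> {0, 1} \<Longrightarrow> \<bar>t\<bar> \<le> T \<Longrightarrow> \<bar>s\<bar> \<le> d \<Longrightarrow> \<bar>score' v (t + s) - score' v t\<bar> \<le> \<kappa>"
proof -
  have "\<exists>d>0. \<forall>t s. \<bar>t\<bar> \<le> T \<longrightarrow> \<bar>s\<bar> < d \<longrightarrow> \<bar>score' v (t + s) - score' v t\<bar> \<le> \<kappa>" for v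
  proof -
    have "uniformly_continuous_on {- (T + 1)..T + 1} (score' v)"
      by (intro compact_uniformly_continuous continuous_on_subset[OF continuous_on_score']) auto
    then obtain d where d: "d > 0" "\<And>s t. s \<in> {- (T + 1)..T + 1} \<Longrightarrow> t \<in> {- (T + 1)..T + 1} \<Longrightarrow> dist t s < d \<Longrightarrow> dist (score' v t) (score' v s) < \<kappa>"
      unfolding uniformly_continuous_on_def using assms by metis
    show ?thesis
    proof (intro exI[of _ "min d 1"] conjI allI impI)
      fix t s assume "\<bar>t\<bar> \<le> T" "\<bar>s\<bar> < min d 1"
      then have "t \<in> {- (T + 1)..T + 1}" "t + s \<in> {- (T + 1)..T + 1}" "dist (t + s) t < d"
        by (auto simp: dist_real_def)
      from d(2)[OF this] show "\<bar>score' v (t + s) - score' v t\<bar> \<le> \<kappa>"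
        by (simp add: dist_real_def)
    qed (use d in auto)
  qed
  then obtain d where d: "\<And>v. d v > 0" "\<And>v t s. \<bar>t\<bar> \<le> T \<Longrightarrow> \<bar>s\<bar> < d v \<Longrightarrow> \<bar>score' v (t + s) - score' v t\<bar> \<le> \<kappa>"
    by metis
  show ?thesis
    by (rule that[of "min (d 0) (d 1) / 2"]) (use d(1)[of 0] d(1)[of 1] d(2) in auto)
qed

text \<open>Each summand is dominated by \<open>K'\<^sup>2 * R\<close>, which involves neither
  \<open>z\<close> nor the offsets. Markov's inequality for the average of \<open>R\<close>
  therefore produces one exceptional event for all of them at once.\<close>

lemma hessian_remainder:
  assumes "\<epsilon> > 0" "\<eta> > 0"
  shows "likely M \<eta> (\<lambda>n \<omega>. \<forall>z r. norm z \<le> K \<longrightarrow> (\<forall>i<n. \<bar>r i\<bar> \<le> \<bar>X (Suc i) \<omega> \<bullet> z / sqrt (real n)\<bar>) \<longrightarrow>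
    \<bar>(1 / real n) * (\<Sum>i<n. (score' (Y (Suc i) \<omega>) (X (Suc i) \<omega> \<bullet> \<beta>0 + r i) - score' (Y (Suc i) \<omega>) (X (Suc i) \<omega> \<bullet> \<beta>0))
       * w (X (Suc i) \<omega>) * (X (Suc i) \<omega> \<bullet> z)\<^sup>2)\<bar> \<le> \<epsilon>)"
proof -
  obtain C where C: "C \<ge> 0" "\<And>y t. y \<in> {0, 1} \<Longrightarrow> \<bar>score' y t\<bar> \<le> C" using score'_bound by metis
  define K' where "K' = \<bar>K\<bar> + 1"
  have K': "K' > 0" "K \<le> K'" by (auto simp: K'_def)
  define e where "e = \<epsilon> / K'\<^sup>2"
  have e: "e > 0" "K'\<^sup>2 * e = \<epsilon>" using assms K' by (auto simp: e_def)
  define I where "I = expectation (\<lambda>\<omega>. w (x \<omega>) * (norm (x \<omega>))\<^sup>2)"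
  have "I \<ge> 0" unfolding I_def by (intro integral_nonneg_AE AE_I2 mult_nonneg_nonneg w_nonneg) auto
  \<comment> \<open>Half of the allowed mean \<open>\<eta> * e\<close> goes to the continuity
    modulus and half to the tail; \<open>I + 1\<close> replaces \<open>I\<close>, which may be
    0.\<close>
  define \<kappa> where "\<kappa> = \<eta> * e / (2 * (I + 1))"
  have \<kappa>: "\<kappa> > 0" using e assms \<open>I \<ge> 0\<close> by (simp add: \<kappa>_def add_nonneg_pos)
  have "\<kappa> * I \<le> \<kappa> * (I + 1)" using \<kappa> by (intro mult_left_mono) auto
  also have "\<kappa> * (I + 1) = \<eta> * e / 2" using \<open>I \<ge> 0\<close> by (simp add: \<kappa>_def divide_simps)
  finally have \<kappa>I: "\<kappa> * I \<le> \<eta> * e / 2" .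
  have "(\<lambda>k. 2 * C * expectation (\<lambda>\<omega>. w (x \<omega>) * (norm (x \<omega>))\<^sup>2 * of_bool (norm (x \<omega>) > real k))) \<longlonglongrightarrow> 2 * C * 0"
    by (intro tendsto_mult_left tendsto_integral_tail wx2) auto
  then have "\<forall>\<^sub>F k in sequentially. 2 * C * expectation (\<lambda>\<omega>. w (x \<omega>) * (norm (x \<omega>))\<^sup>2 * of_bool (norm (x \<omega>) > real k)) < \<eta> * e / 2"
    using e assms by (intro order_tendstoD) auto
  then obtain T :: nat where T: "2 * C * expectation (\<lambda>\<omega>. w (x \<omega>) * (norm (x \<omega>))\<^sup>2 * of_bool (norm (x \<omega>) > real T)) < \<eta> * e / 2"
    by (auto simp: eventually_sequentially)
  \<comment> \<open>\<open>\<kappa>\<close> bounds the change of \<open>score'\<close> at covariates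
    of norm at most \<open>T\<close>; the crude bound \<open>2 * C\<close> on a difference of two
    values is paid only beyond \<open>T\<close>.\<close>
  define R where "R u = w u * (norm u)\<^sup>2 * (\<kappa> + 2 * C * of_bool (norm u > real T))" for u
  have R0: "R u \<ge> 0" for u using \<kappa> C w_nonneg by (simp add: R_def)
  have Rm [measurable]: "R \<in> borel_measurable borel" unfolding R_def by measurable
  have tail: "integrable M (\<lambda>\<omega>. w (x \<omega>) * (norm (x \<omega>))\<^sup>2 * of_bool (norm (x \<omega>) > real T))"
    by (rule Bochner_Integration.integrable_bound[OF wx2]) (auto simp: abs_mult)
  have Rsplit: "R (x \<omega>) = \<kappa> * (w (x \<omega>) * (norm (x \<omega>))\<^sup>2) + 2 * C * (w (x \<omega>) * (norm (x \<omega>))\<^sup>2 * of_bool (norm (x \<omega>) > real T))" for \<omega>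
    by (simp add: R_def algebra_simps)
  have intR: "integrable M (\<lambda>\<omega>. R (x \<omega>))" unfolding Rsplit
    by (intro Bochner_Integration.integrable_add integrable_mult_right wx2 tail)
  have ER: "expectation (\<lambda>\<omega>. R (x \<omega>)) \<le> \<eta> * e"
  proof -
    have "expectation (\<lambda>\<omega>. R (x \<omega>)) = \<kappa> * I + 2 * C * expectation (\<lambda>\<omega>. w (x \<omega>) * (norm (x \<omega>))\<^sup>2 * of_bool (norm (x \<omega>) > real T))"
      unfolding Rsplit I_def using wx2 tail by simp
    then show ?thesis using \<kappa>I T by linarith
  qed
  have R2: "(\<lambda>p. (\<lambda>v. R) (fst p) (snd p)) \<in> borel_measurable (borel \<Otimes>\<^sub>M (borel :: (real^'p) measure))" by measurable
  note law = expectation_cong_distr[OF iid(2)[OF R2] _ iid(3)[OF R2] iid(4)[OF R2], of "\<lambda>r. r"]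
  have intRi: "integrable M (\<lambda>\<omega>. R (X (Suc i) \<omega>))" and ERi: "expectation (\<lambda>\<omega>. R (X (Suc i) \<omega>)) = expectation (\<lambda>\<omega>. R (x \<omega>))" for i
    using law intR by auto
  have "likely M \<eta> (\<lambda>n \<omega>. (1 / real n) * (\<Sum>i<n. R (X (Suc i) \<omega>)) < e)"
  proof (rule likely_Markov[OF prob_space_axioms])
    show "integrable M (\<lambda>\<omega>. (1 / real n) * (\<Sum>i<n. R (X (Suc i) \<omega>)))" for n using intRi by auto
    then show "random_variable borel (\<lambda>\<omega>. (1 / real n) * (\<Sum>i<n. R (X (Suc i) \<omega>)))" for n
      by (rule borel_measurable_integrable)
    have "expectation (\<lambda>\<omega>. (1 / real n) * (\<Sum>i<n. R (X (Suc i) \<omega>))) \<le> \<eta> * e" for n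
      using ER e assms by (cases "n = 0") (simp_all add: Bochner_Integration.integral_sum intRi ERi)
    then show "\<forall>\<^sub>F n in sequentially. expectation (\<lambda>\<omega>. (1 / real n) * (\<Sum>i<n. R (X (Suc i) \<omega>))) \<le> \<eta> * e" by simp
  qed (use R0 e in \<open>auto intro!: sum_nonneg divide_nonneg_nonneg\<close>)
  from likely_conj[OF this likely_AE[OF Y_binary order_refl] finite_measure_axioms]
  show ?thesis
  proof (rule likely_mono)
    obtain d where d: "d > 0" "\<And>v t s. v \<in> {0, 1} \<Longrightarrow> \<bar>t\<bar> \<le> T * norm \<beta>0 \<Longrightarrow> \<bar>s\<bar> \<le> d \<Longrightarrow> \<bar>score' v (t + s) - score' v t\<bar> \<le> \<kappa>"
      using score'_equicontinuous[OF \<kappa>] by metis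
    \<comment> \<open>At covariates of norm at most \<open>T\<close> every offset is at most this
      quantity, whatever the index, so all of them eventually fall within the modulus
      \<open>d\<close>.\<close>
    have "(\<lambda>n. T * K' / sqrt (real n)) \<longlonglongrightarrow> 0"
      by (intro tendsto_divide_0[OF tendsto_const] filterlim_at_top_imp_at_infinity
          filterlim_compose[OF sqrt_at_top filterlim_real_sequentially])
    then have "\<forall>\<^sub>F n in sequentially. T * K' / sqrt (real n) < d" using d by (intro order_tendstoD) auto
    then show "\<forall>\<^sub>F n in sequentially. \<forall>\<omega>\<in>space M.
      (1 / real n) * (\<Sum>i<n. R (X (Suc i) \<omega>)) < e \<and> (\<forall>i. Y (Suc i) \<omega> \<in> {0, 1}) \<longrightarrow>
      (\<forall>z r. norm z \<le> K \<longrightarrow> (\<forall>i<n. \<bar>r i\<bar> \<le> \<bar>X (Suc i) \<omega> \<bullet> z / sqrt (real n)\<bar>) \<longrightarrow>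
    \<bar>(1 / real n) * (\<Sum>i<n. (score' (Y (Suc i) \<omega>) (X (Suc i) \<omega> \<bullet> \<beta>0 + r i) - score' (Y (Suc i) \<omega>) (X (Suc i) \<omega> \<bullet> \<beta>0))
       * w (X (Suc i) \<omega>) * (X (Suc i) \<omega> \<bullet> z)\<^sup>2)\<bar> \<le> \<epsilon>)"
    proof (eventually_elim, intro ballI allI impI, elim conjE)
      fix n \<omega> and z :: "real^'p" and r
      assume n: "T * K' / sqrt (real n) < d" and D: "(1 / real n) * (\<Sum>i<n. R (X (Suc i) \<omega>)) < e"
        and bin: "\<forall>i. Y (Suc i) \<omega> \<in> {0, 1}" and z: "norm z \<le> K"
        and r: "\<forall>i<n. \<bar>r i\<bar> \<le> \<bar>X (Suc i) \<omega> \<bullet> z / sqrt (real n)\<bar>"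
      define \<Delta> where "\<Delta> i = score' (Y (Suc i) \<omega>) (X (Suc i) \<omega> \<bullet> \<beta>0 + r i) - score' (Y (Suc i) \<omega>) (X (Suc i) \<omega> \<bullet> \<beta>0)" for i
      have summand: "\<bar>\<Delta> i * w (X (Suc i) \<omega>) * (X (Suc i) \<omega> \<bullet> z)\<^sup>2\<bar> \<le> K'\<^sup>2 * R (X (Suc i) \<omega>)" if i: "i < n" for i
      proof -
        define u where "u = X (Suc i) \<omega>"
        have v: "Y (Suc i) \<omega> \<in> {0, 1}" using bin by blast
        have \<Delta>: "\<bar>\<Delta> i\<bar> \<le> \<kappa> + 2 * C * of_bool (norm u > real T)"
        proof (cases "norm u > real T")
          case True
          have "\<bar>\<Delta> i\<bar> \<le> C + C" unfolding \<Delta>_def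
            by (rule order_trans[OF abs_triangle_ineq4 add_mono[OF C(2)[OF v] C(2)[OF v]]])
          then show ?thesis using True \<kappa> by simp
        next
          case False
          have "\<bar>u \<bullet> \<beta>0\<bar> \<le> norm u * norm \<beta>0" by (rule Cauchy_Schwarz_ineq2)
          also have "\<dots> \<le> T * norm \<beta>0" using False by (intro mult_right_mono) auto
          finally have t: "\<bar>u \<bullet> \<beta>0\<bar> \<le> T * norm \<beta>0" .
          have "\<bar>u \<bullet> z\<bar> \<le> T * K'"
            by (rule order_trans[OF Cauchy_Schwarz_ineq2 mult_mono]) (use False z K' in auto)
          then have "\<bar>u \<bullet> z / sqrt (real n)\<bar> \<le> T * K' / sqrt (real n)"
            by (simp add: abs_divide divide_right_mono)
          then have "\<bar>r i\<bar> \<le> d" using r i n unfolding u_def by (meson less_imp_le order_trans)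
          from d(2)[OF v t this] show ?thesis using C unfolding \<Delta>_def u_def by (simp add: add_increasing2)
        qed
        have uz: "(u \<bullet> z)\<^sup>2 \<le> (norm u * K')\<^sup>2"
        proof -
          have "\<bar>u \<bullet> z\<bar> \<le> norm u * K'"
            by (rule order_trans[OF Cauchy_Schwarz_ineq2 mult_left_mono]) (use z K' in auto)
          from power_mono[OF this abs_ge_zero, of 2] show ?thesis by simp
        qed
        have "\<bar>\<Delta> i * w u * (u \<bullet> z)\<^sup>2\<bar> = w u * (\<bar>\<Delta> i\<bar> * (u \<bullet> z)\<^sup>2)" using w_nonneg[of u] by (simp add: abs_mult)
        also have "\<dots> \<le> w u * ((\<kappa> + 2 * C * of_bool (norm u > real T)) * (norm u * K')\<^sup>2)"
          using \<Delta> uz w_nonneg[of u] by (intro mult_left_mono mult_mono) (auto intro: order_trans[OF abs_ge_zero])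
        also have "\<dots> = K'\<^sup>2 * R u" by (simp add: R_def power_mult_distrib)
        finally show ?thesis unfolding u_def .
      qed
      have "\<bar>\<Sum>i<n. \<Delta> i * w (X (Suc i) \<omega>) * (X (Suc i) \<omega> \<bullet> z)\<^sup>2\<bar> \<le> (\<Sum>i<n. K'\<^sup>2 * R (X (Suc i) \<omega>))"
        by (rule order_trans[OF sum_abs sum_mono]) (use summand in auto)
      then have "(1 / real n) * \<bar>\<Sum>i<n. \<Delta> i * w (X (Suc i) \<omega>) * (X (Suc i) \<omega> \<bullet> z)\<^sup>2\<bar> \<le> (1 / real n) * (\<Sum>i<n. K'\<^sup>2 * R (X (Suc i) \<omega>))"
        by (intro mult_left_mono) auto
      also have "\<dots> = K'\<^sup>2 * ((1 / real n) * (\<Sum>i<n. R (X (Suc i) \<omega>)))" by (simp add: sum_distrib_left)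
      also have "\<dots> \<le> K'\<^sup>2 * e" using D by (intro mult_left_mono) auto
      finally show "\<bar>(1 / real n) * (\<Sum>i<n. (score' (Y (Suc i) \<omega>) (X (Suc i) \<omega> \<bullet> \<beta>0 + r i) - score' (Y (Suc i) \<omega>) (X (Suc i) \<omega> \<bullet> \<beta>0))
       * w (X (Suc i) \<omega>) * (X (Suc i) \<omega> \<bullet> z)\<^sup>2)\<bar> \<le> \<epsilon>"
        unfolding e(2) \<Delta>_def by (simp add: abs_mult)
    qed
  qed simp
qed

lemma loss_expansion:
  assumes "\<epsilon> > 0" "\<eta> > 0"
  shows "likely M \<eta> (\<lambda>n \<omega>. \<forall>z. norm z \<le> K \<longrightarrow>
    \<bar>real n * (emp_loss \<rho> \<psi> w (\<lambda>i. Y i \<omega>) (\<lambda>i. X i \<omega>) n (\<beta>0 + (1 / sqrt (real n)) *\<^sub>R z)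
        - emp_loss \<rho> \<psi> w (\<lambda>i. Y i \<omega>) (\<lambda>i. X i \<omega>) n \<beta>0)
      - z \<bullet> normalized_score n \<omega> - 1/2 * (z \<bullet> (A *v z))\<bar> \<le> \<epsilon>)"
proof -
  have "\<eta> / 2 > 0" using assms by simp
  from likely_conj[OF hessian_lln[OF assms(1) this, of K] hessian_remainder[OF assms(1) this, of K] finite_measure_axioms]
  show ?thesis
  proof (rule likely_mono, intro eventually_sequentiallyI[of 1] ballI impI allI, elim conjE)
    fix n \<omega> and z :: "real^'p"
    assume n: "1 \<le> n" and z: "norm z \<le> K"
      and hess: "\<forall>z. norm z \<le> K \<longrightarrow> \<bar>(1 / real n) * (\<Sum>i<n. score' (Y (Suc i) \<omega>) (X (Suc i) \<omega> \<bullet> \<beta>0) * w (X (Suc i) \<omega>) * (X (Suc i) \<omega> \<bullet> z)\<^sup>2)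
      - z \<bullet> (A *v z)\<bar> \<le> \<epsilon>"
      and rem: "\<forall>z r. norm z \<le> K \<longrightarrow> (\<forall>i<n. \<bar>r i\<bar> \<le> \<bar>X (Suc i) \<omega> \<bullet> z / sqrt (real n)\<bar>) \<longrightarrow>
    \<bar>(1 / real n) * (\<Sum>i<n. (score' (Y (Suc i) \<omega>) (X (Suc i) \<omega> \<bullet> \<beta>0 + r i) - score' (Y (Suc i) \<omega>) (X (Suc i) \<omega> \<bullet> \<beta>0))
       * w (X (Suc i) \<omega>) * (X (Suc i) \<omega> \<bullet> z)\<^sup>2)\<bar> \<le> \<epsilon>"
    define u v where "u i = X (Suc i) \<omega>" and "v i = Y (Suc i) \<omega>" for i
    define s where "s i = u i \<bullet> z / sqrt (real n)" for i
    obtain r where r: "\<And>i. \<bar>r i\<bar> \<le> \<bar>s i\<bar>"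
      "\<And>i. phi_loss \<rho> \<psi> (v i) (u i \<bullet> \<beta>0 + s i) - phi_loss \<rho> \<psi> (v i) (u i \<bullet> \<beta>0) = score (v i) (u i \<bullet> \<beta>0) * s i + score' (v i) (u i \<bullet> \<beta>0 + r i) / 2 * (s i)\<^sup>2"
    proof -
      have "\<forall>i. \<exists>r. \<bar>r\<bar> \<le> \<bar>s i\<bar> \<and> phi_loss \<rho> \<psi> (v i) (u i \<bullet> \<beta>0 + s i) - phi_loss \<rho> \<psi> (v i) (u i \<bullet> \<beta>0) =
          score (v i) (u i \<bullet> \<beta>0) * s i + score' (v i) (u i \<bullet> \<beta>0 + r) / 2 * (s i)\<^sup>2"
        using phi_loss_Taylor by blast
      from choice[OF this] show ?thesis using that by blast
    qed
    \<comment> \<open>\<open>S0\<close> is the Hessian form at the true parameter, \<open>S1\<close>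
      its change at the intermediate points. Each contributes an error \<open>\<epsilon>\<close>,
      and the factor 1/2 of the second-order term brings the total back to
      \<open>\<epsilon>\<close>.\<close>
    define S0 where "S0 = (1 / real n) * (\<Sum>i<n. score' (v i) (u i \<bullet> \<beta>0) * w (u i) * (u i \<bullet> z)\<^sup>2)"
    define S1 where "S1 = (1 / real n) * (\<Sum>i<n. (score' (v i) (u i \<bullet> \<beta>0 + r i) - score' (v i) (u i \<bullet> \<beta>0)) * w (u i) * (u i \<bullet> z)\<^sup>2)"
    have S0: "\<bar>S0 - z \<bullet> (A *v z)\<bar> \<le> \<epsilon>" using hess z by (simp add: S0_def u_def v_def)
    have S1: "\<bar>S1\<bar> \<le> \<epsilon>" using rem[rule_format, OF z, of r] r(1) by (simp add: S1_def u_def v_def s_def)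
    have S01: "S0 + S1 = (1 / real n) * (\<Sum>i<n. score' (v i) (u i \<bullet> \<beta>0 + r i) * w (u i) * (u i \<bullet> z)\<^sup>2)"
      by (simp add: S0_def S1_def algebra_simps sum_subtractf sum.distrib)
    have "real n * (emp_loss \<rho> \<psi> w (\<lambda>i. Y i \<omega>) (\<lambda>i. X i \<omega>) n (\<beta>0 + (1 / sqrt (real n)) *\<^sub>R z) - emp_loss \<rho> \<psi> w (\<lambda>i. Y i \<omega>) (\<lambda>i. X i \<omega>) n \<beta>0)
      = (\<Sum>i<n. (phi_loss \<rho> \<psi> (v i) (u i \<bullet> \<beta>0 + s i) - phi_loss \<rho> \<psi> (v i) (u i \<bullet> \<beta>0)) * w (u i))"
      using n unfolding emp_loss_def One_nat_def sum.atLeast1_atMost_eq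
      by (simp add: u_def v_def s_def inner_add_right left_diff_distrib right_diff_distrib sum_subtractf)
    also have "\<dots> = (\<Sum>i<n. score (v i) (u i \<bullet> \<beta>0) * s i * w (u i)) + (\<Sum>i<n. score' (v i) (u i \<bullet> \<beta>0 + r i) / 2 * (s i)\<^sup>2 * w (u i))"
      unfolding r(2) by (simp add: distrib_right sum.distrib)
    also have "(\<Sum>i<n. score (v i) (u i \<bullet> \<beta>0) * s i * w (u i)) = z \<bullet> normalized_score n \<omega>"
      by (simp add: normalized_score_def score_vec_def u_def v_def s_def inner_sum_right sum_divide_distrib inner_commute algebra_simps)
    also have "(\<Sum>i<n. score' (v i) (u i \<bullet> \<beta>0 + r i) / 2 * (s i)\<^sup>2 * w (u i)) = 1/2 * (S0 + S1)"
      unfolding S01 s_def using n by (simp add: sum_distrib_left power_divide sum_divide_distrib algebra_simps)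
    finally have eq: "real n * (emp_loss \<rho> \<psi> w (\<lambda>i. Y i \<omega>) (\<lambda>i. X i \<omega>) n (\<beta>0 + (1 / sqrt (real n)) *\<^sub>R z)
        - emp_loss \<rho> \<psi> w (\<lambda>i. Y i \<omega>) (\<lambda>i. X i \<omega>) n \<beta>0) = z \<bullet> normalized_score n \<omega> + 1/2 * (S0 + S1)" .
    show "\<bar>real n * (emp_loss \<rho> \<psi> w (\<lambda>i. Y i \<omega>) (\<lambda>i. X i \<omega>) n (\<beta>0 + (1 / sqrt (real n)) *\<^sub>R z)
        - emp_loss \<rho> \<psi> w (\<lambda>i. Y i \<omega>) (\<lambda>i. X i \<omega>) n \<beta>0)
      - z \<bullet> normalized_score n \<omega> - 1/2 * (z \<bullet> (A *v z))\<bar> \<le> \<epsilon>"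
      unfolding eq using S0 S1 by (simp add: abs_le_iff field_simps)
  qed simp
qed

end

section \<open>Asymptotic distribution\<close>

context logistic_sample
begin

lemma objective_expansion:
  assumes alpha: "0 \<le> \<alpha>" "\<alpha> \<le> 1"
    and J: "\<And>k t. t \<ge> 0 \<Longrightarrow> (J k has_real_derivative J' k t) (at t within {0..})"
    and J0: "\<And>k. J' k 0 = 0"
    and lam: "\<And>n. n \<ge> 1 \<Longrightarrow> lam n \<in> borel_measurable M" "conv_in_prob M (\<lambda>n \<omega>. sqrt (real n) * lam n \<omega>) b"
    and pos: "\<epsilon> > 0" "\<eta> > 0"
  shows "likely M \<eta> (\<lambda>n \<omega>. \<forall>z. norm z \<le> K \<longrightarrow>
    \<bar>real n * (emp_loss \<rho> \<psi> w (\<lambda>i. Y i \<omega>) (\<lambda>i. X i \<omega>) n (\<beta>0 + (1 / sqrt (real n)) *\<^sub>R z) + penalty \<alpha> J (lam n \<omega>) (\<beta>0 + (1 / sqrt (real n)) *\<^sub>R z)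
        - (emp_loss \<rho> \<psi> w (\<lambda>i. Y i \<omega>) (\<lambda>i. X i \<omega>) n \<beta>0 + penalty \<alpha> J (lam n \<omega>) \<beta>0))
      - R_proc A b \<alpha> J' \<beta>0 (normalized_score n \<omega>) z\<bar> \<le> \<epsilon>)"
proof -
  have "continuous_on (cball 0 K) (\<lambda>z. z \<bullet> q_vec \<alpha> J' \<beta>0 z)"
    unfolding inner_q_vec by (intro continuous_intros)
  then have "bounded ((\<lambda>z. z \<bullet> q_vec \<alpha> J' \<beta>0 z) ` cball 0 K)"
    by (intro compact_imp_bounded compact_continuous_image) auto
  then obtain Q where Q: "Q > 0" "\<And>z. norm z \<le> K \<Longrightarrow> \<bar>z \<bullet> q_vec \<alpha> J' \<beta>0 z\<bar> \<le> Q"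
    unfolding bounded_pos by (metis imageI mem_cball_0 real_norm_def)
  \<comment> \<open>Expanding the penalty costs \<open>(\<bar>b\<bar> + 1) * e\<close>, where the
    cap \<open>e \<le> 1\<close> bounds the rescaled tuning parameter, and replacing that parameter
    by \<open>b\<close> costs \<open>e * Q\<close>. Together they use one half of
    \<open>\<epsilon>\<close>; the loss uses the other.\<close>
  define e where "e = min 1 (\<epsilon> / 2 / (\<bar>b\<bar> + 1 + Q))"
  have e: "e > 0" "e \<le> 1" using pos Q by (auto simp: e_def add_nonneg_pos intro!: divide_pos_pos)
  have "e \<le> \<epsilon> / 2 / (\<bar>b\<bar> + 1 + Q)" by (simp add: e_def)
  then have eb: "(\<bar>b\<bar> + 1 + Q) * e \<le> \<epsilon> / 2"
    using Q(1) by (subst (asm) pos_le_divide_eq) (simp_all only: mult.commute add_nonneg_pos abs_ge_zero zero_less_one add_pos_pos)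
  have meas: "(\<lambda>\<omega>. sqrt (real n) * lam n \<omega>) \<in> borel_measurable M" if "n \<ge> 1" for n
    using lam(1)[OF that] by measurable
  have half: "\<epsilon> / 2 > 0" "\<eta> / 2 > 0" using pos by auto
  from likely_conj[OF loss_expansion[OF half, of K] conv_in_prob_likely[OF lam(2) meas e(1) half(2)] finite_measure_axioms]
  show ?thesis
  proof (rule likely_mono)
    have "\<forall>\<^sub>F n in sequentially. \<forall>z l. norm z \<le> K \<longrightarrow>
          \<bar>real n * (penalty \<alpha> J l (\<beta>0 + (1 / sqrt (real n)) *\<^sub>R z) - penalty \<alpha> J l \<beta>0)
            - sqrt (real n) * l * (z \<bullet> q_vec \<alpha> J' \<beta>0 z)\<bar> \<le> sqrt (real n) * \<bar>l\<bar> * e"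
      by (rule penalty_expansion[OF alpha J J0 e(1)])
    then show "\<forall>\<^sub>F n in sequentially. \<forall>\<omega>\<in>space M.
      (\<forall>z. norm z \<le> K \<longrightarrow>
        \<bar>real n * (emp_loss \<rho> \<psi> w (\<lambda>i. Y i \<omega>) (\<lambda>i. X i \<omega>) n (\<beta>0 + (1 / sqrt (real n)) *\<^sub>R z)
            - emp_loss \<rho> \<psi> w (\<lambda>i. Y i \<omega>) (\<lambda>i. X i \<omega>) n \<beta>0)
          - z \<bullet> normalized_score n \<omega> - 1/2 * (z \<bullet> (A *v z))\<bar> \<le> \<epsilon> / 2) \<and> dist (sqrt (real n) * lam n \<omega>) b \<le> e \<longrightarrow>
      (\<forall>z. norm z \<le> K \<longrightarrow>
        \<bar>real n * (emp_loss \<rho> \<psi> w (\<lambda>i. Y i \<omega>) (\<lambda>i. X i \<omega>) n (\<beta>0 + (1 / sqrt (real n)) *\<^sub>R z) + penalty \<alpha> J (lam n \<omega>) (\<beta>0 + (1 / sqrt (real n)) *\<^sub>R z)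
            - (emp_loss \<rho> \<psi> w (\<lambda>i. Y i \<omega>) (\<lambda>i. X i \<omega>) n \<beta>0 + penalty \<alpha> J (lam n \<omega>) \<beta>0))
          - R_proc A b \<alpha> J' \<beta>0 (normalized_score n \<omega>) z\<bar> \<le> \<epsilon>)"
    proof (eventually_elim, intro ballI impI allI, elim conjE)
      fix n \<omega> and z :: "real^'p"
      assume pen: "\<forall>z l. norm z \<le> K \<longrightarrow>
          \<bar>real n * (penalty \<alpha> J l (\<beta>0 + (1 / sqrt (real n)) *\<^sub>R z) - penalty \<alpha> J l \<beta>0)
            - sqrt (real n) * l * (z \<bullet> q_vec \<alpha> J' \<beta>0 z)\<bar> \<le> sqrt (real n) * \<bar>l\<bar> * e"
        and loss: "\<forall>z. norm z \<le> K \<longrightarrow>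
          \<bar>real n * (emp_loss \<rho> \<psi> w (\<lambda>i. Y i \<omega>) (\<lambda>i. X i \<omega>) n (\<beta>0 + (1 / sqrt (real n)) *\<^sub>R z)
              - emp_loss \<rho> \<psi> w (\<lambda>i. Y i \<omega>) (\<lambda>i. X i \<omega>) n \<beta>0)
            - z \<bullet> normalized_score n \<omega> - 1/2 * (z \<bullet> (A *v z))\<bar> \<le> \<epsilon> / 2"
        and l: "dist (sqrt (real n) * lam n \<omega>) b \<le> e" and z: "norm z \<le> K"
      define L1 L0 P1 P0 l where "L1 = emp_loss \<rho> \<psi> w (\<lambda>i. Y i \<omega>) (\<lambda>i. X i \<omega>) n (\<beta>0 + (1 / sqrt (real n)) *\<^sub>R z)"
        and "L0 = emp_loss \<rho> \<psi> w (\<lambda>i. Y i \<omega>) (\<lambda>i. X i \<omega>) n \<beta>0"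
        and "P1 = penalty \<alpha> J (lam n \<omega>) (\<beta>0 + (1 / sqrt (real n)) *\<^sub>R z)"
        and "P0 = penalty \<alpha> J (lam n \<omega>) \<beta>0"
        and "l = sqrt (real n) * lam n \<omega>"
      define q where "q = z \<bullet> q_vec \<alpha> J' \<beta>0 z"
      have lb: "\<bar>l - b\<bar> \<le> e" using l by (simp add: l_def dist_real_def)
      have "\<bar>real n * (P1 - P0) - l * q\<bar> \<le> \<bar>l\<bar> * e"
        using pen[rule_format, OF z, of "lam n \<omega>"] by (simp add: P1_def P0_def l_def q_def abs_mult)
      also have "\<dots> \<le> (\<bar>b\<bar> + 1) * e" using lb e by (intro mult_right_mono) auto
      finally have 1: "\<bar>real n * (P1 - P0) - l * q\<bar> \<le> (\<bar>b\<bar> + 1) * e" .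
      have 2: "\<bar>l * q - b * q\<bar> \<le> e * Q"
        using mult_mono[OF lb Q(2)[OF z]] e by (simp add: q_def abs_mult flip: left_diff_distrib)
      have 3: "(\<bar>b\<bar> + 1) * e + e * Q \<le> \<epsilon> / 2" using eb by (simp add: algebra_simps)
      have 4: "\<bar>real n * (L1 - L0) - z \<bullet> normalized_score n \<omega> - 1/2 * (z \<bullet> (A *v z))\<bar> \<le> \<epsilon> / 2"
        using loss z unfolding L1_def L0_def by blast
      have "real n * (L1 + P1 - (L0 + P0)) - R_proc A b \<alpha> J' \<beta>0 (normalized_score n \<omega>) z
         = (real n * (L1 - L0) - z \<bullet> normalized_score n \<omega> - 1/2 * (z \<bullet> (A *v z)))
          + (real n * (P1 - P0) - l * q) + (l * q - b * q)"
        by (simp add: R_proc_def q_def algebra_simps)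
      then have "\<bar>real n * (L1 + P1 - (L0 + P0)) - R_proc A b \<alpha> J' \<beta>0 (normalized_score n \<omega>) z\<bar> \<le> \<epsilon>"
        using 1 2 3 4 by linarith
      then show "\<bar>real n * (emp_loss \<rho> \<psi> w (\<lambda>i. Y i \<omega>) (\<lambda>i. X i \<omega>) n (\<beta>0 + (1 / sqrt (real n)) *\<^sub>R z) + penalty \<alpha> J (lam n \<omega>) (\<beta>0 + (1 / sqrt (real n)) *\<^sub>R z)
            - (emp_loss \<rho> \<psi> w (\<lambda>i. Y i \<omega>) (\<lambda>i. X i \<omega>) n \<beta>0 + penalty \<alpha> J (lam n \<omega>) \<beta>0))
          - R_proc A b \<alpha> J' \<beta>0 (normalized_score n \<omega>) z\<bar> \<le> \<epsilon>"
        unfolding L1_def L0_def P1_def P0_def .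
    qed
  qed (use pos in auto)
qed

end

text \<open>If \<open>b\<close> were negative, lying within \<open>- b / 2\<close> of it would
  contradict nonnegativity, yet for some \<open>n\<close> both hold off an event of probability at
  most 1/2, whose complement is not empty.\<close>

lemma (in prob_space) conv_in_prob_nonneg:
  assumes "conv_in_prob M X b" "\<And>n. n \<ge> 1 \<Longrightarrow> X n \<in> borel_measurable M"
    and "\<And>n. n \<ge> 1 \<Longrightarrow> AE \<omega> in M. X n \<omega> \<ge> (0::real)"
  shows "b \<ge> 0"
proof (rule ccontr)
  assume "\<not> b \<ge> 0"
  then have "likely M (1/2 + 0) (\<lambda>n \<omega>. dist (X n \<omega>) b \<le> - b / 2 \<and> X n \<omega> \<ge> 0)"
    by (intro likely_conj conv_in_prob_likely[OF assms(1,2)] likely_AE assms(3) finite_measure_axioms) auto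
  then obtain n S where S: "S \<in> sets M" "prob S \<le> 1/2"
      "\<forall>\<omega>\<in>space M - S. dist (X n \<omega>) b \<le> - b / 2 \<and> X n \<omega> \<ge> 0"
    unfolding likely_def by (auto dest: eventually_happens'[OF sequentially_bot])
  have "\<not> (dist r b \<le> - b / 2 \<and> r \<ge> 0)" for r
    using \<open>\<not> b \<ge> 0\<close> by (auto simp: dist_real_def)
  with S(3) have "space M \<subseteq> S" by blast
  then have "S = space M" using sets.sets_into_space[OF S(1)] by blast
  then show False using S(2) prob_space by simp
qed

lemma (in smooth_loss) nu_nonneg:
  assumes "mono_on {0..} \<rho>" shows "nu \<psi> t \<ge> 0"
proof -
  have "\<psi> s \<ge> 0" if "s > 0" for s
    by (rule mono_on_imp_deriv_nonneg[OF assms rho_DERIV[OF that]]) (use that in \<open>simp add: interior_real_atLeast\<close>)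
  then show ?thesis
    unfolding nu_def using logistic_bounds[of t] neg_ln_logistic_pos[of t] by (intro add_nonneg_nonneg mult_nonneg_nonneg) auto
qed

theorem theorem5p4:
  fixes M :: "'a measure" and N :: "'b measure"
    and y :: "'a \<Rightarrow> real" and x :: "'a \<Rightarrow> real^'p"
    and Y :: "nat \<Rightarrow> 'a \<Rightarrow> real" and X :: "nat \<Rightarrow> 'a \<Rightarrow> real^'p"
    and \<beta>0 :: "real^'p" and \<beta>hat :: "nat \<Rightarrow> 'a \<Rightarrow> real^'p" and lam :: "nat \<Rightarrow> 'a \<Rightarrow> real"
    and \<rho> \<psi> \<psi>' :: "real \<Rightarrow> real" and w :: "real^'p \<Rightarrow> real"
    and J J' :: "'p \<Rightarrow> real \<Rightarrow> real" and \<alpha> b :: real and W :: "'b \<Rightarrow> real^'p"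
  defines "A \<equiv> A_mat M x \<psi> w \<beta>0" and "B \<equiv> B_mat M x \<psi> w \<beta>0"
  assumes "prob_space M"
    \<comment> \<open>the logistic model and the i.i.d. sample\<close>
    and y_meas: "y \<in> borel_measurable M" and x_meas: "x \<in> borel_measurable M"
    and y_binary: "AE \<omega> in M. y \<omega> \<in> {0, 1}"
    and model: "AE \<omega> in M. real_cond_exp M (vimage_algebra (space M) x borel)
                  (indicator {\<omega> \<in> space M. y \<omega> = 1}) \<omega> = logistic (x \<omega> \<bullet> \<beta>0)"
    and indep: "prob_space.indep_vars M (\<lambda>_. borel) (\<lambda>i \<omega>. (Y i \<omega>, X i \<omega>)) {1..}"
    and ident: "\<And>i. i \<ge> 1 \<Longrightarrow>
                  distr M borel (\<lambda>\<omega>. (Y i \<omega>, X i \<omega>)) = distr M borel (\<lambda>\<omega>. (y \<omega>, x \<omega>))"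
    \<comment> \<open>the loss, including (R3)\<close>
    and rho_bounded: "bounded (\<rho> ` {0..})" and rho_mono: "mono_on {0..} \<rho>"
    and rho_deriv: "\<And>t. t \<ge> 0 \<Longrightarrow> (\<rho> has_real_derivative \<psi> t) (at t within {0..})"
    and psi_deriv: "\<And>t. t \<ge> 0 \<Longrightarrow> (\<psi> has_real_derivative \<psi>' t) (at t within {0..})"
    and psi'_cont: "continuous_on {0..} \<psi>'"
    and psi_bounded: "bounded (\<psi> ` {0..})" and psi'_bounded: "bounded (\<psi>' ` {0..})"
    \<comment> \<open>the penalty\<close>
    and alpha: "0 \<le> \<alpha>" "\<alpha> \<le> 1"
    and J_deriv: "\<And>k t. t \<ge> 0 \<Longrightarrow> (J k has_real_derivative J' k t) (at t within {0..})"
    and J'_cont: "\<And>k. continuous_on {0..} (J' k)" and J'_0: "\<And>k. J' k 0 = 0"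
    and lam_meas: "\<And>n. n \<ge> 1 \<Longrightarrow> lam n \<in> borel_measurable M"
    and lam_pos: "\<And>n. n \<ge> 1 \<Longrightarrow> AE \<omega> in M. lam n \<omega> > 0"
    \<comment> \<open>the estimator\<close>
    and betahat_meas: "\<And>n. n \<ge> 1 \<Longrightarrow> \<beta>hat n \<in> borel_measurable M"
    and betahat_argmin: "\<And>n. n \<ge> 1 \<Longrightarrow> AE \<omega> in M.
          is_arg_min (\<lambda>\<beta>. emp_loss \<rho> \<psi> w (\<lambda>i. Y i \<omega>) (\<lambda>i. X i \<omega>) n \<beta> + penalty \<alpha> J (lam n \<omega>) \<beta>)
            (\<lambda>_. True) (\<beta>hat n \<omega>)"
    \<comment> \<open>(H2), (H3), (H4)\<close>
    and w_meas: "w \<in> borel_measurable borel" and w_nonneg: "\<And>u. w u \<ge> 0"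
    and w_bounded: "bounded (range w)" and w_norm: "(SUP u. \<bar>w u\<bar>) = 1"
    and w_supp: "measure M {\<omega> \<in> space M. x \<omega> \<in> {u. w u > 0}} > 0"
    and H3: "integrable M (\<lambda>\<omega>. w (x \<omega>) * (norm (x \<omega>))\<^sup>2)"
    and H4: "invertible A"
    \<comment> \<open>rates\<close>
    and root_n: "bounded_in_prob M (\<lambda>n \<omega>. sqrt (real n) *\<^sub>R (\<beta>hat n \<omega> - \<beta>0))"
    and lam_lim: "conv_in_prob M (\<lambda>n \<omega>. sqrt (real n) * lam n \<omega>) b"
    and beta0: "norm \<beta>0 \<noteq> 0"
    \<comment> \<open>the Gaussian vector in the limiting process\<close>
    and "prob_space N" and gauss: "centred_gaussian N W B"
  shows "(\<forall>\<omega>\<in>space N. \<exists>!z. is_arg_min (R_proc A b \<alpha> J' \<beta>0 (W \<omega>)) (\<lambda>_. True) z) \<and>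
         conv_in_distr M (\<lambda>n \<omega>. sqrt (real n) *\<^sub>R (\<beta>hat n \<omega> - \<beta>0))
           N (\<lambda>\<omega>. arg_min (R_proc A b \<alpha> J' \<beta>0 (W \<omega>)) (\<lambda>_. True))"
proof -
  interpret N: prob_space N by fact
  have w_le: "w u \<le> 1" for u
    using cSUP_upper[of u UNIV "\<lambda>u. \<bar>w u\<bar>"] w_bounded w_norm
    by (force simp: bounded_iff bdd_above_def)
  interpret S: logistic_sample M \<rho> \<psi> \<psi>' y x Y X \<beta>0 w
    by (intro logistic_sample.intro smooth_loss.intro logistic_sample_axioms.intro; fact)
  obtain c where c: "c > 0" "\<And>z. z \<bullet> (A *v z) \<ge> c * (norm z)\<^sup>2"
    using S.A_coercive[OF S.nu_nonneg[OF rho_mono]] H4 unfolding A_def by metis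
  have lam_meas': "(\<lambda>\<omega>. sqrt (real n) * lam n \<omega>) \<in> borel_measurable M" if "n \<ge> 1" for n
    using lam_meas[OF that] by measurable
  have b: "b \<ge> 0"
  proof (rule S.conv_in_prob_nonneg[OF lam_lim lam_meas'])
    show "AE \<omega> in M. sqrt (real n) * lam n \<omega> \<ge> 0" if "n \<ge> 1" for n
      using lam_pos[OF that] by eventually_elim simp
  qed
  define m where "m v = arg_min (R_proc A b \<alpha> J' \<beta>0 v) (\<lambda>_. True)" for v
  note R = b alpha(1) c
  have m: "is_arg_min (R_proc A b \<alpha> J' \<beta>0 v) (\<lambda>_. True) (m v)" for v
    unfolding m_def by (rule R_proc_arg_min[OF R])
  have m_cont: "continuous_on UNIV m"
    unfolding m_def[abs_def] by (rule continuous_arg_min_R_proc[OF R])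
  define V where "V = S.normalized_score"
  have conv: "conv_in_distr M (\<lambda>n \<omega>. m (V n \<omega>)) N (\<lambda>\<omega>. m (W \<omega>))"
    unfolding V_def
    by (rule conv_in_distr_continuous[OF S.normalized_score_conv[OF \<open>prob_space N\<close> gauss[unfolded B_def]] m_cont])
  define Z where "Z n \<omega> = sqrt (real n) *\<^sub>R (\<beta>hat n \<omega> - \<beta>0)" for n \<omega>
  have Z_meas: "Z n \<in> borel_measurable M" if "n \<ge> 1" for n
    using betahat_meas[OF that] unfolding Z_def[abs_def] by measurable
  have mV_meas: "(\<lambda>\<omega>. m (V n \<omega>)) \<in> borel_measurable M" for n
    using measurable_compose[OF S.normalized_score_meas borel_measurable_continuous_onI[OF m_cont]]
    by (simp add: V_def)
  have "conv_in_distr M Z N (\<lambda>\<omega>. m (W \<omega>))"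
  proof (rule slutsky[OF \<open>prob_space M\<close> \<open>prob_space N\<close> mV_meas Z_meas conv])
    fix \<epsilon> \<eta> :: real assume pos: "\<epsilon> > 0" "\<eta> > 0"
    then have \<eta>: "\<eta> / 3 > 0" by simp
    obtain K1 where K1: "likely M (\<eta> / 3) (\<lambda>n \<omega>. norm (Z n \<omega>) \<le> K1)"
      using bounded_in_prob_likely[OF root_n Z_meas[unfolded Z_def[abs_def]] \<eta>] unfolding Z_def by blast
    obtain K2 where K2: "likely M (\<eta> / 3) (\<lambda>n \<omega>. norm (m (V n \<omega>)) \<le> K2)"
      using conv_in_distr_tight[OF \<open>prob_space M\<close> \<open>prob_space N\<close> mV_meas conv \<eta>] by blast
    \<comment> \<open>The approximation is used at two points, so minimality of
      \<open>\<beta>hat\<close> bounds the gap of the limiting process by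
      \<open>2 * \<delta>\<close>. Growth with constant \<open>c / 4\<close> then gives a squared
      distance of at most \<open>8 * \<delta> / c\<close>.\<close>
    define \<delta> where "\<delta> = c * \<epsilon>\<^sup>2 / 8"
    have \<delta>: "\<delta> > 0" using c pos by (simp add: \<delta>_def)
    define obj where "obj n \<omega> \<beta> = emp_loss \<rho> \<psi> w (\<lambda>i. Y i \<omega>) (\<lambda>i. X i \<omega>) n \<beta> + penalty \<alpha> J (lam n \<omega>) \<beta>" for n \<omega> \<beta>
    have exp: "likely M (\<eta> / 3) (\<lambda>n \<omega>. \<forall>z. norm z \<le> max K1 K2 \<longrightarrow>
       \<bar>real n * (obj n \<omega> (\<beta>0 + (1 / sqrt (real n)) *\<^sub>R z) - obj n \<omega> \<beta>0) - R_proc A b \<alpha> J' \<beta>0 (V n \<omega>) z\<bar> \<le> \<delta>)"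
      unfolding obj_def V_def A_def
      by (rule S.objective_expansion[OF alpha J_deriv J'_0 lam_meas lam_lim \<delta> \<eta>])
    \<comment> \<open>Optimality holds almost surely and gets level 0; the two radii and the
      expansion use up the three thirds of \<open>\<eta>\<close>.\<close>
    have opt: "likely M 0 (\<lambda>n \<omega>. is_arg_min (obj n \<omega>) (\<lambda>_. True) (\<beta>hat n \<omega>))"
      unfolding obj_def by (rule likely_AE[OF betahat_argmin]) auto
    note fm = S.finite_measure_axioms
    show "likely M \<eta> (\<lambda>n \<omega>. dist (Z n \<omega>) (m (V n \<omega>)) \<le> \<epsilon>)"
    proof (rule likely_mono[OF likely_conj[OF likely_conj[OF K1 K2 fm] likely_conj[OF exp opt fm] fm]],
        intro eventually_sequentiallyI[of 1] ballI impI, elim conjE)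
      fix n \<omega> assume n: "1 \<le> n" and Z: "norm (Z n \<omega>) \<le> K1" and mV: "norm (m (V n \<omega>)) \<le> K2"
        and approx: "\<forall>z. norm z \<le> max K1 K2 \<longrightarrow>
          \<bar>real n * (obj n \<omega> (\<beta>0 + (1 / sqrt (real n)) *\<^sub>R z) - obj n \<omega> \<beta>0) - R_proc A b \<alpha> J' \<beta>0 (V n \<omega>) z\<bar> \<le> \<delta>"
        and opt: "is_arg_min (obj n \<omega>) (\<lambda>_. True) (\<beta>hat n \<omega>)"
      define f where "f z = real n * (obj n \<omega> (\<beta>0 + (1 / sqrt (real n)) *\<^sub>R z) - obj n \<omega> \<beta>0)" for z
      \<comment> \<open>The rescaling is undone only for \<open>n \<ge> 1\<close>; it turns global
        minimality of \<open>\<beta>hat\<close> into a comparison of \<open>f\<close> at the two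
        points of the ball.\<close>
      have "\<beta>0 + (1 / sqrt (real n)) *\<^sub>R Z n \<omega> = \<beta>hat n \<omega>" using n by (simp add: Z_def)
      then have "f (Z n \<omega>) \<le> f (m (V n \<omega>))"
        using opt unfolding f_def by (auto simp: is_arg_min_def not_less intro!: mult_left_mono)
      moreover have "\<bar>f z - R_proc A b \<alpha> J' \<beta>0 (V n \<omega>) z\<bar> \<le> \<delta>" if "norm z \<le> max K1 K2" for z
        using approx that unfolding f_def by blast
      from this[of "Z n \<omega>"] this[of "m (V n \<omega>)"] Z mV
      have "\<bar>f (Z n \<omega>) - R_proc A b \<alpha> J' \<beta>0 (V n \<omega>) (Z n \<omega>)\<bar> \<le> \<delta>"
        "\<bar>f (m (V n \<omega>)) - R_proc A b \<alpha> J' \<beta>0 (V n \<omega>) (m (V n \<omega>))\<bar> \<le> \<delta>" by auto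
      ultimately have "c / 4 * (norm (Z n \<omega> - m (V n \<omega>)))\<^sup>2 \<le> 2 * \<delta>"
        using R_proc_growth[OF R m, where v="V n \<omega>" and z="Z n \<omega>"] by linarith
      then have "(norm (Z n \<omega> - m (V n \<omega>)))\<^sup>2 \<le> \<epsilon>\<^sup>2" using c(1) by (simp add: \<delta>_def)
      from power2_le_imp_le[OF this] show "dist (Z n \<omega>) (m (V n \<omega>)) \<le> \<epsilon>"
        using pos by (simp add: dist_norm)
    qed simp
  qed
  from this[unfolded Z_def[abs_def] m_def] R_proc_argmin_unique[OF R] show ?thesis
    by (intro conjI ballI)
qed

end
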